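(* Consider the iterates of algorithm DP-SCC-PL described in the context, under all the assumptions listed there (network, lower boundedness, smoothness, sampling, bounded variance/heterogeneity, P-Ł condition), with the constants defined there. Suppose that the contraction constant satisfies $0\le\rho<\lambda/(4\sqrt{|\mathcal R|})$ such that $\varphi,\eta,\phi\in(0,1)$, and that the decaying step-size $\alpha_k=\underline\theta/(k+k_0)$ is used. Then for $K\ge1$ $$\begin{aligned}\mathbb E f_{K+1}^{\mathrm{best}}-f^*\le{}&\frac{\mathbb E f(\bar x_0)-f^*}{\underline\theta\,\nu(\ln(K+k_0)-\ln k_0)}+\frac{\underline\theta L\sigma^2\sum_{k=0}^K\frac1{(k+k_0)^2}}{\nu(\ln(K+k_0)-\ln k_0)}\\&+\frac{L^2}{\nu}\Big(\frac{96|\mathcal R|\rho^2}{\eta}+\frac1{|\mathcal R|}\Big)\frac{\sum_{k=0}^K\frac1{k+k_0}\mathbb E D_k}{\ln(K+k_0)-\ln k_0}\\&+\frac{8\rho^2}{\nu(1-\eta)\underline\theta^2}\,\frac{\sum_{k=0}^K(k+k_0)\mathbb E D_k}{\ln(K+k_0)-\ln k_0}+\frac{64|\mathcal R|\rho^2}{\nu\eta}(\sigma^2+\zeta^2)\\&+\frac{4n}{\nu}\Big(1+\frac{8|\mathcal R|\rho^2}{\eta}\Big)\varpi^2 .\end{aligned}$$ If the contraction constant further satisfies $0\le\rho<\bar\rho$, then $$\lim_{K\to\infty}\mathbb E f_{K+1}^{\mathrm{best}}-f^*\le\mathcal O\big(\rho^2(\varpi^2+\sigma^2+\zeta^2)+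\varpi^2\big).$$
   Context: **Network.** $\mathcal G=(\mathcal V,\mathcal E)$ is a static undirected network of $m=|\mathcal V|$ agents; $\mathcal V$ is the disjoint union of the set $\mathcal R$ of reliable agents and the set $\mathcal B$ of Byzantine agents. For $i\in\mathcal R$, $\mathcal R_i$ and $\mathcal B_i$ are its sets of reliable and Byzantine neighbors (not including $i$), and $\mathcal N_i=\mathcal R_i\cup\mathcal B_i$. The weight matrix $W=[w_{ij}]\in\mathbb R^{m\times m}$ associated with $\mathcal G$ ($w_{ij}=0$ if $j\ne i$ is not a neighbor of $i$) is nonnegative and doubly stochastic, $W\mathbf 1=\mathbf 1$, $\mathbf 1^\top W=\mathbf 1^\top$, with $w_{ii}>0$ for $i\in\mathcal R$. The reliable agents form a connected undirected network $\mathcal G_{\mathcal R}=(\mathcal R,\mathcal E_{\mathcal R})$. **Problem.** Minimize $f(x)=\frac1{|\mathcal R|}\sum_{i\in\mathcal R}f_i(x)$ over $x\in\mathbb R^n$, where $f_i(x)=\mathbb E_{\xi_i\sim\mathcal D_i}f_i(x,\xi_i)$ and $\mathbb E\nabla f_i(x,\xi_i)=\nabla f_i(x)$. **Assumptions on the objectives.** (Feasibility) $f^*:=\inf_{x\in\mathbb R^n}f(x)>-\infty$. (Smoothness) Each $f_i$, $i\in\mathcal R$, has an $L_i$-Lipschitz gradient, $L_i>0$, so that $f_i(y)-f_i(x)-\langle\nabla f_i(x),y-x\rangle\le\frac{L_i}{2}\|y-x\|_2^2$ for all $x,y$; $L:=\max_{i\in\mathcal R}L_i$. (Sampling) The stochastic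 sampling processes associated with $\{\xi_{i,k}\}_{i\in\mathcal R,k\ge0}$ ($\xi_{i,k}\sim\mathcal D_i$) are independent over iterations $k=0,1,2,\dots$ and over reliable agents; sampling is uniform and without replacement. (Bounded variance and heterogeneity) There are constants $\sigma,\zeta>0$ such that for all $i\in\mathcal R$ and $x\in\mathbb R^n$: $\mathbb E\|\nabla f_i(x,\xi_i)-\nabla f_i(x)\|_2^2\le\sigma^2$ and $\big\|\mathbb E\nabla f_i(x,\xi_i)-\frac1{|\mathcal R|}\sum_{j\in\mathcal R}\mathbb E\nabla f_j(x,\xi_j)\big\|_2^2\le\zeta^2$. (P-Ł condition) For a constant $\nu>0$, $\frac12\|\nabla f(x)\|_2^2\ge\nu(f(x)-f^* )$ for all $x\in\mathbb R^n$. **Self-centered clipping (SCC).** With clipping parameter $\tau_i$, $\mathrm{Clip}\{v,\tau\}=v\cdot\min\{1,\tau/\|v\|_2\}$ and $$SCC_i\{\tilde x_i^i,\{\tilde x_j^i\}_{j\in\mathcal N_i}\}=\sum_{j\in\mathcal N_i\cup\{i\}}w_{ij}\big(\tilde x_i^i+\mathrm{Clip}\{\tilde x_j^i-\tilde x_i^i,\tau_i\}\big).$$ **Algorithm DP-SCC-PL.** Given initial $x_{i,0}\in\mathbb R^n$ and step-sizes $\alpha_k>0$, at each $k\ge 0$ each reliable $i$ computes $\tilde g_i(x_{i,k})=\nabla f_i(x_{i,k},\xi_{i,k})+\tilde n_{i,k}$, where $\tilde n_{i,k}\sim N(0,\tilde\varpi_{i,k}^2\mathbf I)$ is Gaussian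 noise in $\mathbb R^n$ with $0<\tilde\varpi_{i,k}^2\le\varpi_i^2$; sets $\tilde x_{i,k}^i=x_{i,k}-\alpha_k\tilde g_i(x_{i,k})$; sends $\tilde x_{i,k}^j=\tilde x_{i,k}^i$ to all neighbors $j$; receives $\tilde x_{j,k}^i$ from all $j\in\mathcal N_i$; and sets $x_{i,k+1}=SCC_i\{\tilde x_{i,k}^i,\{\tilde x_{j,k}^i\}_{j\in\mathcal N_i}\}$. Byzantine agents send arbitrary vectors, possibly different to different neighbors. $\varpi^2:=\max_{i\in\mathcal R}\varpi_i^2$. **Virtual weight matrix and contraction constant.** $\tilde W=[\tilde w_{ij}]\in\mathbb R^{|\mathcal R|\times|\mathcal R|}$ has $\tilde w_{ii}=w_{ii}+\sum_{j\in\mathcal B_i}w_{ij}$ and $\tilde w_{ij}=w_{ij}$ for $j\ne i$; $\tilde W$ is doubly stochastic. A constant $\rho\ge0$ is a contraction constant of SCC if for all $i\in\mathcal R$ $$\big\|SCC_i(\tilde x_i^i,\{\tilde x_j^i\}_{j\in\mathcal R_i\cup\mathcal B_i})-\hat x_i\big\|_2\le\rho\max_{j\in\mathcal R_i\cup\{i\}}\|\tilde x_j^i-\hat x_i\|_2,\qquad \hat x_i:=\sum_{j\in\mathcal R_i\cup\{i\}}\tilde w_{ij}\tilde x_j^i .$$ It is assumed that $\rho$ is such a constant for the SCC steps of the algorithm. **Constants.** $\lambda:=1-\|\tilde W-\frac1{|\mathcal R|}\mathbf 1\mathbf 1^\top\|_2^2$, $\varphi:=\lambda-4\rho\sqrt{|\mathcal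 R|}$, $\eta:=\varphi/2$, $\phi:=\varphi/(4-\varphi)$, $\theta:=\phi/(4\sqrt3L)$, $\underline\theta:=\min\{\theta,1/\nu\}$, $k_0>2/\phi$, $\bar\rho:=\lambda/(4\sqrt{|\mathcal R|})$. **Error measures.** $\bar x_k:=\frac1{|\mathcal R|}\sum_{i\in\mathcal R}x_{i,k}$; $X_k=[x_{1,k},\dots,x_{|\mathcal R|,k}]^\top\in\mathbb R^{|\mathcal R|\times n}$; $D_k:=\|X_k-\frac1{|\mathcal R|}\mathbf 1\mathbf 1^\top X_k\|_F^2$; $\mathbb E f_{K+1}^{\mathrm{best}}:=\min_{k\in\{1,\dots,K+1\}}\mathbb E f(\bar x_k)$. In $\mathcal O(\cdot)$ the hidden constant does not depend on $\varpi,\sigma,\zeta$; it may depend on $n,|\mathcal R|,L,\nu,\eta,\phi,k_0$. *)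

theory Defs
  imports "HOL-Probability.Probability"
begin

section \<open>General notions\<close>

definition grad :: "('a::real_inner \<Rightarrow> real) \<Rightarrow> 'a \<Rightarrow> 'a" where
  "grad h x = (THE g. GDERIV h x :> g)"

definition spectral_norm :: "'v set \<Rightarrow> ('v \<Rightarrow> 'v \<Rightarrow> real) \<Rightarrow> real" where
  "spectral_norm I A = (SUP u\<in>{u. L2_set u I \<le> 1}. L2_set (\<lambda>i. \<Sum>j\<in>I. A i j * u j) I)"

definition doubly_stochastic :: "'v set \<Rightarrow> ('v \<Rightarrow> 'v \<Rightarrow> real) \<Rightarrow> bool" where
  "doubly_stochastic I A \<longleftrightarrow>
     (\<forall>i\<in>I. \<forall>j\<in>I. A i j \<ge> 0) \<and>
     (\<forall>i\<in>I. (\<Sum>j\<in>I. A i j) = 1) \<and> (\<forall>j\<in>I. (\<Sum>i\<in>I. A i j) = 1)"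

text \<open>The value at \<open>v = 0\<close> is \<open>0\<close>, whatever \<open>\<tau> / 0\<close> is.\<close>

definition clip :: "'a::real_normed_vector \<Rightarrow> real \<Rightarrow> 'a" where
  "clip v \<tau> = min 1 (\<tau> / norm v) *\<^sub>R v"

text \<open>In \<open>scc w N \<tau> i z\<close> the family \<open>z\<close> holds the own vector of agent \<open>i\<close> at index \<open>i\<close>, and at
  index \<open>j \<in> N\<close> the vector received from neighbor \<open>j\<close>.\<close>

definition scc ::
  "('v \<Rightarrow> 'v \<Rightarrow> real) \<Rightarrow> 'v set \<Rightarrow> real \<Rightarrow> 'v \<Rightarrow> ('v \<Rightarrow> 'a::real_normed_vector) \<Rightarrow> 'a" where
  "scc w N \<tau> i z = (\<Sum>j\<in>insert i N. w i j *\<^sub>R (z i + clip (z j - z i) \<tau>))"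

section \<open>Data of a run\<close>

text \<open>Byzantine messages and clipping parameters are random variables, so both may be
  chosen adaptively; \<open>byz_msg k j i\<close> is what Byzantine agent \<open>j\<close> sends to agent \<open>i\<close> at iteration
  \<open>k\<close>. A fixed clipping parameter is the case where \<open>threshold i k\<close> is constant.\<close>

record ('v, 'n::finite, 's, 'w) dp_scc =
  reliable :: "'v set"
  byzantine :: "'v set"
  adj :: "'v \<Rightarrow> 'v \<Rightarrow> bool"
  weight :: "'v \<Rightarrow> 'v \<Rightarrow> real"
  data :: "'v \<Rightarrow> 's measure"
  loss :: "'v \<Rightarrow> real^'n \<Rightarrow> 's \<Rightarrow> real"
  lip :: "'v \<Rightarrow> real"
  probspace :: "'w measure"
  start :: "'v \<Rightarrow> real^'n"
  stepsize :: "nat \<Rightarrow> real"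
  sample :: "'v \<Rightarrow> nat \<Rightarrow> 'w \<Rightarrow> 's"
  noise :: "'v \<Rightarrow> nat \<Rightarrow> 'w \<Rightarrow> real^'n"
  noise_sd :: "'v \<Rightarrow> nat \<Rightarrow> real"
  noise_cap :: "'v \<Rightarrow> real"
  threshold :: "'v \<Rightarrow> nat \<Rightarrow> 'w \<Rightarrow> real"
  byz_msg :: "nat \<Rightarrow> 'v \<Rightarrow> 'v \<Rightarrow> 'w \<Rightarrow> real^'n"

section \<open>Network\<close>

definition agents :: "('v, 'n::finite, 's, 'w) dp_scc \<Rightarrow> 'v set" where
  "agents P = reliable P \<union> byzantine P"

definition nbrs :: "('v, 'n::finite, 's, 'w) dp_scc \<Rightarrow> 'v \<Rightarrow> 'v set" where
  "nbrs P i = {j \<in> agents P. adj P i j}"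

definition rel_nbrs :: "('v, 'n::finite, 's, 'w) dp_scc \<Rightarrow> 'v \<Rightarrow> 'v set" where
  "rel_nbrs P i = nbrs P i \<inter> reliable P"

definition byz_nbrs :: "('v, 'n::finite, 's, 'w) dp_scc \<Rightarrow> 'v \<Rightarrow> 'v set" where
  "byz_nbrs P i = nbrs P i \<inter> byzantine P"

definition virtual_weight :: "('v, 'n::finite, 's, 'w) dp_scc \<Rightarrow> 'v \<Rightarrow> 'v \<Rightarrow> real" where
  "virtual_weight P i j =
     (if j = i then weight P i i + (\<Sum>b\<in>byz_nbrs P i. weight P i b) else weight P i j)"

text \<open>Double stochasticity of the virtual matrix does not follow from that of the weight matrix
  unless the latter is symmetric, hence it is a separate requirement.\<close>

definition network :: "('v, 'n::finite, 's, 'w) dp_scc \<Rightarrow> bool" where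
  "network P \<longleftrightarrow>
     finite (agents P) \<and> reliable P \<noteq> {} \<and> reliable P \<inter> byzantine P = {} \<and>
     (\<forall>i\<in>agents P. \<not> adj P i i) \<and>
     (\<forall>i\<in>agents P. \<forall>j\<in>agents P. adj P i j \<longrightarrow> adj P j i) \<and>
     (\<forall>i\<in>reliable P. \<forall>j\<in>reliable P.
        (\<lambda>a b. a \<in> reliable P \<and> b \<in> reliable P \<and> adj P a b)\<^sup>*\<^sup>* i j) \<and>
     (\<forall>i\<in>agents P. \<forall>j\<in>agents P. j \<noteq> i \<and> \<not> adj P i j \<longrightarrow> weight P i j = 0) \<and>
     doubly_stochastic (agents P) (weight P) \<and>
     (\<forall>i\<in>reliable P. weight P i i > 0) \<and>
     doubly_stochastic (reliable P) (virtual_weight P)"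

section \<open>Objectives\<close>

definition local_obj :: "('v, 'n::finite, 's, 'w) dp_scc \<Rightarrow> 'v \<Rightarrow> real^'n \<Rightarrow> real" where
  "local_obj P i x = (LINT s|data P i. loss P i x s)"

definition obj :: "('v, 'n::finite, 's, 'w) dp_scc \<Rightarrow> real^'n \<Rightarrow> real" where
  "obj P x = (\<Sum>i\<in>reliable P. local_obj P i x) / real (card (reliable P))"

definition opt_val :: "('v, 'n::finite, 's, 'w) dp_scc \<Rightarrow> real" where
  "opt_val P = (INF x. obj P x)"

definition sample_grad :: "('v, 'n::finite, 's, 'w) dp_scc \<Rightarrow> 'v \<Rightarrow> real^'n \<Rightarrow> 's \<Rightarrow> real^'n" where
  "sample_grad P i x s = grad (\<lambda>y. loss P i y s) x"

text \<open>The integrability and measurability conditions only make the expectations below genuine;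
  joint measurability turns the stochastic gradients along the iterates into random variables.\<close>

definition objectives :: "('v, 'n::finite, 's, 'w) dp_scc \<Rightarrow> bool" where
  "objectives P \<longleftrightarrow>
     (\<forall>i\<in>reliable P.
        prob_space (data P i) \<and>
        (\<forall>s\<in>space (data P i). \<forall>x. (\<lambda>y. loss P i y s) differentiable (at x)) \<and>
        (\<lambda>(x, s). sample_grad P i x s) \<in> borel_measurable (borel \<Otimes>\<^sub>M data P i) \<and>
        (\<forall>x. integrable (data P i) (loss P i x)) \<and>
        (\<forall>x. local_obj P i differentiable (at x)) \<and>
        (\<forall>x. has_bochner_integral (data P i) (sample_grad P i x) (grad (local_obj P i) x)))"

definition feasible :: "('v, 'n::finite, 's, 'w) dp_scc \<Rightarrow> bool" where
  "feasible P \<longleftrightarrow> bdd_below (range (obj P))"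

definition smooth :: "('v, 'n::finite, 's, 'w) dp_scc \<Rightarrow> bool" where
  "smooth P \<longleftrightarrow>
     (\<forall>i\<in>reliable P. lip P i > 0 \<and> (lip P i)-lipschitz_on UNIV (grad (local_obj P i)))"

definition bounded_variance_heterogeneity ::
  "('v, 'n::finite, 's, 'w) dp_scc \<Rightarrow> real \<Rightarrow> real \<Rightarrow> bool" where
  "bounded_variance_heterogeneity P \<sigma> \<zeta> \<longleftrightarrow>
     (\<forall>i\<in>reliable P. \<forall>x.
        integrable (data P i) (\<lambda>s. (norm (sample_grad P i x s - grad (local_obj P i) x))\<^sup>2) \<and>
        (LINT s|data P i. (norm (sample_grad P i x s - grad (local_obj P i) x))\<^sup>2) \<le> \<sigma>\<^sup>2 \<and>
        (norm ((LINT s|data P i. sample_grad P i x s) -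
               (1 / real (card (reliable P))) *\<^sub>R
                 (\<Sum>j\<in>reliable P. LINT s|data P j. sample_grad P j x s)))\<^sup>2 \<le> \<zeta>\<^sup>2)"

definition PL_condition :: "('v, 'n::finite, 's, 'w) dp_scc \<Rightarrow> real \<Rightarrow> bool" where
  "PL_condition P \<nu> \<longleftrightarrow> (\<forall>x. (norm (grad (obj P) x))\<^sup>2 / 2 \<ge> \<nu> * (obj P x - opt_val P))"

section \<open>Randomness\<close>

definition sampling :: "('v, 'n::finite, 's, 'w) dp_scc \<Rightarrow> bool" where
  "sampling P \<longleftrightarrow>
     prob_space (probspace P) \<and>
     (\<forall>i\<in>reliable P. \<forall>k. sample P i k \<in> probspace P \<rightarrow>\<^sub>M data P i \<and>
        distr (probspace P) (data P i) (sample P i k) = data P i) \<and>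
     prob_space.indep_vars (probspace P) (\<lambda>(i, k). data P i) (\<lambda>(i, k). sample P i k)
       (reliable P \<times> UNIV)"

text \<open>The product of one-dimensional centred normal densities is the density of
  \<open>N(0, s\<^sup>2 I)\<close>, where \<open>s\<close> is the standard deviation.\<close>

definition gaussian_noise :: "('v, 'n::finite, 's, 'w) dp_scc \<Rightarrow> bool" where
  "gaussian_noise P \<longleftrightarrow>
     (\<forall>i\<in>reliable P. \<forall>k.
        0 < noise_sd P i k \<and> (noise_sd P i k)\<^sup>2 \<le> (noise_cap P i)\<^sup>2 \<and>
        distributed (probspace P) lborel (noise P i k)
          (\<lambda>v. ennreal (\<Prod>c\<in>UNIV. normal_density 0 (noise_sd P i k) (v $ c))))"

text \<open>\<open>F k\<close> is the information available before iteration \<open>k\<close>. Byzantine messages are arbitrary,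
  and may depend on everything drawn up to and including the current iteration, but cannot
  anticipate the samples and noises of later iterations.\<close>

definition nonanticipating :: "('v, 'n::finite, 's, 'w) dp_scc \<Rightarrow> bool" where
  "nonanticipating P \<longleftrightarrow> (\<exists>F :: nat \<Rightarrow> 'w measure.
     filtration (space (probspace P)) F \<and>
     (\<forall>k. subalgebra (probspace P) (F k)) \<and>
     (\<forall>k. \<forall>i\<in>reliable P.
        sample P i k \<in> F (Suc k) \<rightarrow>\<^sub>M data P i \<and>
        noise P i k \<in> F (Suc k) \<rightarrow>\<^sub>M borel \<and>
        threshold P i k \<in> F (Suc k) \<rightarrow>\<^sub>M borel \<and>
        (\<forall>j\<in>byz_nbrs P i. byz_msg P k j i \<in> F (Suc k) \<rightarrow>\<^sub>M borel)) \<and>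
     (\<forall>k. prob_space.indep_set (probspace P) (sets (F k))
        (sets (vimage_algebra (space (probspace P))
          (\<lambda>\<omega>. \<lambda>i\<in>reliable P. (sample P i k \<omega>, noise P i k \<omega>))
          (\<Pi>\<^sub>M i\<in>reliable P. data P i \<Otimes>\<^sub>M borel)))))"

section \<open>Algorithm\<close>

definition half_step ::
  "('v, 'n::finite, 's, 'w) dp_scc \<Rightarrow> nat \<Rightarrow> 'w \<Rightarrow> ('v \<Rightarrow> real^'n) \<Rightarrow> 'v \<Rightarrow> real^'n" where
  "half_step P k \<omega> x i =
     x i - stepsize P k *\<^sub>R (sample_grad P i (x i) (sample P i k \<omega>) + noise P i k \<omega>)"

text \<open>\<open>messages P k \<omega> x i j\<close> is the vector agent \<open>i\<close> has from agent \<open>j\<close> (or its own one,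
  if \<open>j = i\<close>) when the reliable agents are in state \<open>x\<close>.\<close>

definition messages ::
  "('v, 'n::finite, 's, 'w) dp_scc \<Rightarrow> nat \<Rightarrow> 'w \<Rightarrow> ('v \<Rightarrow> real^'n) \<Rightarrow> 'v \<Rightarrow> 'v \<Rightarrow> real^'n" where
  "messages P k \<omega> x i j =
     (if j \<in> reliable P then half_step P k \<omega> x j else byz_msg P k j i \<omega>)"

definition scc_step ::
  "('v, 'n::finite, 's, 'w) dp_scc \<Rightarrow> nat \<Rightarrow> 'w \<Rightarrow> ('v \<Rightarrow> real^'n) \<Rightarrow> 'v \<Rightarrow> real^'n" where
  "scc_step P k \<omega> x i =
     scc (weight P) (nbrs P i) (threshold P i k \<omega>) i (messages P k \<omega> x i)"

primrec iterate :: "('v, 'n::finite, 's, 'w) dp_scc \<Rightarrow> nat \<Rightarrow> 'w \<Rightarrow> 'v \<Rightarrow> real^'n" where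
  "iterate P 0 \<omega> = start P"
| "iterate P (Suc k) \<omega> = scc_step P k \<omega> (iterate P k \<omega>)"

definition nonneg_thresholds :: "('v, 'n::finite, 's, 'w) dp_scc \<Rightarrow> bool" where
  "nonneg_thresholds P \<longleftrightarrow>
     (\<forall>i\<in>reliable P. \<forall>k. \<forall>\<omega>\<in>space (probspace P). 0 \<le> threshold P i k \<omega>)"

definition virtual_avg ::
  "('v, 'n::finite, 's, 'w) dp_scc \<Rightarrow> ('v \<Rightarrow> real^'n) \<Rightarrow> 'v \<Rightarrow> real^'n" where
  "virtual_avg P z i = (\<Sum>j\<in>insert i (rel_nbrs P i). virtual_weight P i j *\<^sub>R z j)"

definition contraction_const :: "('v, 'n::finite, 's, 'w) dp_scc \<Rightarrow> real \<Rightarrow> bool" where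
  "contraction_const P \<rho> \<longleftrightarrow>
     (\<forall>i\<in>reliable P. \<forall>k. AE \<omega> in probspace P.
        (let z = messages P k \<omega> (iterate P k \<omega>) i; xhat = virtual_avg P z i in
         norm (scc (weight P) (nbrs P i) (threshold P i k \<omega>) i z - xhat)
           \<le> \<rho> * Max ((\<lambda>j. norm (z j - xhat)) ` insert i (rel_nbrs P i))))"

section \<open>Constants and error measures\<close>

definition lip_max :: "('v, 'n::finite, 's, 'w) dp_scc \<Rightarrow> real" where
  "lip_max P = Max (lip P ` reliable P)"

definition noise_max_sq :: "('v, 'n::finite, 's, 'w) dp_scc \<Rightarrow> real" where
  "noise_max_sq P = Max ((\<lambda>i. (noise_cap P i)\<^sup>2) ` reliable P)"

definition lambda_const :: "('v, 'n::finite, 's, 'w) dp_scc \<Rightarrow> real" where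
  "lambda_const P = 1 - (spectral_norm (reliable P)
     (\<lambda>i j. virtual_weight P i j - 1 / real (card (reliable P))))\<^sup>2"

definition varphi_const :: "('v, 'n::finite, 's, 'w) dp_scc \<Rightarrow> real \<Rightarrow> real" where
  "varphi_const P \<rho> = lambda_const P - 4 * \<rho> * sqrt (real (card (reliable P)))"

definition eta_const :: "('v, 'n::finite, 's, 'w) dp_scc \<Rightarrow> real \<Rightarrow> real" where
  "eta_const P \<rho> = varphi_const P \<rho> / 2"

definition phi_const :: "('v, 'n::finite, 's, 'w) dp_scc \<Rightarrow> real \<Rightarrow> real" where
  "phi_const P \<rho> = varphi_const P \<rho> / (4 - varphi_const P \<rho>)"

definition theta_const :: "('v, 'n::finite, 's, 'w) dp_scc \<Rightarrow> real \<Rightarrow> real" where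
  "theta_const P \<rho> = phi_const P \<rho> / (4 * sqrt 3 * lip_max P)"

definition theta_low :: "('v, 'n::finite, 's, 'w) dp_scc \<Rightarrow> real \<Rightarrow> real \<Rightarrow> real" where
  "theta_low P \<rho> \<nu> = min (theta_const P \<rho>) (1 / \<nu>)"

definition rho_bar :: "('v, 'n::finite, 's, 'w) dp_scc \<Rightarrow> real" where
  "rho_bar P = lambda_const P / (4 * sqrt (real (card (reliable P))))"

definition mean_iterate :: "('v, 'n::finite, 's, 'w) dp_scc \<Rightarrow> nat \<Rightarrow> 'w \<Rightarrow> real^'n" where
  "mean_iterate P k \<omega> =
     (1 / real (card (reliable P))) *\<^sub>R (\<Sum>i\<in>reliable P. iterate P k \<omega> i)"

text \<open>Squared Frobenius norm, computed row by row: the row of index \<open>i\<close> is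
  \<open>iterate P k \<omega> i - mean_iterate P k \<omega>\<close>.\<close>

definition disagreement :: "('v, 'n::finite, 's, 'w) dp_scc \<Rightarrow> nat \<Rightarrow> 'w \<Rightarrow> real" where
  "disagreement P k \<omega> = (\<Sum>i\<in>reliable P. (norm (iterate P k \<omega> i - mean_iterate P k \<omega>))\<^sup>2)"

definition exp_obj :: "('v, 'n::finite, 's, 'w) dp_scc \<Rightarrow> nat \<Rightarrow> real" where
  "exp_obj P k = (LINT \<omega>|probspace P. obj P (mean_iterate P k \<omega>))"

definition exp_disagreement :: "('v, 'n::finite, 's, 'w) dp_scc \<Rightarrow> nat \<Rightarrow> real" where
  "exp_disagreement P k = (LINT \<omega>|probspace P. disagreement P k \<omega>)"

definition exp_obj_best :: "('v, 'n::finite, 's, 'w) dp_scc \<Rightarrow> nat \<Rightarrow> real" where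
  "exp_obj_best P k = Min (exp_obj P ` {1..k})"

end

theory Submission
  imports Defs
begin

text \<open>
  Split one iteration in two: every reliable agent takes a noisy gradient step, and then clipping
  aggregates the messages. The contraction constant says that aggregation is averaging with the
  doubly stochastic virtual matrix up to an error of size \<open>\<rho>\<close> times the diameter of the half
  iterates, whatever the Byzantine agents send. Averaging preserves the mean of the reliable agents,
  so the mean follows an inexact gradient step on the global objective, and the squared diameter is
  at most twice the spread (the squared Frobenius distance to consensus). The spread of the half
  iterates is in turn controlled by the disagreement \<open>D\<close>, the heterogeneity and the two noises
  (\<open>spread_half_le\<close>).

  Two inequalities in expectation follow. For the objective (\<open>exp_obj_step\<close>), smoothness and the
  P-L condition give a decrease by \<open>\<alpha> \<nu> (f - f*)\<close>, up to errors of order \<open>\<alpha>\<^sup>2\<close> from the noise, of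
  order \<open>\<alpha> D\<close> from the disagreement, and \<open>\<rho>\<^sup>2 / \<alpha>\<close> times the spread of the half iterates from the
  aggregation. The noise enters linearly only through its inner product with the gradient at the
  mean, whose expectation vanishes because fresh samples and noises are independent of the past.
  For the disagreement (\<open>exp_disagreement_step\<close>), mixing shrinks it by the squared spectral norm of
  the virtual matrix minus the averaging matrix, and the assumption on \<open>\<rho>\<close> leaves a contraction factor \<open>1 - \<phi>\<close> after the
  aggregation error is added.

  Summing the first inequality bounds the best gap times the sum of the step-sizes
  (\<open>best_gap_le\<close>), and this sum grows like \<open>\<theta> ln K\<close>; this is the first claim. The second inequality
  with \<open>\<alpha> = \<theta> / (k + k0)\<close> bounds \<open>(k + k0)\<^sup>2 E D\<close> by a geometrically decaying term plus the
  constant \<open>floor_level\<close> (\<open>scaled_disagreement_le\<close>), where \<open>k0 > 2 / \<phi>\<close> makes the growth of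
  \<open>(k + k0)\<^sup>2\<close> slower than the contraction. Hence the three sums in the first claim are bounded,
  except that the one weighted by \<open>k + k0\<close> is at most a constant plus \<open>floor_level\<close> times the logarithm. After
  division by the logarithm only terms of order \<open>\<rho>\<^sup>2 (\<varpi>\<^sup>2 + \<sigma>\<^sup>2 + \<zeta>\<^sup>2) + \<varpi>\<^sup>2\<close> remain, in particular
  nothing that depends on the starting point. The limit itself exists because the best expected
  value is decreasing and bounded below by the optimal value.
\<close>

section \<open>Gradients and inexact gradient steps\<close>

lemma grad_eqI:
  fixes h :: "'a::real_inner \<Rightarrow> real"
  assumes "GDERIV h x :> g"
  shows "grad h x = g"
  unfolding grad_def
proof (rule the_equality)
  fix g' assume "GDERIV h x :> g'"
  then have "(\<lambda>v. inner v g') = (\<lambda>v. inner v g)"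
    using assms unfolding gderiv_def by (rule has_derivative_unique)
  then have "inner (g' - g) (g' - g) = 0"
    by (metis cancel_comm_monoid_add_class.diff_cancel inner_diff_right)
  then show "g' = g" by simp
qed (rule assms)

lemma differentiable_imp_GDERIV_grad:
  fixes h :: "'a::euclidean_space \<Rightarrow> real"
  assumes "h differentiable (at x)"
  shows "GDERIV h x :> grad h x"
proof -
  obtain h' where h': "(h has_derivative h') (at x)"
    using assms unfolding differentiable_def by blast
  then have "linear h'" by (rule has_derivative_linear)
  then have "h' = (\<lambda>v. inner v (adjoint h' 1))"
    using adjoint_works[of h' _ 1] by auto
  with h' have g: "GDERIV h x :> adjoint h' 1"
    unfolding gderiv_def by simp
  with grad_eqI[OF g] show ?thesis by simp
qed

text \<open>Along the segment from \<open>x\<close> to \<open>y\<close>, the function \<open>p\<close>, the difference of the two sides up to a constant, has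
  nonpositive derivative,
  by Cauchy-Schwarz and the Lipschitz bound.\<close>
lemma lipschitz_grad_descent:
  fixes h :: "'a::euclidean_space \<Rightarrow> real"
  assumes G: "\<And>x. GDERIV h x :> G x" and lip: "L-lipschitz_on UNIV G"
  shows "h y \<le> h x + inner (G x) (y - x) + L / 2 * (norm (y - x))\<^sup>2"
proof -
  define v where "v = y - x"
  define p where "p = (\<lambda>t. h (x + t *\<^sub>R v) - t * inner (G x) v - L * t\<^sup>2 / 2 * (norm v)\<^sup>2)"
  have der: "DERIV p t :> inner v (G (x + t *\<^sub>R v)) - inner (G x) v - L * t * (norm v)\<^sup>2" for t
  proof -
    have "((\<lambda>t. h (x + t *\<^sub>R v)) has_derivative (\<lambda>s. inner (s *\<^sub>R v) (G (x + t *\<^sub>R v)))) (at t)"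
    proof (rule has_derivative_compose[where f = "\<lambda>t. x + t *\<^sub>R v" and f' = "\<lambda>s. s *\<^sub>R v"])
      show "((\<lambda>t. x + t *\<^sub>R v) has_derivative (\<lambda>s. s *\<^sub>R v)) (at t)"
        by (auto intro!: derivative_eq_intros)
      show "(h has_derivative (\<lambda>s. inner s (G (x + t *\<^sub>R v)))) (at (x + t *\<^sub>R v))"
        using G[of "x + t *\<^sub>R v"] unfolding gderiv_def .
    qed
    then have "DERIV (\<lambda>t. h (x + t *\<^sub>R v)) t :> inner v (G (x + t *\<^sub>R v))"
      unfolding has_field_derivative_def by (simp add: mult.commute[of _ "inner v _"])
    then show ?thesis
      unfolding p_def by (auto intro!: derivative_eq_intros)
  qed
  have "p 0 \<ge> p 1"
  proof (rule DERIV_nonpos_imp_nonincreasing[where f = p])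
    fix t :: real assume t: "0 \<le> t" "t \<le> 1"
    have "inner v (G (x + t *\<^sub>R v)) - inner (G x) v = inner v (G (x + t *\<^sub>R v) - G x)"
      by (simp add: inner_diff_right inner_commute)
    also have "\<dots> \<le> norm v * norm (G (x + t *\<^sub>R v) - G x)"
      by (rule norm_cauchy_schwarz)
    also have "\<dots> \<le> norm v * (L * norm (t *\<^sub>R v))"
      using lipschitz_onD[OF lip, of "x + t *\<^sub>R v" x]
      by (intro mult_left_mono) (auto simp: dist_norm)
    also have "\<dots> = L * t * (norm v)\<^sup>2"
      using t by (simp add: power2_eq_square)
    finally show "\<exists>d. DERIV p t :> d \<and> d \<le> 0"
      using der[of t] by auto
  qed simp
  then show ?thesis
    unfolding p_def v_def by simp
qed

text \<open>Young's inequality with weight \<open>\<eta>\<close>. The weight matters where \<open>a\<close> must keep a factor close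
  to 1; with \<open>\<eta> = 1 / 2\<close> it is the parallelogram bound.\<close>
lemma norm_add_sq_weighted:
  fixes a b :: "'a::real_inner"
  assumes "0 < \<eta>" "\<eta> < 1"
  shows "(norm (a + b))\<^sup>2 \<le> (norm a)\<^sup>2 / (1 - \<eta>) + (norm b)\<^sup>2 / \<eta>"
proof -
  have "0 \<le> (norm (\<eta> *\<^sub>R a - (1 - \<eta>) *\<^sub>R b))\<^sup>2" by simp
  also have "\<dots> = \<eta>\<^sup>2 * (norm a)\<^sup>2 - 2 * \<eta> * (1 - \<eta>) * inner a b + (1 - \<eta>)\<^sup>2 * (norm b)\<^sup>2"
    unfolding power2_norm_eq_inner
    by (simp add: inner_diff_left inner_diff_right inner_commute power2_eq_square algebra_simps)
  finally have "2 * inner a b \<le> \<eta> / (1 - \<eta>) * (norm a)\<^sup>2 + (1 - \<eta>) / \<eta> * (norm b)\<^sup>2"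
    using assms by (simp add: field_simps power2_eq_square)
  moreover have "(norm (a + b))\<^sup>2 = (norm a)\<^sup>2 + 2 * inner a b + (norm b)\<^sup>2"
    using dot_norm[of a b] by simp
  moreover have "\<eta> / (1 - \<eta>) * (norm a)\<^sup>2 = (norm a)\<^sup>2 / (1 - \<eta>) - (norm a)\<^sup>2"
    "(1 - \<eta>) / \<eta> * (norm b)\<^sup>2 = (norm b)\<^sup>2 / \<eta> - (norm b)\<^sup>2"
    using assms by (simp_all add: field_simps)
  ultimately show ?thesis by linarith
qed

text \<open>The step is a gradient step with direction \<open>g\<close> in place of \<open>G a\<close>, noise \<open>\<xi>\<close> and an additive error \<open>e\<close>.
  The noise is kept outside the completed square, so that it enters linearly only through its inner
  product with the exact gradient: there its expectation vanishes, whereas \<open>e\<close> may be correlated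
  with \<open>\<xi>\<close>. The quadratic term in \<open>v = e - \<alpha> g\<close> that smoothness costs is paid by
  \<open>- (norm v)\<^sup>2 / (2 \<alpha>)\<close>, which polarization of the inner product provides.\<close>
lemma inexact_gradient_step:
  fixes h :: "'a::euclidean_space \<Rightarrow> real"
  assumes G: "\<And>x. GDERIV h x :> G x" and lip: "L-lipschitz_on UNIV G"
    and \<alpha>: "0 < \<alpha>" "4 * L * \<alpha> \<le> 1"
  shows "h (a - \<alpha> *\<^sub>R (g + \<xi>) + e) \<le> h a - \<alpha> / 2 * (norm (G a))\<^sup>2 - \<alpha> * inner (G a) \<xi>
    + \<alpha> * (norm (G a - g))\<^sup>2 + (norm e)\<^sup>2 / \<alpha> + 2 / 3 * L * \<alpha>\<^sup>2 * (norm \<xi>)\<^sup>2"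
proof -
  define p where "p = G a"
  define v where "v = e - \<alpha> *\<^sub>R g"
  have L: "0 \<le> L" using lip by (rule lipschitz_on_nonneg)
  have "h (a - \<alpha> *\<^sub>R (g + \<xi>) + e) = h (a + (v - \<alpha> *\<^sub>R \<xi>))"
    by (simp add: v_def algebra_simps)
  also have "\<dots> \<le> h a + inner p (v - \<alpha> *\<^sub>R \<xi>) + L / 2 * (norm (v - \<alpha> *\<^sub>R \<xi>))\<^sup>2"
    using lipschitz_grad_descent[OF G lip, of "a + (v - \<alpha> *\<^sub>R \<xi>)" a] by (simp add: p_def)
  finally have 1: "h (a - \<alpha> *\<^sub>R (g + \<xi>) + e) \<le>
    h a + inner p v - \<alpha> * inner p \<xi> + L / 2 * (norm (v - \<alpha> *\<^sub>R \<xi>))\<^sup>2"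
    by (simp add: inner_diff_right)
  have 2: "inner p v = (norm (\<alpha> *\<^sub>R p + v))\<^sup>2 / (2 * \<alpha>) - \<alpha> / 2 * (norm p)\<^sup>2 - (norm v)\<^sup>2 / (2 * \<alpha>)"
  proof -
    have "(norm (\<alpha> *\<^sub>R p + v))\<^sup>2 = \<alpha>\<^sup>2 * (norm p)\<^sup>2 + 2 * \<alpha> * inner p v + (norm v)\<^sup>2"
      using dot_norm[of "\<alpha> *\<^sub>R p" v] by (simp add: power_mult_distrib)
    then show ?thesis using \<alpha>(1) by (simp add: field_simps power2_eq_square)
  qed
  have "\<alpha> *\<^sub>R p + v = \<alpha> *\<^sub>R (p - g) + e"
    by (simp add: v_def scaleR_diff_right)
  then have "(norm (\<alpha> *\<^sub>R p + v))\<^sup>2 \<le> 2 * \<alpha>\<^sup>2 * (norm (p - g))\<^sup>2 + 2 * (norm e)\<^sup>2"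
    using norm_add_sq_weighted[of "1/2" "\<alpha> *\<^sub>R (p - g)" e]
    by (simp add: power_mult_distrib)
  then have "(norm (\<alpha> *\<^sub>R p + v))\<^sup>2 / (2 * \<alpha>) \<le> (2 * \<alpha>\<^sup>2 * (norm (p - g))\<^sup>2 + 2 * (norm e)\<^sup>2) / (2 * \<alpha>)"
    using \<alpha>(1) by (intro divide_right_mono) auto
  also have "\<dots> = \<alpha> * (norm (p - g))\<^sup>2 + (norm e)\<^sup>2 / \<alpha>"
    using \<alpha>(1) by (simp add: field_simps power2_eq_square)
  finally have 3: "(norm (\<alpha> *\<^sub>R p + v))\<^sup>2 / (2 * \<alpha>) \<le> \<alpha> * (norm (p - g))\<^sup>2 + (norm e)\<^sup>2 / \<alpha>" .
  have "(norm (v - \<alpha> *\<^sub>R \<xi>))\<^sup>2 \<le> 4 * (norm v)\<^sup>2 + 4 / 3 * (\<alpha>\<^sup>2 * (norm \<xi>)\<^sup>2)"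
    using norm_add_sq_weighted[of "3/4" v "- (\<alpha> *\<^sub>R \<xi>)"] by (simp add: power_mult_distrib)
  then have "L / 2 * (norm (v - \<alpha> *\<^sub>R \<xi>))\<^sup>2 \<le> L / 2 * (4 * (norm v)\<^sup>2 + 4 / 3 * (\<alpha>\<^sup>2 * (norm \<xi>)\<^sup>2))"
    using L by (intro mult_left_mono) auto
  also have "\<dots> = 2 * L * (norm v)\<^sup>2 + 2 / 3 * L * \<alpha>\<^sup>2 * (norm \<xi>)\<^sup>2"
    by (simp add: algebra_simps)
  also have "2 * L * (norm v)\<^sup>2 \<le> 1 / (2 * \<alpha>) * (norm v)\<^sup>2"
    using \<alpha> by (intro mult_right_mono) (auto simp: field_simps)
  finally have 4: "L / 2 * (norm (v - \<alpha> *\<^sub>R \<xi>))\<^sup>2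
      \<le> (norm v)\<^sup>2 / (2 * \<alpha>) + 2 / 3 * L * \<alpha>\<^sup>2 * (norm \<xi>)\<^sup>2" by simp
  show ?thesis
    using 1 2 3 4 unfolding p_def by linarith
qed

lemma GDERIV_sum:
  assumes "\<And>i. i \<in> I \<Longrightarrow> GDERIV (h i) x :> g i"
  shows "GDERIV (\<lambda>x. \<Sum>i\<in>I. h i x) x :> (\<Sum>i\<in>I. g i)"
  using assms unfolding gderiv_def inner_sum_right by (rule has_derivative_sum)

section \<open>Means and spreads of finite families of vectors\<close>

definition fmean :: "'v set \<Rightarrow> ('v \<Rightarrow> 'a::real_vector) \<Rightarrow> 'a" where
  "fmean I z = (1 / real (card I)) *\<^sub>R (\<Sum>i\<in>I. z i)"

text \<open>The squared Frobenius norm of the matrix with rows \<open>z i\<close> after its mean row is subtracted.\<close>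
definition spread :: "'v set \<Rightarrow> ('v \<Rightarrow> 'a::real_normed_vector) \<Rightarrow> real" where
  "spread I z = (\<Sum>i\<in>I. (norm (z i - fmean I z))\<^sup>2)"

lemma spread_nonneg: "0 \<le> spread I z"
  unfolding spread_def by (intro sum_nonneg) simp

lemma fmean_add: "fmean I (\<lambda>i. f i + g i) = fmean I f + fmean I g"
  by (simp add: fmean_def sum.distrib scaleR_add_right)

lemma fmean_diff: "fmean I (\<lambda>i. f i - g i) = fmean I f - fmean I g"
  by (simp add: fmean_def sum_subtractf scaleR_diff_right)

lemma fmean_scaleR: "fmean I (\<lambda>i. c *\<^sub>R f i) = c *\<^sub>R fmean I f"
  by (simp add: fmean_def flip: scaleR_sum_right)

lemma sum_diff_fmean: "finite I \<Longrightarrow> I \<noteq> {} \<Longrightarrow> (\<Sum>i\<in>I. z i - fmean I z) = 0"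
  by (simp add: fmean_def sum_subtractf sum_constant_scaleR)

text \<open>The decomposition into variance and squared bias. It makes the mean the best constant
  approximation (\<open>spread_le\<close>) and gives convexity of the squared norm (\<open>norm_fmean_sq_le\<close>).\<close>
lemma sum_norm_sq_decomp:
  fixes z :: "'v \<Rightarrow> 'a::real_inner"
  assumes "finite I" "I \<noteq> {}"
  shows "(\<Sum>i\<in>I. (norm (z i - a))\<^sup>2) = spread I z + real (card I) * (norm (fmean I z - a))\<^sup>2"
proof -
  have "(norm (z i - a))\<^sup>2 = (norm (z i - fmean I z))\<^sup>2
      + 2 * inner (z i - fmean I z) (fmean I z - a) + (norm (fmean I z - a))\<^sup>2" for i
    using dot_norm[of "z i - fmean I z" "fmean I z - a"] by simp
  then have "(\<Sum>i\<in>I. (norm (z i - a))\<^sup>2) = spread I z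
      + 2 * inner (\<Sum>i\<in>I. z i - fmean I z) (fmean I z - a) + real (card I) * (norm (fmean I z - a))\<^sup>2"
    by (simp add: spread_def sum.distrib inner_sum_left sum_distrib_left)
  then show ?thesis using sum_diff_fmean[OF assms, of z] by simp
qed

lemma spread_le:
  fixes z :: "'v \<Rightarrow> 'a::real_inner"
  assumes "finite I" "I \<noteq> {}"
  shows "spread I z \<le> (\<Sum>i\<in>I. (norm (z i - a))\<^sup>2)"
  using sum_norm_sq_decomp[OF assms, of z a] by simp

lemma norm_fmean_sq_le:
  fixes z :: "'v \<Rightarrow> 'a::real_inner"
  assumes "finite I" "I \<noteq> {}"
  shows "(norm (fmean I z))\<^sup>2 \<le> (\<Sum>i\<in>I. (norm (z i))\<^sup>2) / real (card I)"
  using sum_norm_sq_decomp[OF assms, of z 0] spread_nonneg[of I z] assms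
  by (simp add: field_simps card_gt_0_iff)

lemma norm_diff_sq_le_spread:
  fixes z :: "'v \<Rightarrow> 'a::real_inner"
  assumes "finite I" "i \<in> I" "j \<in> I"
  shows "(norm (z i - z j))\<^sup>2 \<le> 2 * spread I z"
proof (cases "i = j")
  case True then show ?thesis by (simp add: spread_nonneg)
next
  case False
  let ?m = "fmean I z"
  have "(norm (z i - z j))\<^sup>2 \<le> 2 * ((norm (z i - ?m))\<^sup>2 + (norm (z j - ?m))\<^sup>2)"
  proof -
    have "norm (z i - z j) \<le> norm (z i - ?m) + norm (z j - ?m)"
      using norm_triangle_ineq4[of "z i - ?m" "z j - ?m"] by simp
    then have "(norm (z i - z j))\<^sup>2 \<le> (norm (z i - ?m) + norm (z j - ?m))\<^sup>2"
      by (rule power_mono) simp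
    also have "\<dots> \<le> 2 * ((norm (z i - ?m))\<^sup>2 + (norm (z j - ?m))\<^sup>2)"
      using sum_squares_bound[of "norm (z i - ?m)" "norm (z j - ?m)"] by (simp add: power2_sum)
    finally show ?thesis .
  qed
  also have "(norm (z i - ?m))\<^sup>2 + (norm (z j - ?m))\<^sup>2 = (\<Sum>l\<in>{i, j}. (norm (z l - ?m))\<^sup>2)"
    using False by simp
  also have "\<dots> \<le> spread I z"
    unfolding spread_def using assms by (intro sum_mono2) auto
  finally show ?thesis by simp
qed

text \<open>The form in which the contraction property is used: there the convex combination is a row
  of the virtual matrix, and \<open>z j\<close> runs over the messages of the reliable neighbors.\<close>
lemma norm_diff_convex_comb_le_spread:
  fixes z :: "'v \<Rightarrow> 'a::real_inner"
  assumes I: "finite I" "j \<in> I" and c: "\<And>l. l \<in> I \<Longrightarrow> 0 \<le> c l" "(\<Sum>l\<in>I. c l) = 1"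
  shows "norm (z j - (\<Sum>l\<in>I. c l *\<^sub>R z l)) \<le> sqrt (2 * spread I z)"
proof -
  have "z j - (\<Sum>l\<in>I. c l *\<^sub>R z l) = (\<Sum>l\<in>I. c l *\<^sub>R (z j - z l))"
    using c(2) by (simp add: scaleR_diff_right sum_subtractf flip: scaleR_sum_left)
  also have "norm \<dots> \<le> (\<Sum>l\<in>I. c l * norm (z j - z l))"
    using c(1) by (intro sum_norm_le) auto
  also have "\<dots> \<le> (\<Sum>l\<in>I. c l * sqrt (2 * spread I z))"
    using c(1) I by (intro sum_mono mult_left_mono real_le_rsqrt norm_diff_sq_le_spread) auto
  also have "\<dots> = sqrt (2 * spread I z)"
    using c(2) by (simp flip: sum_distrib_right)
  finally show ?thesis .
qed

lemma spread_diff_scaleR_le: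
  fixes x g :: "'v \<Rightarrow> 'a::real_inner"
  assumes "0 < \<eta>" "\<eta> < 1"
  shows "spread I (\<lambda>i. x i - \<alpha> *\<^sub>R g i) \<le> spread I x / (1 - \<eta>) + \<alpha>\<^sup>2 / \<eta> * spread I g"
proof -
  have "(norm (x i - \<alpha> *\<^sub>R g i - fmean I (\<lambda>i. x i - \<alpha> *\<^sub>R g i)))\<^sup>2
      \<le> (norm (x i - fmean I x))\<^sup>2 / (1 - \<eta>) + \<alpha>\<^sup>2 / \<eta> * (norm (g i - fmean I g))\<^sup>2" for i
  proof -
    have "x i - \<alpha> *\<^sub>R g i - fmean I (\<lambda>i. x i - \<alpha> *\<^sub>R g i)
        = (x i - fmean I x) + (- \<alpha>) *\<^sub>R (g i - fmean I g)"
      by (simp add: fmean_diff fmean_scaleR algebra_simps)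
    then show ?thesis
      using norm_add_sq_weighted[OF assms, of "x i - fmean I x" "(- \<alpha>) *\<^sub>R (g i - fmean I g)"]
      by (simp only: norm_scaleR power_mult_distrib power2_abs) simp
  qed
  then have "spread I (\<lambda>i. x i - \<alpha> *\<^sub>R g i) \<le>
     (\<Sum>i\<in>I. (norm (x i - fmean I x))\<^sup>2 / (1 - \<eta>) + \<alpha>\<^sup>2 / \<eta> * (norm (g i - fmean I g))\<^sup>2)"
    unfolding spread_def by (intro sum_mono)
  then show ?thesis
    by (simp add: spread_def sum.distrib sum_distrib_left sum_divide_distrib)
qed

lemma norm_sum4_sq_le:
  fixes a b c d :: "'a::real_inner"
  shows "(norm (a + b + c + d))\<^sup>2 \<le> 4 * ((norm a)\<^sup>2 + (norm b)\<^sup>2 + (norm c)\<^sup>2 + (norm d)\<^sup>2)"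
proof -
  have two: "(norm (u + v))\<^sup>2 \<le> 2 * ((norm u)\<^sup>2 + (norm v)\<^sup>2)" for u v :: 'a
    using norm_add_sq_weighted[of "1/2" u v] by simp
  have "(norm ((a + b) + (c + d)))\<^sup>2 \<le> 2 * ((norm (a + b))\<^sup>2 + (norm (c + d))\<^sup>2)"
    by (rule two)
  with two[of a b] two[of c d] show ?thesis by (simp add: add.assoc)
qed

section \<open>Spectral norm and mixing\<close>

text \<open>The supremum that defines the spectral norm is over a bounded set, since the Frobenius norm \<open>B\<close>
  bounds it; without this the supremum would carry no information.\<close>
lemma L2_set_matrix_le_spectral_norm:
  assumes "finite I"
  shows "L2_set (\<lambda>i. \<Sum>j\<in>I. A i j * u j) I \<le> spectral_norm I A * L2_set u I"
proof -
  let ?T = "\<lambda>u. L2_set (\<lambda>i. \<Sum>j\<in>I. A i j * u j) I"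
  define B where "B = L2_set (\<lambda>i. L2_set (A i) I) I"
  have bound: "?T u \<le> B * L2_set u I" for u
  proof -
    have "?T u \<le> L2_set (\<lambda>i. L2_set (A i) I * L2_set u I) I"
      unfolding L2_set_def
    proof (intro real_sqrt_le_mono sum_mono, fold L2_set_def)
      fix i
      have "\<bar>\<Sum>j\<in>I. A i j * u j\<bar> \<le> (\<Sum>j\<in>I. \<bar>A i j\<bar> * \<bar>u j\<bar>)"
        by (rule order_trans[OF sum_abs]) (simp add: abs_mult)
      also have "\<dots> \<le> L2_set (A i) I * L2_set u I" by (rule L2_set_mult_ineq)
      finally show "(\<Sum>j\<in>I. A i j * u j)\<^sup>2 \<le> (L2_set (A i) I * L2_set u I)\<^sup>2"
        by (metis abs_ge_zero power2_abs power_mono)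
    qed
    then show ?thesis by (simp add: B_def L2_set_left_distrib)
  qed
  have bdd: "bdd_above (?T ` {u. L2_set u I \<le> 1})"
  proof (rule bdd_aboveI2)
    fix u assume u: "u \<in> {u. L2_set u I \<le> 1}"
    have "B * L2_set u I \<le> B * 1"
      using u by (intro mult_left_mono) (auto simp: B_def)
    with bound[of u] show "?T u \<le> B" by simp
  qed
  show ?thesis
  proof (cases "L2_set u I = 0")
    case True
    then show ?thesis using bound[of u] by simp
  next
    case False
    define c where "c = L2_set u I"
    have c: "c > 0" using False by (simp add: c_def less_le)
    have scale: "L2_set (\<lambda>j. f j / c) I = L2_set f I / c" for f
      using L2_set_right_distrib[of "1 / c" f I] c by simp
    have "?T (\<lambda>j. u j / c) \<le> spectral_norm I A"
      unfolding spectral_norm_def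
    proof (rule cSUP_upper[OF _ bdd])
      show "(\<lambda>j. u j / c) \<in> {u. L2_set u I \<le> 1}" using c scale[of u] by (simp add: c_def)
    qed
    moreover have "?T (\<lambda>j. u j / c) = ?T u / c"
      using scale[of "\<lambda>i. \<Sum>j\<in>I. A i j * u j"] by (simp add: sum_divide_distrib)
    ultimately show ?thesis using c by (simp add: c_def field_simps)
  qed
qed

lemma spectral_norm_nonneg:
  assumes "finite I" "I \<noteq> {}"
  shows "0 \<le> spectral_norm I A"
proof -
  obtain i where i: "i \<in> I" using assms(2) by blast
  define u where "u j = (if j = i then 1 else 0 :: real)" for j
  have "L2_set u I = 1"
    using assms(1) i by (simp add: L2_set_def u_def if_distrib[of "\<lambda>x. x\<^sup>2"] cong: if_cong)
  then show ?thesis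
    using order_trans[OF L2_set_nonneg L2_set_matrix_le_spectral_norm[OF assms(1), of A u]] by simp
qed

text \<open>The spectral norm acts on each coordinate of the rows separately, and squares add up over
  coordinates.\<close>
lemma sum_norm_sq_matrix_le:
  fixes z :: "'v \<Rightarrow> real^'n"
  assumes "finite I"
  shows "(\<Sum>i\<in>I. (norm (\<Sum>j\<in>I. A i j *\<^sub>R z j))\<^sup>2) \<le> (spectral_norm I A)\<^sup>2 * (\<Sum>i\<in>I. (norm (z i))\<^sup>2)"
proof -
  have n2: "(norm v)\<^sup>2 = (\<Sum>c\<in>UNIV. (v $ c)\<^sup>2)" for v :: "real^'n"
    by (simp add: norm_vec_def L2_set_def sum_nonneg)
  have row: "(\<Sum>i\<in>I. (\<Sum>j\<in>I. A i j * z j $ c)\<^sup>2) \<le> (spectral_norm I A)\<^sup>2 * (\<Sum>i\<in>I. (z i $ c)\<^sup>2)" for c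
  proof -
    have sq: "(L2_set f I)\<^sup>2 = (\<Sum>i\<in>I. (f i)\<^sup>2)" for f
      by (simp add: L2_set_def sum_nonneg)
    show ?thesis
      using power_mono[OF L2_set_matrix_le_spectral_norm[OF assms, of A "\<lambda>j. z j $ c"], of 2]
      by (simp add: sq power_mult_distrib)
  qed
  have "(\<Sum>i\<in>I. (norm (\<Sum>j\<in>I. A i j *\<^sub>R z j))\<^sup>2) = (\<Sum>i\<in>I. \<Sum>c\<in>UNIV. (\<Sum>j\<in>I. A i j * z j $ c)\<^sup>2)"
    by (simp add: n2)
  also have "\<dots> = (\<Sum>c\<in>UNIV. \<Sum>i\<in>I. (\<Sum>j\<in>I. A i j * z j $ c)\<^sup>2)"
    by (rule sum.swap)
  also have "\<dots> \<le> (\<Sum>c\<in>UNIV. (spectral_norm I A)\<^sup>2 * (\<Sum>i\<in>I. (z i $ c)\<^sup>2))"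
    by (intro sum_mono row)
  also have "\<dots> = (spectral_norm I A)\<^sup>2 * (\<Sum>i\<in>I. \<Sum>c\<in>UNIV. (z i $ c)\<^sup>2)"
    by (subst sum.swap) (simp add: sum_distrib_left)
  finally show ?thesis by (simp add: n2)
qed

lemma fmean_doubly_stochastic:
  fixes z :: "'v \<Rightarrow> 'a::real_vector"
  assumes "doubly_stochastic I W"
  shows "fmean I (\<lambda>i. \<Sum>j\<in>I. W i j *\<^sub>R z j) = fmean I z"
proof -
  have "(\<Sum>i\<in>I. \<Sum>j\<in>I. W i j *\<^sub>R z j) = (\<Sum>j\<in>I. (\<Sum>i\<in>I. W i j) *\<^sub>R z j)"
    by (subst sum.swap) (simp add: scaleR_sum_left)
  then show ?thesis using assms by (simp add: fmean_def doubly_stochastic_def)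
qed

text \<open>Since the rows of \<open>W\<close> sum to 1 and its columns preserve the mean, centering the family turns \<open>W\<close>
  into \<open>W - J\<close>, where \<open>J\<close> is the averaging matrix; the spread then contracts by the squared norm.\<close>
lemma spread_doubly_stochastic_le:
  fixes z :: "'v \<Rightarrow> real^'n"
  assumes I: "finite I" "I \<noteq> {}" and W: "doubly_stochastic I W"
  shows "spread I (\<lambda>i. \<Sum>j\<in>I. W i j *\<^sub>R z j)
    \<le> (spectral_norm I (\<lambda>i j. W i j - 1 / real (card I)))\<^sup>2 * spread I z"
proof -
  have "(\<Sum>j\<in>I. W i j *\<^sub>R z j) - fmean I z = (\<Sum>j\<in>I. (W i j - 1 / real (card I)) *\<^sub>R (z j - fmean I z))"
    if "i \<in> I" for i
  proof -
    have "(\<Sum>j\<in>I. (W i j - 1 / real (card I)) *\<^sub>R (z j - fmean I z))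
        = (\<Sum>j\<in>I. W i j *\<^sub>R z j) - (\<Sum>j\<in>I. W i j) *\<^sub>R fmean I z
          - (1 / real (card I)) *\<^sub>R (\<Sum>j\<in>I. z j - fmean I z)"
      by (simp only: scaleR_diff_left scaleR_diff_right sum_subtractf scaleR_sum_left scaleR_sum_right) simp
    then show ?thesis using W that sum_diff_fmean[OF I, of z] by (simp add: doubly_stochastic_def)
  qed
  then have "spread I (\<lambda>i. \<Sum>j\<in>I. W i j *\<^sub>R z j)
      = (\<Sum>i\<in>I. (norm (\<Sum>j\<in>I. (W i j - 1 / real (card I)) *\<^sub>R (z j - fmean I z)))\<^sup>2)"
    by (simp add: spread_def fmean_doubly_stochastic[OF W])
  also have "\<dots> \<le> (spectral_norm I (\<lambda>i j. W i j - 1 / real (card I)))\<^sup>2 * spread I z"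
    unfolding spread_def by (rule sum_norm_sq_matrix_le[OF I(1)])
  finally show ?thesis .
qed

lemma sqrt_spread_add_le:
  fixes z e :: "'v \<Rightarrow> 'a::real_inner"
  assumes "finite I" "I \<noteq> {}"
  shows "sqrt (spread I (\<lambda>i. z i + e i)) \<le> sqrt (spread I z) + sqrt (\<Sum>i\<in>I. (norm (e i))\<^sup>2)"
proof -
  have s: "sqrt (spread I z) = L2_set (\<lambda>i. norm (z i - fmean I z)) I" for z :: "'v \<Rightarrow> 'a"
    by (simp add: L2_set_def spread_def)
  have "sqrt (spread I (\<lambda>i. z i + e i))
      \<le> L2_set (\<lambda>i. norm (z i - fmean I z) + norm (e i - fmean I e)) I"
    unfolding s fmean_add
    by (intro L2_set_mono) (auto intro: order_trans[OF _ norm_triangle_ineq] simp: algebra_simps)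
  also have "\<dots> \<le> sqrt (spread I z) + sqrt (spread I e)"
    unfolding s by (rule L2_set_triangle_ineq)
  also have "sqrt (spread I e) \<le> sqrt (\<Sum>i\<in>I. (norm (e i))\<^sup>2)"
    using spread_le[OF assms, of e 0] by simp
  finally show ?thesis by simp
qed

section \<open>Square-integrable random vectors\<close>

definition square_integrable :: "'w measure \<Rightarrow> ('w \<Rightarrow> 'a::euclidean_space) \<Rightarrow> bool" where
  "square_integrable M X \<longleftrightarrow> X \<in> borel_measurable M \<and> integrable M (\<lambda>\<omega>. (norm (X \<omega>))\<^sup>2)"

lemma square_integrable_bound:
  assumes "X \<in> borel_measurable M" "integrable M g" "AE \<omega> in M. (norm (X \<omega>))\<^sup>2 \<le> g \<omega>"
  shows "square_integrable M X"
  unfolding square_integrable_def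
proof (intro conjI assms(1) Bochner_Integration.integrable_bound[OF assms(2)])
  show "(\<lambda>\<omega>. (norm (X \<omega>))\<^sup>2) \<in> borel_measurable M" using assms(1) by simp
  show "AE \<omega> in M. norm ((norm (X \<omega>))\<^sup>2) \<le> norm (g \<omega>)"
    using assms(3) by eventually_elim simp
qed

lemma square_integrable_add:
  assumes "square_integrable M X" "square_integrable M Y"
  shows "square_integrable M (\<lambda>\<omega>. X \<omega> + Y \<omega>)"
proof (rule square_integrable_bound)
  show "(\<lambda>\<omega>. X \<omega> + Y \<omega>) \<in> borel_measurable M"
    using assms by (auto simp: square_integrable_def)
  show "integrable M (\<lambda>\<omega>. 2 * (norm (X \<omega>))\<^sup>2 + 2 * (norm (Y \<omega>))\<^sup>2)"
    using assms by (auto simp: square_integrable_def)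
  show "AE \<omega> in M. (norm (X \<omega> + Y \<omega>))\<^sup>2 \<le> 2 * (norm (X \<omega>))\<^sup>2 + 2 * (norm (Y \<omega>))\<^sup>2"
  proof (rule AE_I2)
    fix \<omega>
    show "(norm (X \<omega> + Y \<omega>))\<^sup>2 \<le> 2 * (norm (X \<omega>))\<^sup>2 + 2 * (norm (Y \<omega>))\<^sup>2"
      using norm_add_sq_weighted[of "1/2" "X \<omega>" "Y \<omega>"] by simp
  qed
qed

lemma square_integrable_scaleR:
  "square_integrable M X \<Longrightarrow> square_integrable M (\<lambda>\<omega>. c *\<^sub>R X \<omega>)"
  by (auto simp: square_integrable_def power_mult_distrib)

lemma square_integrable_diff:
  assumes "square_integrable M X" "square_integrable M Y"
  shows "square_integrable M (\<lambda>\<omega>. X \<omega> - Y \<omega>)"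
  using square_integrable_add[OF assms(1) square_integrable_scaleR[OF assms(2), of "-1"]] by simp

lemma (in finite_measure) square_integrable_const: "square_integrable M (\<lambda>\<omega>. c)"
  by (simp add: square_integrable_def)

lemma (in finite_measure) square_integrable_sum:
  assumes "\<And>i. i \<in> I \<Longrightarrow> square_integrable M (X i)"
  shows "square_integrable M (\<lambda>\<omega>. \<Sum>i\<in>I. X i \<omega>)"
  using assms
  by (induction I rule: infinite_finite_induct) (auto intro: square_integrable_add square_integrable_const)

lemma (in finite_measure) square_integrable_fmean:
  assumes "\<And>i. i \<in> I \<Longrightarrow> square_integrable M (X i)"
  shows "square_integrable M (\<lambda>\<omega>. fmean I (\<lambda>i. X i \<omega>))"
  unfolding fmean_def using assms by (intro square_integrable_scaleR square_integrable_sum)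

lemma (in finite_measure) square_integrable_lipschitz:
  assumes X: "square_integrable M X" and g: "L-lipschitz_on UNIV g"
  shows "square_integrable M (\<lambda>\<omega>. g (X \<omega>))"
proof (rule square_integrable_bound)
  have "continuous_on UNIV g" using g by (rule lipschitz_on_continuous_on)
  then have "g \<in> borel_measurable borel" by (rule borel_measurable_continuous_onI)
  then show "(\<lambda>\<omega>. g (X \<omega>)) \<in> borel_measurable M"
    using X unfolding square_integrable_def by (auto intro: measurable_compose)
  show "integrable M (\<lambda>\<omega>. 2 * L\<^sup>2 * (norm (X \<omega>))\<^sup>2 + 2 * (norm (g 0))\<^sup>2)"
    using X by (auto simp: square_integrable_def)
  show "AE \<omega> in M. (norm (g (X \<omega>)))\<^sup>2 \<le> 2 * L\<^sup>2 * (norm (X \<omega>))\<^sup>2 + 2 * (norm (g 0))\<^sup>2"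
  proof (rule AE_I2)
    fix \<omega>
    have "norm (g (X \<omega>) - g 0) \<le> L * norm (X \<omega>)"
      using lipschitz_onD[OF g, of "X \<omega>" 0] by (simp add: dist_norm)
    then have "(norm (g (X \<omega>) - g 0))\<^sup>2 \<le> L\<^sup>2 * (norm (X \<omega>))\<^sup>2"
      by (metis norm_ge_zero power_mono power_mult_distrib)
    then show "(norm (g (X \<omega>)))\<^sup>2 \<le> 2 * L\<^sup>2 * (norm (X \<omega>))\<^sup>2 + 2 * (norm (g 0))\<^sup>2"
      using norm_add_sq_weighted[of "1/2" "g (X \<omega>) - g 0" "g 0"] by simp
  qed
qed

lemma integrable_inner_square_integrable:
  assumes X: "square_integrable M X" and Y: "square_integrable M Y"
  shows "integrable M (\<lambda>\<omega>. inner (X \<omega>) (Y \<omega>))"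
proof (rule Bochner_Integration.integrable_bound)
  show "integrable M (\<lambda>\<omega>. (norm (X \<omega>))\<^sup>2 + (norm (Y \<omega>))\<^sup>2)"
    using assms by (auto simp: square_integrable_def)
  show "(\<lambda>\<omega>. inner (X \<omega>) (Y \<omega>)) \<in> borel_measurable M"
    using assms by (auto simp: square_integrable_def)
  show "AE \<omega> in M. norm (inner (X \<omega>) (Y \<omega>)) \<le> norm ((norm (X \<omega>))\<^sup>2 + (norm (Y \<omega>))\<^sup>2)"
  proof (rule AE_I2)
    fix \<omega>
    have "\<bar>inner (X \<omega>) (Y \<omega>)\<bar> \<le> norm (X \<omega>) * norm (Y \<omega>)"
      by (rule Cauchy_Schwarz_ineq2)
    moreover have "2 * (norm (X \<omega>) * norm (Y \<omega>)) \<le> (norm (X \<omega>))\<^sup>2 + (norm (Y \<omega>))\<^sup>2"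
      using sum_squares_bound[of "norm (X \<omega>)" "norm (Y \<omega>)"] by (simp add: mult.assoc)
    moreover have "0 \<le> norm (X \<omega>) * norm (Y \<omega>)" by simp
    ultimately have "\<bar>inner (X \<omega>) (Y \<omega>)\<bar> \<le> (norm (X \<omega>))\<^sup>2 + (norm (Y \<omega>))\<^sup>2" by linarith
    then show "norm (inner (X \<omega>) (Y \<omega>)) \<le> norm ((norm (X \<omega>))\<^sup>2 + (norm (Y \<omega>))\<^sup>2)" by simp
  qed
qed

section \<open>Independence\<close>

text \<open>Independence is stated as a product law because \<open>X\<close> and \<open>Y\<close> take values in different types: below,
  \<open>X\<close> is a state of the run and \<open>Y\<close> a sample or a noise vector.\<close>
lemma (in prob_space) distr_pair_of_indep_subalgebras:
  assumes indep: "indep_set (sets A) (sets B)"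
    and A: "subalgebra M A" and B: "space B = space M"
    and X: "X \<in> A \<rightarrow>\<^sub>M S" and Y: "Y \<in> B \<rightarrow>\<^sub>M T"
  shows "random_variable S X" and "random_variable T Y"
    and "distr M S X \<Otimes>\<^sub>M distr M T Y = distr M (S \<Otimes>\<^sub>M T) (\<lambda>\<omega>. (X \<omega>, Y \<omega>))"
proof -
  have sA: "sets A \<subseteq> events" and sB: "sets B \<subseteq> events"
    using indep by (auto simp: indep_set_def indep_sets_def UNIV_bool)
  have spA: "space A = space M" using A by (simp add: subalgebra_def)
  show rvX[measurable]: "random_variable S X" and rvY[measurable]: "random_variable T Y"
    using measurable_sets[OF X] measurable_sets[OF Y] measurable_space[OF X] measurable_space[OF Y] sA sB spA B
    by (auto intro!: measurableI)
  interpret X: prob_space "distr M S X" by (rule prob_space_distr) simp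
  interpret Y: prob_space "distr M T Y" by (rule prob_space_distr) simp
  show "distr M S X \<Otimes>\<^sub>M distr M T Y = distr M (S \<Otimes>\<^sub>M T) (\<lambda>\<omega>. (X \<omega>, Y \<omega>))"
  proof (rule pair_measure_eqI[OF X.sigma_finite_measure_axioms Y.sigma_finite_measure_axioms])
    fix C D assume "C \<in> sets (distr M S X)" "D \<in> sets (distr M T Y)"
    then have C[measurable]: "C \<in> sets S" and D[measurable]: "D \<in> sets T" by auto
    have "prob ((X -` C \<inter> space M) \<inter> (Y -` D \<inter> space M))
        = prob (X -` C \<inter> space M) * prob (Y -` D \<inter> space M)"
      using measurable_sets[OF X C] measurable_sets[OF Y D] spA B
      by (intro indep_setD[OF indep]) auto
    moreover have "(\<lambda>\<omega>. (X \<omega>, Y \<omega>)) -` (C \<times> D) \<inter> space M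
        = (X -` C \<inter> space M) \<inter> (Y -` D \<inter> space M)" by auto
    ultimately show "emeasure (distr M S X) C * emeasure (distr M T Y) D
        = emeasure (distr M (S \<Otimes>\<^sub>M T) (\<lambda>\<omega>. (X \<omega>, Y \<omega>))) (C \<times> D)"
      by (simp add: emeasure_distr emeasure_eq_measure ennreal_mult')
  qed (simp cong: sets_pair_measure_cong)
qed

text \<open>Together with \<open>indep_expectation_zero\<close> this replaces conditioning on the past: by Fubini,
  a bound that holds for every frozen state \<open>x\<close> holds for the random state \<open>X\<close>.\<close>
lemma (in prob_space) indep_expectation_le:
  fixes h :: "'x \<times> 'y \<Rightarrow> real"
  assumes rv[measurable]: "random_variable S X" "random_variable T Y"
    and eq: "distr M S X \<Otimes>\<^sub>M distr M T Y = distr M (S \<Otimes>\<^sub>M T) (\<lambda>\<omega>. (X \<omega>, Y \<omega>))"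
    and h: "h \<in> borel_measurable (S \<Otimes>\<^sub>M T)" "\<And>z. 0 \<le> h z"
    and int: "\<And>x. x \<in> space S \<Longrightarrow> integrable (distr M T Y) (\<lambda>y. h (x, y))"
    and le: "\<And>x. x \<in> space S \<Longrightarrow> (LINT y|distr M T Y. h (x, y)) \<le> c"
  shows "integrable M (\<lambda>\<omega>. h (X \<omega>, Y \<omega>))" and "expectation (\<lambda>\<omega>. h (X \<omega>, Y \<omega>)) \<le> c"
proof -
  interpret Y: prob_space "distr M T Y" by (rule prob_space_distr) simp
  interpret X: prob_space "distr M S X" by (rule prob_space_distr) simp
  obtain x where "x \<in> space S"
    using measurable_space[OF rv(1)] not_empty by blast
  then have c: "0 \<le> c"
    using h(2) by (intro order_trans[OF Bochner_Integration.integral_nonneg_AE le[of x]]) auto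
  have "(\<integral>\<^sup>+\<omega>. h (X \<omega>, Y \<omega>) \<partial>M) = (\<integral>\<^sup>+z. h z \<partial>distr M (S \<Otimes>\<^sub>M T) (\<lambda>x. (X x, Y x)))"
    using h by (subst nn_integral_distr) auto
  also have "\<dots> = (\<integral>\<^sup>+x. \<integral>\<^sup>+y. h (x, y) \<partial>distr M T Y \<partial>distr M S X)"
    unfolding eq[symmetric] using h(1) by (subst Y.nn_integral_fst) auto
  also have "\<dots> \<le> (\<integral>\<^sup>+x. ennreal c \<partial>distr M S X)"
  proof (rule nn_integral_mono)
    fix x assume "x \<in> space (distr M S X)"
    then have x: "x \<in> space S" by simp
    have "(\<integral>\<^sup>+y. h (x, y) \<partial>distr M T Y) = ennreal (LINT y|distr M T Y. h (x, y))"
      using int[OF x] h(2) by (intro nn_integral_eq_integral) auto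
    then show "(\<integral>\<^sup>+y. h (x, y) \<partial>distr M T Y) \<le> ennreal c"
      using le[OF x] by (simp add: ennreal_leI)
  qed
  also have "\<dots> = ennreal c" using X.emeasure_space_1 by simp
  finally have *: "(\<integral>\<^sup>+\<omega>. h (X \<omega>, Y \<omega>) \<partial>M) \<le> ennreal c" .
  have meas: "(\<lambda>\<omega>. h (X \<omega>, Y \<omega>)) \<in> borel_measurable M" using h(1) by measurable
  show i: "integrable M (\<lambda>\<omega>. h (X \<omega>, Y \<omega>))"
  proof (rule integrableI_bounded[OF meas])
    show "(\<integral>\<^sup>+\<omega>. ennreal (norm (h (X \<omega>, Y \<omega>))) \<partial>M) < \<infinity>"
      using * h(2) by (simp add: le_less_trans[OF _ ennreal_less_top])
  qed
  show "expectation (\<lambda>\<omega>. h (X \<omega>, Y \<omega>)) \<le> c"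
    using * nn_integral_eq_integral[OF i] h(2) c by (simp add: ennreal_le_iff)
qed

lemma (in prob_space) indep_expectation_zero:
  fixes h :: "'x \<times> 'y \<Rightarrow> real"
  assumes rv[measurable]: "random_variable S X" "random_variable T Y"
    and eq: "distr M S X \<Otimes>\<^sub>M distr M T Y = distr M (S \<Otimes>\<^sub>M T) (\<lambda>\<omega>. (X \<omega>, Y \<omega>))"
    and h: "h \<in> borel_measurable (S \<Otimes>\<^sub>M T)"
    and int: "integrable M (\<lambda>\<omega>. h (X \<omega>, Y \<omega>))"
    and zero: "\<And>x. x \<in> space S \<Longrightarrow> (LINT y|distr M T Y. h (x, y)) = 0"
  shows "expectation (\<lambda>\<omega>. h (X \<omega>, Y \<omega>)) = 0"
proof -
  interpret Y: prob_space "distr M T Y" by (rule prob_space_distr) simp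
  interpret X: prob_space "distr M S X" by (rule prob_space_distr) simp
  interpret XY: pair_sigma_finite "distr M S X" "distr M T Y" ..
  have i: "integrable (distr M S X \<Otimes>\<^sub>M distr M T Y) h"
    unfolding eq using h int by (subst integrable_distr_eq) auto
  have "expectation (\<lambda>\<omega>. h (X \<omega>, Y \<omega>)) = (LINT z|(distr M S X \<Otimes>\<^sub>M distr M T Y). h z)"
    unfolding eq using h by (subst integral_distr) auto
  also have "\<dots> = (LINT x|distr M S X. LINT y|distr M T Y. h (x, y))"
    using XY.integral_fst'[OF i] by simp
  also have "\<dots> = (LINT x|distr M S X. 0)"
    by (rule Bochner_Integration.integral_cong) (auto simp: zero)
  finally show ?thesis by simp
qed

section \<open>Gaussian noise\<close>

text \<open>On a set that restricts one coordinate only, the integral of the product density factors, and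
  all other factors are 1. This reduces the moments of the vector to those of the line.\<close>
lemma distributed_gaussian_component:
  fixes X :: "'w \<Rightarrow> real^'n"
  assumes D: "distributed M lborel X (\<lambda>v. ennreal (\<Prod>c\<in>UNIV. normal_density 0 s (v $ c)))"
    and s: "0 < s"
  shows "distributed M lborel (\<lambda>\<omega>. X \<omega> $ c) (normal_density 0 s)"
proof -
  let ?N = "normal_density 0 s"
  have X[measurable]: "X \<in> borel_measurable M" using D by (simp add: distributed_def)
  have bas: "(\<Prod>b\<in>Basis. f b) = (\<Prod>d\<in>UNIV. f (axis d 1))" for f :: "real^'n \<Rightarrow> ennreal"
    by (simp add: Basis_vec_def UNION_singleton_eq_range prod.reindex axis_eq_axis inj_on_def)
  have one: "(\<integral>\<^sup>+t. ?N t \<partial>lborel) = 1"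
    using s integral_normal_density[OF s, of 0] integrable_normal_density[OF s, of 0]
    by (subst nn_integral_eq_integral) auto
  have "emeasure M ((\<lambda>\<omega>. X \<omega> $ c) -` A \<inter> space M) = (\<integral>\<^sup>+t. ?N t * indicator A t \<partial>lborel)"
    if A[measurable]: "A \<in> sets borel" for A
  proof -
    \<comment> \<open>The density, cut down to \<open>A\<close> in coordinate \<open>c\<close> only, as a product over the basis.\<close>
    define f where "f b t = ?N t * (if b = axis c 1 then indicator A t else 1)" for b :: "real^'n" and t
    have "emeasure M ((\<lambda>\<omega>. X \<omega> $ c) -` A \<inter> space M) = emeasure M (X -` {v. v $ c \<in> A} \<inter> space M)"
      by (auto intro!: arg_cong[where f = "emeasure M"])
    also have "\<dots> = (\<integral>\<^sup>+v. ennreal (\<Prod>d\<in>UNIV. ?N (v $ d)) * indicator {v. v $ c \<in> A} v \<partial>lborel)"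
      by (rule distributed_emeasure[OF D]) simp
    also have "\<dots> = (\<integral>\<^sup>+v. (\<Prod>b\<in>Basis. ennreal (f b (inner v b))) \<partial>lborel)"
    proof (rule nn_integral_cong)
      fix v :: "real^'n"
      have "(\<Prod>d\<in>UNIV. if d = c then indicator A (v $ d) else 1) = (indicator A (v $ c) :: real)"
        by (simp add: prod.delta)
      then have "(\<Prod>d\<in>UNIV. f (axis d 1) (v $ d)) = (\<Prod>d\<in>UNIV. ?N (v $ d)) * indicator A (v $ c)"
        by (simp add: f_def prod.distrib axis_eq_axis)
      moreover have "(\<Prod>d\<in>UNIV. ennreal (f (axis d 1) (v $ d))) = ennreal (\<Prod>d\<in>UNIV. f (axis d 1) (v $ d))"
        by (rule prod_ennreal) (simp add: f_def)
      ultimately show "ennreal (\<Prod>d\<in>UNIV. ?N (v $ d)) * indicator {v. v $ c \<in> A} v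
          = (\<Prod>b\<in>Basis. ennreal (f b (inner v b)))"
        unfolding bas inner_axis by (simp add: ennreal_mult' indicator_def)
    qed
    also have "\<dots> = (\<Prod>b\<in>Basis. \<integral>\<^sup>+t. ennreal (f b t) \<partial>lborel)"
    proof -
      have m: "f b \<in> borel_measurable borel" for b
        unfolding f_def by (cases "b = axis c 1") simp_all
      then show ?thesis
        by (intro nn_integral_lborel_prod) auto
    qed
    also have "\<dots> = (\<Prod>d\<in>UNIV. if d = c then (\<integral>\<^sup>+t. ?N t * indicator A t \<partial>lborel) else 1)"
      unfolding bas by (intro prod.cong) (auto simp: f_def one axis_eq_axis)
    also have "\<dots> = (\<integral>\<^sup>+t. ?N t * indicator A t \<partial>lborel)"
      by (simp add: prod.delta)
    finally show ?thesis .
  qed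
  moreover have "(\<lambda>\<omega>. X \<omega> $ c) \<in> borel_measurable M"
    by (rule borel_measurable_continuous_on[OF _ X]) (intro continuous_intros)
  ultimately show ?thesis
    unfolding distributed_def
    by (intro conjI measure_eqI)
      (auto simp: emeasure_distr emeasure_density ennreal_mult' ennreal_indicator)
qed

lemma (in prob_space) gaussian_vector_moments:
  fixes X :: "'a \<Rightarrow> real^'n"
  assumes D: "distributed M lborel X (\<lambda>v. ennreal (\<Prod>c\<in>UNIV. normal_density 0 s (v $ c)))"
    and s: "0 < s"
  shows "square_integrable M X"
    and "expectation (\<lambda>\<omega>. (norm (X \<omega>))\<^sup>2) = real CARD('n) * s\<^sup>2"
    and "expectation (\<lambda>\<omega>. inner v (X \<omega>)) = 0"
proof -
  have X[measurable]: "X \<in> borel_measurable M" using D by (simp add: distributed_def)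
  note Dc = distributed_gaussian_component[OF D s]
  have E0: "expectation (\<lambda>\<omega>. X \<omega> $ c) = 0" for c
    by (rule normal_distributed_expectation[OF s Dc])
  have V: "expectation (\<lambda>\<omega>. (X \<omega> $ c)\<^sup>2) = s\<^sup>2" for c
    using normal_distributed_variance[OF s Dc[of c]] E0[of c] by simp
  have i2: "integrable M (\<lambda>\<omega>. (X \<omega> $ c)\<^sup>2)" for c
    using distributed_integrable[OF Dc, of "\<lambda>t. t\<^sup>2" c] integrable_normal_moment[OF s, of 0 2] by simp
  have i1: "integrable M (\<lambda>\<omega>. X \<omega> $ c)" for c
    using distributed_integrable[OF Dc, of "\<lambda>t. t" c] integrable_normal_moment[OF s, of 0 1] by simp
  have n2: "(norm v)\<^sup>2 = (\<Sum>c\<in>UNIV. (v $ c)\<^sup>2)" for v :: "real^'n"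
    by (simp add: norm_vec_def L2_set_def sum_nonneg)
  show "square_integrable M X"
    unfolding square_integrable_def n2 using i2 by simp
  show "expectation (\<lambda>\<omega>. (norm (X \<omega>))\<^sup>2) = real CARD('n) * s\<^sup>2"
    unfolding n2 using i2 V by simp
  show "expectation (\<lambda>\<omega>. inner v (X \<omega>)) = 0"
    unfolding inner_vec_def using i1 E0 by simp
qed

section \<open>Recursions and harmonic sums\<close>

text \<open>Comparison of the sum with the integral of \<open>1 / t\<close>, term by term through \<open>ln x \<le> x - 1\<close>.\<close>
lemma ln_le_sum_inverse:
  fixes k0 :: real
  assumes "0 < k0"
  shows "ln (real K + k0) - ln k0 \<le> (\<Sum>k=0..K. 1 / (real k + k0))"
proof -
  have step: "ln (t + 1) - ln t \<le> 1 / t" if "0 < t" for t :: real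
    using ln_le_minus_one[of "(t + 1) / t"] that by (simp add: ln_div field_simps)
  have "ln (real K + 1 + k0) - ln k0 \<le> (\<Sum>k=0..K. 1 / (real k + k0))"
  proof (induction K)
    case 0
    show ?case using step[OF assms] by (simp add: add.commute)
  next
    case (Suc K)
    show ?case using Suc step[of "real K + 1 + k0"] assms by (simp add: algebra_simps)
  qed
  moreover have "ln (real K + k0) \<le> ln (real K + 1 + k0)" using assms by simp
  ultimately show ?thesis by linarith
qed

lemma sum_inverse_le_ln:
  fixes k0 :: real
  assumes "0 < k0"
  shows "(\<Sum>k=0..K. 1 / (real k + k0)) \<le> 1 / k0 + (ln (real K + k0) - ln k0)"
proof (induction K)
  case 0
  show ?case by simp
next
  case (Suc K)
  have step: "1 / (t + 1) \<le> ln (t + 1) - ln t" if "0 < t" for t :: real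
    using ln_le_minus_one[of "t / (t + 1)"] that by (simp add: ln_div field_simps)
  show ?case using Suc step[of "real K + k0"] assms by (simp add: algebra_simps)
qed

text \<open>Telescoping with \<open>1 / t\<^sup>2 \<le> 1 / (t - 1) - 1 / t\<close>.\<close>
lemma sum_inverse_sq_le_1:
  fixes k0 :: real
  assumes "2 \<le> k0"
  shows "(\<Sum>k=0..K. 1 / (real k + k0)\<^sup>2) \<le> 1"
proof -
  have step: "1 / t\<^sup>2 \<le> 1 / (t - 1) - 1 / t" if "1 < t" for t :: real
    using that by (simp add: field_simps power2_eq_square)
  have "(\<Sum>k=0..K. 1 / (real k + k0)\<^sup>2) \<le> 1 / (k0 - 1) - 1 / (real K + k0)"
  proof (induction K)
    case 0
    show ?case using step[of k0] assms by simp
  next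
    case (Suc K)
    show ?case using Suc step[of "real (Suc K) + k0"] assms by simp
  qed
  also have "\<dots> \<le> 1 / (k0 - 1)" using assms by simp
  also have "\<dots> \<le> 1" using assms by simp
  finally show ?thesis .
qed

text \<open>The steps \<open>0..K\<close> see the gaps \<open>\<Delta> 0, ..., \<Delta> K\<close>, while \<open>m\<close> bounds only \<open>\<Delta> 1, ..., \<Delta> (K + 1)\<close> from
  below. The telescoped sum leaves \<open>\<Delta> (K + 1)\<close> with weight 1, and since \<open>\<alpha> 0 * \<nu> \<le> 1\<close> it can stand
  in for the missing gap at index 0 with the weight \<open>\<alpha> 0 * \<nu>\<close>.\<close>
lemma best_gap_le:
  fixes \<Delta> \<alpha> e :: "nat \<Rightarrow> real"
  assumes step: "\<And>k. \<Delta> (Suc k) \<le> \<Delta> k - \<alpha> k * \<nu> * \<Delta> k + e k"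
    and pos: "\<And>k. 0 \<le> \<alpha> k" "0 \<le> \<nu>" "0 \<le> \<Delta> 0" and \<alpha>0: "\<alpha> 0 * \<nu> \<le> 1"
    and m: "0 \<le> m" "\<And>k. k \<in> {1..Suc K} \<Longrightarrow> m \<le> \<Delta> k"
  shows "m * \<nu> * (\<Sum>k=0..K. \<alpha> k) \<le> \<Delta> 0 + (\<Sum>k=0..K. e k)"
proof -
  have "\<Delta> (Suc J) + m * \<nu> * (\<Sum>k=1..J. \<alpha> k) \<le> \<Delta> 0 + (\<Sum>k=0..J. e k)" if "J \<le> K" for J
    using that
  proof (induction J)
    case 0
    have "0 \<le> \<alpha> 0 * \<nu> * \<Delta> 0" using pos by simp
    with step[of 0] show ?case by simp
  next
    case (Suc J)
    have "\<alpha> (Suc J) * \<nu> * m \<le> \<alpha> (Suc J) * \<nu> * \<Delta> (Suc J)"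
      using pos m(2)[of "Suc J"] Suc.prems by (intro mult_left_mono) auto
    with Suc step[of "Suc J"] show ?case by (simp add: algebra_simps)
  qed
  from this[of K] have "\<Delta> (Suc K) + m * \<nu> * (\<Sum>k=1..K. \<alpha> k) \<le> \<Delta> 0 + (\<Sum>k=0..K. e k)" by simp
  moreover have "m * (\<alpha> 0 * \<nu>) \<le> m" using mult_left_mono[OF \<alpha>0 m(1)] by simp
  moreover have "m \<le> \<Delta> (Suc K)" by (rule m(2)) simp
  moreover have "(\<Sum>k=0..K. \<alpha> k) = \<alpha> 0 + (\<Sum>k=1..K. \<alpha> k)"
    by (simp add: sum.atLeast_Suc_atMost)
  ultimately show ?thesis by (simp add: algebra_simps)
qed

lemma affine_recursion_le:
  fixes u :: "nat \<Rightarrow> real"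
  assumes step: "\<And>k. u (Suc k) \<le> q * u k + c" and q: "0 \<le> q" "q < 1" and c: "0 \<le> c"
  shows "u k \<le> q ^ k * u 0 + c / (1 - q)"
proof (induction k)
  case 0
  show ?case using q c by simp
next
  case (Suc k)
  have "u (Suc k) \<le> q * (q ^ k * u 0 + c / (1 - q)) + c"
    using step[of k] mult_left_mono[OF Suc q(1)] by linarith
  also have "\<dots> = q ^ Suc k * u 0 + c / (1 - q)"
    using q by (simp add: field_simps)
  finally show ?case .
qed

section \<open>One iteration along a fixed path\<close>

text \<open>A run together with a filtration \<open>\<F>\<close> that witnesses nonanticipation, so that the same filtration
  can serve all iterations.\<close>
locale dp_scc_run =
  fixes P :: "('v, 'n::finite, 's, 'w) dp_scc"
    and \<F> :: "nat \<Rightarrow> 'w measure"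
    and \<sigma> \<zeta> \<nu> \<rho> k0 :: real
  assumes network: "network P" and objectives: "objectives P" and feasible: "feasible P"
    and smooth: "smooth P" and sampling: "sampling P" and gaussian: "gaussian_noise P"
    and filtration: "filtration (space (probspace P)) \<F>"
    and subalgebra: "subalgebra (probspace P) (\<F> k)"
    and adapted: "i \<in> reliable P \<Longrightarrow> sample P i k \<in> \<F> (Suc k) \<rightarrow>\<^sub>M data P i \<and>
        noise P i k \<in> \<F> (Suc k) \<rightarrow>\<^sub>M borel \<and> threshold P i k \<in> \<F> (Suc k) \<rightarrow>\<^sub>M borel \<and>
        (\<forall>j\<in>byz_nbrs P i. byz_msg P k j i \<in> \<F> (Suc k) \<rightarrow>\<^sub>M borel)"
    and indep: "prob_space.indep_set (probspace P) (sets (\<F> k))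
        (sets (vimage_algebra (space (probspace P))
          (\<lambda>\<omega>. \<lambda>i\<in>reliable P. (sample P i k \<omega>, noise P i k \<omega>))
          (\<Pi>\<^sub>M i\<in>reliable P. data P i \<Otimes>\<^sub>M borel)))"
    and variance: "bounded_variance_heterogeneity P \<sigma> \<zeta>"
    and \<nu>: "0 < \<nu>" and PL: "PL_condition P \<nu>"
    and contraction: "contraction_const P \<rho>" and \<rho>: "0 \<le> \<rho>"
    and \<phi>: "varphi_const P \<rho> \<in> {0<..<1}"
    and k0: "k0 > 2 / phi_const P \<rho>"
    and stepsize: "stepsize P k = theta_low P \<rho> \<nu> / (real k + k0)"
begin

abbreviation "R \<equiv> reliable P"
abbreviation "N \<equiv> real (card (reliable P))"
abbreviation "M \<equiv> probspace P"
abbreviation "L \<equiv> lip_max P"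
abbreviation "\<alpha> \<equiv> stepsize P"
abbreviation "\<eta> \<equiv> eta_const P \<rho>"
abbreviation "\<phi> \<equiv> phi_const P \<rho>"
abbreviation "\<theta> \<equiv> theta_low P \<rho> \<nu>"
abbreviation "w2 \<equiv> noise_max_sq P"
abbreviation "f \<equiv> obj P"
abbreviation "fstar \<equiv> opt_val P"
abbreviation "G i \<equiv> grad (local_obj P i)"
abbreviation "x \<equiv> iterate P"
abbreviation "xm \<equiv> mean_iterate P"
abbreviation "D \<equiv> disagreement P"

definition "half k \<omega> = half_step P k \<omega> (x k \<omega>)"
text \<open>\<open>mixed\<close> is the ideal result of aggregation, the virtual average of the half iterates; the true next
  iterate differs from it by the aggregation error.\<close>
definition "mixed k \<omega> i = (\<Sum>j\<in>R. virtual_weight P i j *\<^sub>R half k \<omega> j)"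
definition "grad_noise k \<omega> i = sample_grad P i (x k \<omega> i) (sample P i k \<omega>) - G i (x k \<omega> i)"
definition "priv_noise k \<omega> i = noise P i k \<omega>"
definition "mean_noise k \<omega> = fmean R (\<lambda>i. grad_noise k \<omega> i + priv_noise k \<omega> i)"
definition "noise_energy k \<omega> = (\<Sum>i\<in>R. (norm (grad_noise k \<omega> i))\<^sup>2) + (\<Sum>i\<in>R. (norm (priv_noise k \<omega> i))\<^sup>2)"

lemma R: "finite R" "R \<noteq> {}" "1 \<le> N"
proof -
  show fR: "finite R" "R \<noteq> {}" using network by (auto simp: network_def agents_def)
  then have "1 \<le> card R" by (simp add: Suc_le_eq card_gt_0_iff)
  then show "1 \<le> N" by simp
qed

lemma xm_eq: "xm k \<omega> = fmean R (x k \<omega>)"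
  by (simp add: mean_iterate_def fmean_def)

lemma D_eq: "D k \<omega> = spread R (x k \<omega>)"
  by (simp add: disagreement_def spread_def xm_eq)

lemma virtual_weights: "doubly_stochastic R (virtual_weight P)"
  using network by (simp add: network_def)

subsection \<open>Constants\<close>

lemma eta: "0 < \<eta>" "\<eta> < 1 / 2"
  using \<phi> by (auto simp: eta_const_def)

text \<open>In this form \<open>\<phi>\<close> is seen to be at most half of \<open>\<eta> / (1 - \<eta>)\<close>, the decrement that is left when
  the weight \<open>\<eta>\<close> of Young's inequality has been spent on the gradients.\<close>
lemma phi_eq: "\<phi> = \<eta> / (2 - \<eta>)"
  using \<phi> by (simp add: phi_const_def eta_const_def field_simps)

lemma phi: "0 < \<phi>" "\<phi> \<le> \<eta>" "\<phi> < 1 / 3" "2 * \<phi> \<le> \<eta> / (1 - \<eta>)"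
proof -
  show "0 < \<phi>" "\<phi> \<le> \<eta>" "\<phi> < 1 / 3"
    using eta unfolding phi_eq by (auto simp: field_simps)
  show "2 * \<phi> \<le> \<eta> / (1 - \<eta>)"
    using eta unfolding phi_eq by (simp add: field_simps)
qed

lemma k0_phi: "2 < k0 * \<phi>" "6 < k0"
proof -
  show *: "2 < k0 * \<phi>" using k0 phi(1) by (simp add: field_simps)
  show "6 < k0"
  proof (rule ccontr)
    assume "\<not> 6 < k0"
    then have "k0 * \<phi> \<le> 6 * \<phi>" using phi(1) by (intro mult_right_mono) auto
    then show False using * phi(3) by simp
  qed
qed

lemma L_pos: "0 < L" and lip_le: "i \<in> R \<Longrightarrow> lip P i \<le> L"
proof -
  show le: "i \<in> R \<Longrightarrow> lip P i \<le> L" for i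
    unfolding lip_max_def using R by (intro Max_ge) auto
  obtain i where "i \<in> R" using R by blast
  with le[of i] smooth show "0 < L" by (force simp: smooth_def)
qed

lemma theta: "0 < \<theta>" "\<theta> * \<nu> \<le> 1" "4 * L * \<theta> \<le> \<phi>"
proof -
  have t: "0 < theta_const P \<rho>"
    using phi(1) L_pos by (simp add: theta_const_def)
  then show "0 < \<theta>" using \<nu> by (simp add: theta_low_def)
  have "\<theta> \<le> 1 / \<nu>" by (simp add: theta_low_def)
  then show "\<theta> * \<nu> \<le> 1" using \<nu> by (simp add: field_simps)
  have "4 * L * \<theta> \<le> 4 * L * theta_const P \<rho>"
    using L_pos by (simp add: theta_low_def)
  also have "\<dots> = \<phi> / sqrt 3"
    using L_pos by (simp add: theta_const_def)
  also have "\<dots> \<le> \<phi> / 1"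
    using phi(1) by (intro divide_left_mono) auto
  finally show "4 * L * \<theta> \<le> \<phi>" by simp
qed

lemma alpha_pos: "0 < \<alpha> k" and L_alpha: "8 * L * \<alpha> k \<le> \<phi>\<^sup>2" "4 * L * \<alpha> k \<le> 1"
proof -
  have kk: "0 < real k + k0" "k0 \<le> real k + k0" using k0_phi by auto
  show "0 < \<alpha> k" using theta kk by (simp add: stepsize)
  have "8 * L * \<theta> \<le> 2 * \<phi>" using theta by simp
  also have "2 * \<phi> \<le> \<phi>\<^sup>2 * k0"
    using mult_right_mono[of 2 "k0 * \<phi>" \<phi>] k0_phi phi by (simp add: power2_eq_square algebra_simps)
  also have "\<dots> \<le> \<phi>\<^sup>2 * (real k + k0)" using kk by (intro mult_left_mono) auto
  finally show *: "8 * L * \<alpha> k \<le> \<phi>\<^sup>2"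
    using kk by (simp add: stepsize field_simps)
  have "\<phi>\<^sup>2 \<le> 1" using phi by (simp add: power_le_one)
  then show "4 * L * \<alpha> k \<le> 1" using * by simp
qed

subsection \<open>Gradients and inexact gradient steps\<close>

lemma GDERIV_local: "i \<in> R \<Longrightarrow> GDERIV (local_obj P i) a :> G i a"
  using objectives by (intro differentiable_imp_GDERIV_grad) (auto simp: objectives_def)

lemma GDERIV_obj: "GDERIV f a :> fmean R (\<lambda>i. G i a)"
proof -
  have "((\<lambda>x. (1 / N) * (\<Sum>i\<in>R. local_obj P i x)) has_derivative
      (\<lambda>h. (1 / N) * inner h (\<Sum>i\<in>R. G i a))) (at a)"
    using GDERIV_sum[OF GDERIV_local, of R "\<lambda>i. i" a]
    unfolding gderiv_def by (intro has_derivative_mult_right)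
  then show ?thesis
    unfolding gderiv_def fmean_def by (simp add: obj_def[abs_def])
qed

lemma grad_obj: "grad f a = fmean R (\<lambda>i. G i a)"
  by (rule grad_eqI[OF GDERIV_obj])

lemma lipschitz_local: "i \<in> R \<Longrightarrow> L-lipschitz_on UNIV (G i)"
  using smooth lip_le by (auto simp: smooth_def intro: lipschitz_on_le)

lemma norm_G_diff_le: "i \<in> R \<Longrightarrow> norm (G i a - G i b) \<le> L * norm (a - b)"
  using lipschitz_onD[OF lipschitz_local, of i a b] by (simp add: dist_norm)

lemma lipschitz_obj: "L-lipschitz_on UNIV (grad f)"
proof (rule lipschitz_onI)
  fix a b :: "real^'n"
  have "dist (grad f a) (grad f b) = norm (fmean R (\<lambda>i. G i a - G i b))"
    by (simp add: grad_obj fmean_diff dist_norm)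
  also have "\<dots> \<le> (\<Sum>i\<in>R. norm (G i a - G i b)) / N"
    unfolding fmean_def using norm_sum[of "\<lambda>i. G i a - G i b" R] R
    by (simp add: divide_right_mono)
  also have "\<dots> \<le> (\<Sum>i\<in>R. L * norm (a - b)) / N"
    using R by (intro divide_right_mono sum_mono norm_G_diff_le) auto
  also have "\<dots> = L * dist a b" using R by (simp add: dist_norm)
  finally show "dist (grad f a) (grad f b) \<le> L * dist a b" .
qed (use L_pos in simp)

lemma expected_sample_grad:
  assumes "i \<in> R"
  shows "integrable (data P i) (sample_grad P i a)" "(LINT s|data P i. sample_grad P i a s) = G i a"
  using assms objectives
  by (auto simp: objectives_def has_bochner_integral_iff)

lemma heterogeneity: "i \<in> R \<Longrightarrow> (norm (G i a - grad f a))\<^sup>2 \<le> \<zeta>\<^sup>2"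
  using variance expected_sample_grad(2)
  by (simp add: bounded_variance_heterogeneity_def grad_obj fmean_def)

lemma fstar_le: "fstar \<le> f a"
  using feasible by (auto simp: feasible_def opt_val_def intro: cINF_lower)

lemma PL_grad: "2 * \<nu> * (f a - fstar) \<le> (norm (grad f a))\<^sup>2"
  using PL[unfolded PL_condition_def, rule_format, of a] by simp

subsection \<open>The half step and its spread\<close>

lemma half_eq: "half k \<omega> i = x k \<omega> i - \<alpha> k *\<^sub>R (G i (x k \<omega> i) + (grad_noise k \<omega> i + priv_noise k \<omega> i))"
  by (simp add: half_def half_step_def grad_noise_def priv_noise_def algebra_simps)

lemma sum_lipschitz_le_D:
  "(\<Sum>i\<in>R. (norm (G i (x k \<omega> i) - G i (xm k \<omega>)))\<^sup>2) \<le> L\<^sup>2 * D k \<omega>"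
proof -
  have "(norm (G i (x k \<omega> i) - G i (xm k \<omega>)))\<^sup>2 \<le> L\<^sup>2 * (norm (x k \<omega> i - xm k \<omega>))\<^sup>2" if "i \<in> R" for i
    using norm_G_diff_le[OF that] by (metis norm_ge_zero power_mono power_mult_distrib)
  then show ?thesis
    unfolding disagreement_def sum_distrib_left by (rule sum_mono)
qed

text \<open>The gradient of agent \<open>i\<close> differs from the common vector \<open>grad f (xm k \<omega>)\<close> by four terms: smoothness,
  heterogeneity, sampling and privacy noise. Young's inequality with weight \<open>\<eta>\<close> leaves the factor
  \<open>1 / (1 - \<eta>)\<close> on the disagreement.\<close>
lemma spread_half_le:
  "spread R (half k \<omega>) \<le> D k \<omega> / (1 - \<eta>)
     + 4 * (\<alpha> k)\<^sup>2 / \<eta> * (L\<^sup>2 * D k \<omega> + N * \<zeta>\<^sup>2 + noise_energy k \<omega>)"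
proof -
  let ?g = "\<lambda>i. G i (x k \<omega> i) + (grad_noise k \<omega> i + priv_noise k \<omega> i)"
  have "spread R ?g \<le> (\<Sum>i\<in>R. (norm (?g i - grad f (xm k \<omega>)))\<^sup>2)"
    by (rule spread_le) (rule R)+
  also have "\<dots> \<le> (\<Sum>i\<in>R. 4 * ((norm (G i (x k \<omega> i) - G i (xm k \<omega>)))\<^sup>2 + \<zeta>\<^sup>2
      + (norm (grad_noise k \<omega> i))\<^sup>2 + (norm (priv_noise k \<omega> i))\<^sup>2))"
  proof (rule sum_mono)
    fix i assume i: "i \<in> R"
    have eq: "?g i - grad f (xm k \<omega>) = (G i (x k \<omega> i) - G i (xm k \<omega>))
        + (G i (xm k \<omega>) - grad f (xm k \<omega>)) + grad_noise k \<omega> i + priv_noise k \<omega> i" by simp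
    show "(norm (?g i - grad f (xm k \<omega>)))\<^sup>2 \<le> 4 * ((norm (G i (x k \<omega> i) - G i (xm k \<omega>)))\<^sup>2 + \<zeta>\<^sup>2
      + (norm (grad_noise k \<omega> i))\<^sup>2 + (norm (priv_noise k \<omega> i))\<^sup>2)"
      unfolding eq
      by (rule order_trans[OF norm_sum4_sq_le])
        (intro mult_left_mono add_right_mono add_left_mono heterogeneity[OF i], simp)
  qed
  also have "\<dots> = 4 * ((\<Sum>i\<in>R. (norm (G i (x k \<omega> i) - G i (xm k \<omega>)))\<^sup>2) + N * \<zeta>\<^sup>2 + noise_energy k \<omega>)"
    by (simp add: noise_energy_def sum.distrib flip: sum_distrib_left)
  also have "\<dots> \<le> 4 * (L\<^sup>2 * D k \<omega> + N * \<zeta>\<^sup>2 + noise_energy k \<omega>)"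
    using sum_lipschitz_le_D by simp
  finally have g: "spread R ?g \<le> 4 * (L\<^sup>2 * D k \<omega> + N * \<zeta>\<^sup>2 + noise_energy k \<omega>)" .
  have "spread R (half k \<omega>) = spread R (\<lambda>i. x k \<omega> i - \<alpha> k *\<^sub>R ?g i)"
    by (simp add: half_eq[abs_def])
  also have "\<dots> \<le> D k \<omega> / (1 - \<eta>) + (\<alpha> k)\<^sup>2 / \<eta> * spread R ?g"
    unfolding D_eq using eta by (intro spread_diff_scaleR_le) auto
  also have "\<dots> \<le> D k \<omega> / (1 - \<eta>) + (\<alpha> k)\<^sup>2 / \<eta> * (4 * (L\<^sup>2 * D k \<omega> + N * \<zeta>\<^sup>2 + noise_energy k \<omega>))"
    using g eta by (intro add_left_mono mult_left_mono) auto
  also have "(\<alpha> k)\<^sup>2 / \<eta> * (4 * Z) = 4 * (\<alpha> k)\<^sup>2 / \<eta> * Z" for Z by simp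
  finally show ?thesis .
qed

subsection \<open>The aggregation error\<close>

text \<open>The sum over reliable neighbors extends to all reliable agents since the other weights vanish.\<close>
lemma virtual_avg_messages:
  assumes i: "i \<in> R"
  shows "virtual_avg P (messages P k \<omega> (x k \<omega>) i) i = mixed k \<omega> i"
proof -
  have sub: "insert i (rel_nbrs P i) \<subseteq> R" using i by (auto simp: rel_nbrs_def)
  have "virtual_avg P (messages P k \<omega> (x k \<omega>) i) i
      = (\<Sum>j\<in>insert i (rel_nbrs P i). virtual_weight P i j *\<^sub>R half k \<omega> j)"
    unfolding virtual_avg_def using sub
    by (intro sum.cong) (auto simp: messages_def half_def)
  also have "\<dots> = (\<Sum>j\<in>R. virtual_weight P i j *\<^sub>R half k \<omega> j)"
  proof (rule sum.mono_neutral_left[OF R(1) sub], rule ballI)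
    fix j assume j: "j \<in> R - insert i (rel_nbrs P i)"
    moreover have "\<forall>i\<in>agents P. \<forall>j\<in>agents P. j \<noteq> i \<and> \<not> adj P i j \<longrightarrow> weight P i j = 0"
      using network unfolding network_def by blast
    ultimately have "weight P i j = 0"
      using i by (auto simp: rel_nbrs_def nbrs_def agents_def)
    then show "virtual_weight P i j *\<^sub>R half k \<omega> j = 0"
      using j by (simp add: virtual_weight_def)
  qed
  finally show ?thesis by (simp add: mixed_def)
qed

lemma AE_aggregation_error:
  "AE \<omega> in M. \<forall>i\<in>R. norm (x (Suc k) \<omega> i - mixed k \<omega> i) \<le> \<rho> * sqrt (2 * spread R (half k \<omega>))"
proof -
  have "AE \<omega> in M. norm (x (Suc k) \<omega> i - mixed k \<omega> i) \<le> \<rho> * sqrt (2 * spread R (half k \<omega>))"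
    if i: "i \<in> R" for i
  proof -
    have "AE \<omega> in M. (let z = messages P k \<omega> (x k \<omega>) i; xhat = virtual_avg P z i in
         norm (scc (weight P) (nbrs P i) (threshold P i k \<omega>) i z - xhat)
           \<le> \<rho> * Max ((\<lambda>j. norm (z j - xhat)) ` insert i (rel_nbrs P i)))"
      using contraction i by (simp add: contraction_const_def)
    then show ?thesis
    proof eventually_elim
      case (elim \<omega>)
      let ?z = "messages P k \<omega> (x k \<omega>) i"
      have sub: "insert i (rel_nbrs P i) \<subseteq> R" using i by (auto simp: rel_nbrs_def)
      have "norm (x (Suc k) \<omega> i - mixed k \<omega> i)
          \<le> \<rho> * Max ((\<lambda>j. norm (?z j - mixed k \<omega> i)) ` insert i (rel_nbrs P i))"
        using elim by (simp add: Let_def virtual_avg_messages[OF i] scc_step_def)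
      also have "\<dots> \<le> \<rho> * sqrt (2 * spread R (half k \<omega>))"
      proof (intro mult_left_mono[OF _ \<rho>] Max.boundedI)
        show "finite ((\<lambda>j. norm (?z j - mixed k \<omega> i)) ` insert i (rel_nbrs P i))"
          using sub R(1) by (intro finite_imageI) (rule finite_subset)
        fix t assume "t \<in> (\<lambda>j. norm (?z j - mixed k \<omega> i)) ` insert i (rel_nbrs P i)"
        then obtain j where j: "j \<in> R" and t: "t = norm (half k \<omega> j - mixed k \<omega> i)"
          using sub by (auto simp: messages_def half_def)
        show "t \<le> sqrt (2 * spread R (half k \<omega>))"
          unfolding t mixed_def using virtual_weights i j R(1)
          by (intro norm_diff_convex_comb_le_spread) (auto simp: doubly_stochastic_def)
      qed simp
      finally show ?case .
    qed
  qed
  then show ?thesis using R(1) by (simp add: AE_finite_all)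
qed

lemma aggregation_error_sq:
  assumes "\<forall>i\<in>R. norm (x (Suc k) \<omega> i - mixed k \<omega> i) \<le> \<rho> * sqrt (2 * spread R (half k \<omega>))" "i \<in> R"
  shows "(norm (x (Suc k) \<omega> i - mixed k \<omega> i))\<^sup>2 \<le> 2 * \<rho>\<^sup>2 * spread R (half k \<omega>)"
proof -
  have "(norm (x (Suc k) \<omega> i - mixed k \<omega> i))\<^sup>2 \<le> (\<rho> * sqrt (2 * spread R (half k \<omega>)))\<^sup>2"
    using assms by (intro power_mono) auto
  also have "\<dots> = 2 * \<rho>\<^sup>2 * spread R (half k \<omega>)"
    using spread_nonneg[of R "half k \<omega>"] by (simp add: power_mult_distrib)
  finally show ?thesis .
qed

lemma noise_energy_nonneg: "0 \<le> noise_energy k \<omega>"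
  by (simp add: noise_energy_def sum_nonneg)

lemma D_nonneg: "0 \<le> D k \<omega>"
  by (simp add: D_eq spread_nonneg)

text \<open>By the triangle inequality mixing and aggregation error together scale the root of the spread by
  \<open>s + sqrt 2 * \<rho> * sqrt N\<close>, where \<open>s\<^sup>2 = 1 - \<lambda>\<close>. The square of this factor is at most \<open>1 - 2 \<eta>\<close>: the
  summand \<open>4 * \<rho> * sqrt N\<close> in \<open>varphi_const\<close> covers the cross term and the square of the error. Young's inequality turns
  \<open>1 - 2 \<eta>\<close> into \<open>1 - \<eta> / (1 - \<eta>) \<le> 1 - 2 \<phi>\<close>; one \<open>\<phi>\<close> absorbs the term with \<open>L\<^sup>2 \<alpha>\<^sup>2 D\<close>.\<close>
lemma disagreement_step:
  assumes e: "\<forall>i\<in>R. norm (x (Suc k) \<omega> i - mixed k \<omega> i) \<le> \<rho> * sqrt (2 * spread R (half k \<omega>))"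
  shows "D (Suc k) \<omega> \<le> (1 - \<phi>) * D k \<omega> + 4 * (\<alpha> k)\<^sup>2 / \<eta> * (N * \<zeta>\<^sup>2 + noise_energy k \<omega>)"
proof -
  define s where "s = spectral_norm R (\<lambda>i j. virtual_weight P i j - 1 / N)"
  define t where "t = \<rho> * sqrt N"
  define S where "S = spread R (half k \<omega>)"
  define A where "A = 4 * (\<alpha> k)\<^sup>2 / \<eta> * (N * \<zeta>\<^sup>2 + noise_energy k \<omega>)"
  have S: "0 \<le> S" by (simp add: S_def spread_nonneg)
  have A: "0 \<le> A" using eta R noise_energy_nonneg by (simp add: A_def)
  have s0: "0 \<le> s" unfolding s_def by (rule spectral_norm_nonneg) (rule R)+
  have t0: "0 \<le> t" using \<rho> by (simp add: t_def)
  have s2: "s\<^sup>2 = 1 - 2 * \<eta> - 4 * t"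
    unfolding s_def t_def eta_const_def varphi_const_def lambda_const_def by (simp add: field_simps)
  \<comment> \<open>From \<open>0 \<le> s\<^sup>2 = 1 - 2 \<eta> - 4 t\<close> follow \<open>s \<le> 1\<close> and \<open>t \<le> 1 / 4\<close>, so \<open>2 sqrt 2 s t + 2 t\<^sup>2 \<le> 4 t\<close>.\<close>
  have contr: "(s + sqrt 2 * t)\<^sup>2 \<le> 1 - 2 * \<eta>"
  proof -
    have t4: "t \<le> 1 / 4" using s2 zero_le_power2[of s] eta by linarith
    have "s\<^sup>2 \<le> 1\<^sup>2" using s2 eta t0 by simp
    then have s1: "s \<le> 1" by (rule power2_le_imp_le) simp
    have r2: "sqrt 2 \<le> 3 / 2" by (rule real_le_lsqrt) (auto simp: power2_eq_square)
    have "(s + sqrt 2 * t)\<^sup>2 = s\<^sup>2 + 2 * (s * (sqrt 2 * t)) + 2 * (t * t)"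
      unfolding power2_sum power_mult_distrib by (simp add: power2_eq_square[of t])
    also have "s * (sqrt 2 * t) \<le> 1 * (3 / 2 * t)"
      using s1 s0 r2 t0 by (intro mult_mono) auto
    also have "t * t \<le> 1 / 4 * t" using t4 t0 by (intro mult_right_mono) auto
    finally show ?thesis using s2 t0 by simp
  qed
  have "sqrt (D (Suc k) \<omega>) = sqrt (spread R (\<lambda>i. mixed k \<omega> i + (x (Suc k) \<omega> i - mixed k \<omega> i)))"
    by (simp add: D_eq)
  also have "\<dots> \<le> sqrt (spread R (mixed k \<omega>)) + sqrt (\<Sum>i\<in>R. (norm (x (Suc k) \<omega> i - mixed k \<omega> i))\<^sup>2)"
    by (rule sqrt_spread_add_le) (rule R)+
  also have "\<dots> \<le> s * sqrt S + sqrt 2 * t * sqrt S"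
  proof (rule add_mono)
    have "spread R (mixed k \<omega>) \<le> s\<^sup>2 * S"
      unfolding mixed_def[abs_def] S_def s_def using R(1,2) virtual_weights
      by (rule spread_doubly_stochastic_le)
    then have "sqrt (spread R (mixed k \<omega>)) \<le> sqrt (s\<^sup>2 * S)" by simp
    then show "sqrt (spread R (mixed k \<omega>)) \<le> s * sqrt S"
      using s0 by (simp add: real_sqrt_mult)
    have "(\<Sum>i\<in>R. (norm (x (Suc k) \<omega> i - mixed k \<omega> i))\<^sup>2) \<le> (\<Sum>i\<in>R. 2 * \<rho>\<^sup>2 * S)"
      unfolding S_def using aggregation_error_sq[OF e] by (intro sum_mono)
    also have "\<dots> = (sqrt 2 * t * sqrt S)\<^sup>2"
      using S by (simp add: t_def power_mult_distrib)
    finally show "sqrt (\<Sum>i\<in>R. (norm (x (Suc k) \<omega> i - mixed k \<omega> i))\<^sup>2) \<le> sqrt 2 * t * sqrt S"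
      using t0 S by (simp add: real_le_lsqrt)
  qed
  also have "\<dots> = (s + sqrt 2 * t) * sqrt S" by (simp add: algebra_simps)
  finally have "(sqrt (D (Suc k) \<omega>))\<^sup>2 \<le> ((s + sqrt 2 * t) * sqrt S)\<^sup>2"
    by (rule power_mono) (simp add: D_nonneg)
  then have "D (Suc k) \<omega> \<le> (s + sqrt 2 * t)\<^sup>2 * S"
    using S by (simp add: D_nonneg power_mult_distrib)
  also have "\<dots> \<le> (1 - 2 * \<eta>) * S" using contr S by (rule mult_right_mono)
  also have "\<dots> \<le> (1 - 2 * \<eta>) * (D k \<omega> / (1 - \<eta>) + 4 * (\<alpha> k)\<^sup>2 / \<eta> * (L\<^sup>2 * D k \<omega>) + A)"
    using spread_half_le[of k \<omega>] eta unfolding S_def A_def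
    by (intro mult_left_mono) (auto simp: algebra_simps add_divide_distrib)
  also have "\<dots> \<le> (1 - 2 * \<eta>) / (1 - \<eta>) * D k \<omega> + 4 * (\<alpha> k)\<^sup>2 / \<eta> * (L\<^sup>2 * D k \<omega>) + A"
  proof -
    have "(1 - 2 * \<eta>) * (4 * (\<alpha> k)\<^sup>2 / \<eta> * (L\<^sup>2 * D k \<omega>) + A)
        \<le> 1 * (4 * (\<alpha> k)\<^sup>2 / \<eta> * (L\<^sup>2 * D k \<omega>) + A)"
      using eta A D_nonneg by (intro mult_right_mono) auto
    then show ?thesis by (simp add: distrib_left add_divide_distrib)
  qed
  also have "\<dots> \<le> (1 - \<phi>) * D k \<omega> + A"
  proof -
    have "(1 - 2 * \<eta>) / (1 - \<eta>) = 1 - \<eta> / (1 - \<eta>)" using eta by (simp add: field_simps)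
    then have 1: "(1 - 2 * \<eta>) / (1 - \<eta>) \<le> 1 - 2 * \<phi>" using phi by simp
    have "4 * (\<alpha> k)\<^sup>2 * L\<^sup>2 = (8 * L * \<alpha> k)\<^sup>2 / 16" by (simp add: power_mult_distrib)
    also have "\<dots> \<le> (\<phi>\<^sup>2)\<^sup>2 / 16"
      using L_alpha alpha_pos[of k] L_pos by (intro divide_right_mono power_mono) auto
    also have "\<dots> \<le> \<phi> * \<phi>"
    proof -
      have "\<phi>\<^sup>2 * \<phi>\<^sup>2 \<le> \<phi>\<^sup>2 * 1" using phi by (intro mult_left_mono) (auto simp: power_le_one)
      then show ?thesis using mult_nonneg_nonneg[of \<phi> \<phi>] phi by (simp add: power2_eq_square)
    qed
    also have "\<dots> \<le> \<phi> * \<eta>" using phi by (intro mult_left_mono) auto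
    finally have 2: "4 * (\<alpha> k)\<^sup>2 / \<eta> * L\<^sup>2 \<le> \<phi>" using eta by (simp add: field_simps)
    have "((1 - 2 * \<eta>) / (1 - \<eta>) + 4 * (\<alpha> k)\<^sup>2 / \<eta> * L\<^sup>2) * D k \<omega> \<le> (1 - \<phi>) * D k \<omega>"
      using 1 2 D_nonneg by (intro mult_right_mono) auto
    then show ?thesis by (simp add: algebra_simps)
  qed
  finally show ?thesis by (simp add: A_def)
qed

text \<open>The aggregation preserves the mean up to the mean of the aggregation errors, so
  \<open>inexact_gradient_step\<close> applies at the mean iterate. The P-L condition replaces the squared
  gradient by the gap.\<close>
lemma objective_step:
  assumes e: "\<forall>i\<in>R. norm (x (Suc k) \<omega> i - mixed k \<omega> i) \<le> \<rho> * sqrt (2 * spread R (half k \<omega>))"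
  shows "f (xm (Suc k) \<omega>) \<le> f (xm k \<omega>) - \<alpha> k * \<nu> * (f (xm k \<omega>) - fstar)
    - \<alpha> k * inner (grad f (xm k \<omega>)) (mean_noise k \<omega>) + \<alpha> k * L\<^sup>2 / N * D k \<omega>
    + 2 * \<rho>\<^sup>2 / \<alpha> k * (D k \<omega> / (1 - \<eta>) + 4 * (\<alpha> k)\<^sup>2 / \<eta> * (L\<^sup>2 * D k \<omega> + N * \<zeta>\<^sup>2 + noise_energy k \<omega>))
    + L * (\<alpha> k)\<^sup>2 / N * ((\<Sum>i\<in>R. (norm (grad_noise k \<omega> i))\<^sup>2) + 2 * (\<Sum>i\<in>R. (norm (priv_noise k \<omega> i))\<^sup>2))"
proof -
  let ?a = "xm k \<omega>" and ?g = "fmean R (\<lambda>i. G i (x k \<omega> i))"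
  let ?e = "fmean R (\<lambda>i. x (Suc k) \<omega> i - mixed k \<omega> i)"
  have "fmean R (mixed k \<omega>) = fmean R (half k \<omega>)"
    unfolding mixed_def[abs_def] by (rule fmean_doubly_stochastic[OF virtual_weights])
  also have "\<dots> = ?a - \<alpha> k *\<^sub>R (?g + mean_noise k \<omega>)"
    unfolding half_eq[abs_def] mean_noise_def xm_eq by (simp only: fmean_diff fmean_scaleR fmean_add)
  finally have "xm (Suc k) \<omega> = ?a - \<alpha> k *\<^sub>R (?g + mean_noise k \<omega>) + ?e"
    unfolding xm_eq[of "Suc k"] by (simp add: fmean_diff)
  then have 1: "f (xm (Suc k) \<omega>) \<le> f ?a - \<alpha> k / 2 * (norm (grad f ?a))\<^sup>2
    - \<alpha> k * inner (grad f ?a) (mean_noise k \<omega>) + \<alpha> k * (norm (grad f ?a - ?g))\<^sup>2 + (norm ?e)\<^sup>2 / \<alpha> k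
    + 2 / 3 * L * (\<alpha> k)\<^sup>2 * (norm (mean_noise k \<omega>))\<^sup>2"
    using inexact_gradient_step[of f "grad f" L "\<alpha> k" ?a ?g "mean_noise k \<omega>" ?e] GDERIV_obj lipschitz_obj
      alpha_pos[of k] L_alpha[of k] by (simp add: grad_obj[abs_def])
  have 2: "\<alpha> k * \<nu> * (f ?a - fstar) \<le> \<alpha> k / 2 * (norm (grad f ?a))\<^sup>2"
    using mult_left_mono[OF PL_grad[of ?a], of "\<alpha> k / 2"] alpha_pos[of k] by simp
  have "(norm (grad f ?a - ?g))\<^sup>2 \<le> (\<Sum>i\<in>R. (norm (G i ?a - G i (x k \<omega> i)))\<^sup>2) / N"
    unfolding grad_obj fmean_diff[symmetric] by (rule norm_fmean_sq_le) (rule R)+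
  also have "\<dots> \<le> L\<^sup>2 * D k \<omega> / N"
    using sum_lipschitz_le_D[of k \<omega>] R by (intro divide_right_mono) (auto simp: norm_minus_commute)
  finally have 3: "\<alpha> k * (norm (grad f ?a - ?g))\<^sup>2 \<le> \<alpha> k * L\<^sup>2 / N * D k \<omega>"
    using mult_left_mono[of _ "L\<^sup>2 * D k \<omega> / N" "\<alpha> k"] alpha_pos[of k] by (simp add: mult.assoc)
  have "(norm ?e)\<^sup>2 \<le> (\<Sum>i\<in>R. (norm (x (Suc k) \<omega> i - mixed k \<omega> i))\<^sup>2) / N"
    by (rule norm_fmean_sq_le) (rule R)+
  also have "\<dots> \<le> (\<Sum>i\<in>R. 2 * \<rho>\<^sup>2 * spread R (half k \<omega>)) / N"
    using aggregation_error_sq[OF e] R by (intro divide_right_mono sum_mono) auto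
  also have "\<dots> = 2 * \<rho>\<^sup>2 * spread R (half k \<omega>)" using R by simp
  also have "\<dots> \<le> 2 * \<rho>\<^sup>2 * (D k \<omega> / (1 - \<eta>) + 4 * (\<alpha> k)\<^sup>2 / \<eta> * (L\<^sup>2 * D k \<omega> + N * \<zeta>\<^sup>2 + noise_energy k \<omega>))"
    by (intro mult_left_mono spread_half_le) auto
  finally have 4: "(norm ?e)\<^sup>2 / \<alpha> k \<le> 2 * \<rho>\<^sup>2 / \<alpha> k
      * (D k \<omega> / (1 - \<eta>) + 4 * (\<alpha> k)\<^sup>2 / \<eta> * (L\<^sup>2 * D k \<omega> + N * \<zeta>\<^sup>2 + noise_energy k \<omega>))"
    using alpha_pos[of k] by (simp add: divide_right_mono)
  have "(norm (mean_noise k \<omega>))\<^sup>2 \<le> (\<Sum>i\<in>R. (norm (grad_noise k \<omega> i + priv_noise k \<omega> i))\<^sup>2) / N"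
    unfolding mean_noise_def by (rule norm_fmean_sq_le) (rule R)+
  also have "\<dots> \<le> (\<Sum>i\<in>R. 3 / 2 * (norm (grad_noise k \<omega> i))\<^sup>2 + 3 * (norm (priv_noise k \<omega> i))\<^sup>2) / N"
    using norm_add_sq_weighted[of "1/3" "grad_noise k \<omega> _" "priv_noise k \<omega> _"]
    by (intro divide_right_mono sum_mono) (auto simp: mult.commute)
  also have "\<dots> = 3 / 2 * (((\<Sum>i\<in>R. (norm (grad_noise k \<omega> i))\<^sup>2) + 2 * (\<Sum>i\<in>R. (norm (priv_noise k \<omega> i))\<^sup>2)) / N)"
    by (simp only: sum.distrib sum_distrib_left[symmetric]) (simp add: field_simps)
  finally have "2 / 3 * L * (\<alpha> k)\<^sup>2 * (norm (mean_noise k \<omega>))\<^sup>2 \<le> 2 / 3 * L * (\<alpha> k)\<^sup>2 *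
      (3 / 2 * (((\<Sum>i\<in>R. (norm (grad_noise k \<omega> i))\<^sup>2) + 2 * (\<Sum>i\<in>R. (norm (priv_noise k \<omega> i))\<^sup>2)) / N))"
    using L_pos by (intro mult_left_mono) auto
  also have "2 / 3 * L * (\<alpha> k)\<^sup>2 * (3 / 2 * (Z / N)) = L * (\<alpha> k)\<^sup>2 / N * Z" for Z by simp
  finally have 5: "2 / 3 * L * (\<alpha> k)\<^sup>2 * (norm (mean_noise k \<omega>))\<^sup>2 \<le> L * (\<alpha> k)\<^sup>2 / N *
      ((\<Sum>i\<in>R. (norm (grad_noise k \<omega> i))\<^sup>2) + 2 * (\<Sum>i\<in>R. (norm (priv_noise k \<omega> i))\<^sup>2))" .
  show ?thesis using 1 2 3 4 5 by linarith
qed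

section \<open>Measurability and independence along a run\<close>
sublocale prob_space M
  using sampling by (simp add: sampling_def)

lemma measurable_F_M: "g \<in> \<F> k \<rightarrow>\<^sub>M T \<Longrightarrow> g \<in> M \<rightarrow>\<^sub>M T"
  using measurable_from_subalg[OF subalgebra] .

lemma measurable_F_Suc: "g \<in> \<F> k \<rightarrow>\<^sub>M T \<Longrightarrow> g \<in> \<F> (Suc k) \<rightarrow>\<^sub>M T"
  using filtration.sets_F_mono[OF filtration, of k "Suc k"] filtration.space_F[OF filtration]
  by (intro measurable_from_subalg[of "\<F> (Suc k)" "\<F> k"]) (auto simp: subalgebra_def)

lemma measurable_sample_grad:
  assumes "i \<in> R" and [measurable]: "a \<in> T \<rightarrow>\<^sub>M borel" "s \<in> T \<rightarrow>\<^sub>M data P i"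
  shows "(\<lambda>\<omega>. sample_grad P i (a \<omega>) (s \<omega>)) \<in> borel_measurable T"
proof -
  have [measurable]: "(\<lambda>(a, s). sample_grad P i a s) \<in> borel_measurable (borel \<Otimes>\<^sub>M data P i)"
    using objectives assms(1) by (auto simp: objectives_def)
  have "(\<lambda>\<omega>. (\<lambda>(a, s). sample_grad P i a s) (a \<omega>, s \<omega>)) \<in> borel_measurable T"
    by measurable
  then show ?thesis by simp
qed

lemma measurable_G: "i \<in> R \<Longrightarrow> G i \<in> borel_measurable borel"
  by (intro borel_measurable_continuous_onI lipschitz_on_continuous_on[OF lipschitz_local])

lemma measurable_scc:
  assumes "finite I" and [measurable]: "\<And>j. j \<in> insert i I \<Longrightarrow> (\<lambda>\<omega>. z \<omega> j) \<in> borel_measurable T"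
    and [measurable]: "\<tau> \<in> borel_measurable T"
  shows "(\<lambda>\<omega>. scc w I (\<tau> \<omega>) i (z \<omega>) :: real^'n) \<in> borel_measurable T"
  unfolding scc_def clip_def
proof (rule borel_measurable_sum)
  fix j assume j: "j \<in> insert i I"
  have [measurable]: "(\<lambda>\<omega>. z \<omega> j) \<in> borel_measurable T" "(\<lambda>\<omega>. z \<omega> i) \<in> borel_measurable T"
    using j by (auto intro: assms(2))
  show "(\<lambda>\<omega>. w i j *\<^sub>R (z \<omega> i + min 1 (\<tau> \<omega> / norm (z \<omega> j - z \<omega> i)) *\<^sub>R (z \<omega> j - z \<omega> i)))
    \<in> borel_measurable T"
    by measurable
qed

lemma measurable_iterate_step:
  assumes x: "\<And>j. j \<in> R \<Longrightarrow> (\<lambda>\<omega>. x k \<omega> j) \<in> borel_measurable (\<F> k)" and i: "i \<in> R"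
  shows "(\<lambda>\<omega>. half k \<omega> i) \<in> borel_measurable (\<F> (Suc k))"
    and "(\<lambda>\<omega>. x (Suc k) \<omega> i) \<in> borel_measurable (\<F> (Suc k))"
proof -
  have half: "(\<lambda>\<omega>. half k \<omega> j) \<in> borel_measurable (\<F> (Suc k))" if j: "j \<in> R" for j
  proof -
    have [measurable]: "(\<lambda>\<omega>. x k \<omega> j) \<in> borel_measurable (\<F> (Suc k))"
      using x[OF j] by (rule measurable_F_Suc)
    have [measurable]: "noise P j k \<in> borel_measurable (\<F> (Suc k))"
      "sample P j k \<in> \<F> (Suc k) \<rightarrow>\<^sub>M data P j"
      using adapted[OF j] by auto
    have [measurable]: "(\<lambda>\<omega>. sample_grad P j (x k \<omega> j) (sample P j k \<omega>)) \<in> borel_measurable (\<F> (Suc k))"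
      by (rule measurable_sample_grad[OF j]) measurable
    show ?thesis unfolding half_def half_step_def by measurable
  qed
  show "(\<lambda>\<omega>. half k \<omega> i) \<in> borel_measurable (\<F> (Suc k))" by (rule half[OF i])
  have "(\<lambda>\<omega>. messages P k \<omega> (x k \<omega>) i j) \<in> borel_measurable (\<F> (Suc k))"
    if "j \<in> insert i (nbrs P i)" for j
  proof (cases "j \<in> R")
    case True
    then show ?thesis using half[OF True] by (simp add: messages_def half_def)
  next
    case False
    then have "j \<in> byz_nbrs P i" using that i by (auto simp: byz_nbrs_def nbrs_def agents_def)
    then show ?thesis using False adapted[OF i] by (simp add: messages_def)
  qed
  moreover have "finite (nbrs P i)" using network by (simp add: network_def nbrs_def)
  ultimately show "(\<lambda>\<omega>. x (Suc k) \<omega> i) \<in> borel_measurable (\<F> (Suc k))"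
    using adapted[OF i, of k] unfolding iterate.simps scc_step_def
    by (intro measurable_scc[where z = "\<lambda>\<omega>. messages P k \<omega> (x k \<omega>) i"]) auto
qed

lemma measurable_iterate: "i \<in> R \<Longrightarrow> (\<lambda>\<omega>. x k \<omega> i) \<in> borel_measurable (\<F> k)"
  by (induction k arbitrary: i) (simp, blast intro: measurable_iterate_step(2))

lemma measurable_xm: "xm k \<in> borel_measurable (\<F> k)"
  unfolding mean_iterate_def[abs_def] using measurable_iterate by measurable

text \<open>The \<open>\<sigma>\<close>-algebra of everything drawn in iteration \<open>k\<close>, which is independent of \<open>\<F> k\<close>.\<close>
definition "fresh k = vimage_algebra (space M) (\<lambda>\<omega>. \<lambda>i\<in>R. (sample P i k \<omega>, noise P i k \<omega>))
  (\<Pi>\<^sub>M i\<in>R. data P i \<Otimes>\<^sub>M borel)"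

lemma measurable_fresh:
  assumes i: "i \<in> R"
  shows "sample P i k \<in> fresh k \<rightarrow>\<^sub>M data P i" "noise P i k \<in> fresh k \<rightarrow>\<^sub>M borel"
proof -
  let ?g = "\<lambda>\<omega>. \<lambda>i\<in>R. (sample P i k \<omega>, noise P i k \<omega>)"
  have rv: "(\<lambda>\<omega>. (sample P i k \<omega>, noise P i k \<omega>)) \<in> M \<rightarrow>\<^sub>M data P i \<Otimes>\<^sub>M borel" if "i \<in> R" for i
    using adapted[OF that, of k] by (intro measurable_Pair measurable_F_M[where k = "Suc k"]) simp_all
  have "?g \<in> M \<rightarrow>\<^sub>M (\<Pi>\<^sub>M i\<in>R. data P i \<Otimes>\<^sub>M borel)"
    using rv by (rule measurable_restrict)
  then have "?g \<in> fresh k \<rightarrow>\<^sub>M (\<Pi>\<^sub>M i\<in>R. data P i \<Otimes>\<^sub>M borel)"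
    unfolding fresh_def by (intro measurable_vimage_algebra1) (auto dest: measurable_space)
  then have "(\<lambda>\<omega>. ?g \<omega> i) \<in> fresh k \<rightarrow>\<^sub>M data P i \<Otimes>\<^sub>M borel"
    using measurable_component_singleton[OF i] by (rule measurable_compose)
  then have *: "(\<lambda>\<omega>. (sample P i k \<omega>, noise P i k \<omega>)) \<in> fresh k \<rightarrow>\<^sub>M data P i \<Otimes>\<^sub>M borel"
    using i by simp
  show "sample P i k \<in> fresh k \<rightarrow>\<^sub>M data P i" "noise P i k \<in> fresh k \<rightarrow>\<^sub>M borel"
    using measurable_compose[OF * measurable_fst] measurable_compose[OF * measurable_snd] by simp_all
qed

lemma distr_pair_fresh:
  assumes "X \<in> \<F> k \<rightarrow>\<^sub>M S" "Y \<in> fresh k \<rightarrow>\<^sub>M T"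
  shows "random_variable S X" "random_variable T Y"
    "distr M S X \<Otimes>\<^sub>M distr M T Y = distr M (S \<Otimes>\<^sub>M T) (\<lambda>\<omega>. (X \<omega>, Y \<omega>))"
proof -
  have "indep_set (sets (\<F> k)) (sets (fresh k))" unfolding fresh_def by (rule indep)
  moreover have "space (fresh k) = space M" by (simp add: fresh_def)
  ultimately show "random_variable S X" "random_variable T Y"
    "distr M S X \<Otimes>\<^sub>M distr M T Y = distr M (S \<Otimes>\<^sub>M T) (\<lambda>\<omega>. (X \<omega>, Y \<omega>))"
    using distr_pair_of_indep_subalgebras[OF _ subalgebra _ assms] by blast+
qed

lemma distr_sample: "i \<in> R \<Longrightarrow> distr M (data P i) (sample P i k) = data P i"
  using sampling by (simp add: sampling_def)

lemma prob_space_data: "i \<in> R \<Longrightarrow> prob_space (data P i)"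
  using objectives by (simp add: objectives_def)

section \<open>Moments along a run\<close>

text \<open>The state at time \<open>k\<close> is independent of the sample drawn at time \<open>k\<close>, so the variance bound at a
  fixed point transfers to the random iterate.\<close>
lemma grad_noise_moments:
  assumes i: "i \<in> R"
  shows "square_integrable M (\<lambda>\<omega>. grad_noise k \<omega> i)" "expectation (\<lambda>\<omega>. (norm (grad_noise k \<omega> i))\<^sup>2) \<le> \<sigma>\<^sup>2"
proof -
  let ?h = "\<lambda>(a, s). (norm (sample_grad P i a s - G i a))\<^sup>2"
  note d = distr_pair_fresh[OF measurable_iterate[OF i] measurable_fresh(1)[OF i], of k]
  have [measurable]: "G i \<in> borel_measurable borel" by (rule measurable_G[OF i])
  have sg[measurable]: "(\<lambda>z. sample_grad P i (fst z) (snd z)) \<in> borel_measurable (borel \<Otimes>\<^sub>M data P i)"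
    by (rule measurable_sample_grad[OF i]) measurable
  have h: "?h \<in> borel_measurable (borel \<Otimes>\<^sub>M data P i)"
    unfolding split_beta by measurable
  have v: "integrable (data P i) (\<lambda>s. (norm (sample_grad P i a s - G i a))\<^sup>2)"
    "(LINT s|data P i. (norm (sample_grad P i a s - G i a))\<^sup>2) \<le> \<sigma>\<^sup>2" for a
    using variance i by (auto simp: bounded_variance_heterogeneity_def)
  have E: "integrable M (\<lambda>\<omega>. (norm (grad_noise k \<omega> i))\<^sup>2)" "expectation (\<lambda>\<omega>. (norm (grad_noise k \<omega> i))\<^sup>2) \<le> \<sigma>\<^sup>2"
    using indep_expectation_le[OF d(1,2,3) h, of "\<sigma>\<^sup>2"] v by (auto simp: distr_sample[OF i] grad_noise_def)
  have "(\<lambda>\<omega>. (\<lambda>z. sample_grad P i (fst z) (snd z) - G i (fst z)) (x k \<omega> i, sample P i k \<omega>)) \<in> borel_measurable M"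
    using d(1,2) by measurable
  then have "(\<lambda>\<omega>. grad_noise k \<omega> i) \<in> borel_measurable M" by (simp add: grad_noise_def)
  with E show "square_integrable M (\<lambda>\<omega>. grad_noise k \<omega> i)" "expectation (\<lambda>\<omega>. (norm (grad_noise k \<omega> i))\<^sup>2) \<le> \<sigma>\<^sup>2"
    by (auto simp: square_integrable_def)
qed

lemma priv_noise_moments:
  assumes i: "i \<in> R"
  shows "square_integrable M (\<lambda>\<omega>. priv_noise k \<omega> i)"
    "expectation (\<lambda>\<omega>. (norm (priv_noise k \<omega> i))\<^sup>2) \<le> real CARD('n) * w2"
    "expectation (\<lambda>\<omega>. inner v (priv_noise k \<omega> i)) = 0"
proof -
  have g: "0 < noise_sd P i k" "(noise_sd P i k)\<^sup>2 \<le> (noise_cap P i)\<^sup>2"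
    "distributed M lborel (noise P i k) (\<lambda>v. ennreal (\<Prod>c\<in>UNIV. normal_density 0 (noise_sd P i k) (v $ c)))"
    using gaussian i by (auto simp: gaussian_noise_def)
  note m = gaussian_vector_moments[OF g(3,1)]
  have "(noise_cap P i)\<^sup>2 \<le> w2"
    unfolding noise_max_sq_def using R i by (intro Max_ge) auto
  with g(2) have "(noise_sd P i k)\<^sup>2 \<le> w2" by simp
  then show "square_integrable M (\<lambda>\<omega>. priv_noise k \<omega> i)"
    "expectation (\<lambda>\<omega>. (norm (priv_noise k \<omega> i))\<^sup>2) \<le> real CARD('n) * w2"
    "expectation (\<lambda>\<omega>. inner v (priv_noise k \<omega> i)) = 0"
    using m by (simp_all add: priv_noise_def mult_left_mono)
qed

lemma w2_nonneg: "0 \<le> w2"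
proof -
  obtain i where "i \<in> R" using R by blast
  then have "(noise_cap P i)\<^sup>2 \<le> w2"
    unfolding noise_max_sq_def using R by (intro Max_ge) auto
  then show ?thesis by (rule order_trans[rotated]) simp
qed

lemma noise_energy_moment:
  "integrable M (noise_energy k)" "expectation (noise_energy k) \<le> N * (\<sigma>\<^sup>2 + real CARD('n) * w2)"
proof -
  have i1: "integrable M (\<lambda>\<omega>. \<Sum>i\<in>R. (norm (grad_noise k \<omega> i))\<^sup>2)"
    and i2: "integrable M (\<lambda>\<omega>. \<Sum>i\<in>R. (norm (priv_noise k \<omega> i))\<^sup>2)"
    using grad_noise_moments priv_noise_moments by (auto simp: square_integrable_def)
  show "integrable M (noise_energy k)" unfolding noise_energy_def[abs_def] using i1 i2 by simp
  have "expectation (noise_energy k) = (\<Sum>i\<in>R. expectation (\<lambda>\<omega>. (norm (grad_noise k \<omega> i))\<^sup>2))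
      + (\<Sum>i\<in>R. expectation (\<lambda>\<omega>. (norm (priv_noise k \<omega> i))\<^sup>2))"
    unfolding noise_energy_def[abs_def] using i1 i2 grad_noise_moments priv_noise_moments
    by (simp add: square_integrable_def)
  also have "\<dots> \<le> (\<Sum>i\<in>R. \<sigma>\<^sup>2) + (\<Sum>i\<in>R. real CARD('n) * w2)"
    using grad_noise_moments priv_noise_moments by (intro add_mono sum_mono) auto
  finally show "expectation (noise_energy k) \<le> N * (\<sigma>\<^sup>2 + real CARD('n) * w2)"
    by (simp add: algebra_simps)
qed

text \<open>The Byzantine messages need not have any moments. The contraction property still dominates the next
  iterate by the half iterates of the reliable agents, almost surely.\<close>
lemma square_integrable_iterate: "i \<in> R \<Longrightarrow> square_integrable M (\<lambda>\<omega>. x k \<omega> i)"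
proof (induction k arbitrary: i)
  case 0
  show ?case by (simp add: square_integrable_const)
next
  case (Suc k)
  have half: "square_integrable M (\<lambda>\<omega>. half k \<omega> j)" if j: "j \<in> R" for j
    unfolding half_eq
    by (intro square_integrable_diff square_integrable_scaleR square_integrable_add Suc.IH j
        square_integrable_lipschitz[OF Suc.IH[OF j] lipschitz_local[OF j]]
        grad_noise_moments(1) priv_noise_moments(1))
  have yh: "square_integrable M (\<lambda>\<omega>. mixed k \<omega> i)"
    unfolding mixed_def by (intro square_integrable_sum square_integrable_scaleR half)
  have "square_integrable M (\<lambda>\<omega>. x (Suc k) \<omega> i - mixed k \<omega> i)"
  proof (rule square_integrable_bound)
    show "(\<lambda>\<omega>. x (Suc k) \<omega> i - mixed k \<omega> i) \<in> borel_measurable M"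
      using measurable_F_M[OF measurable_iterate[OF Suc.prems, of "Suc k"]] yh
      unfolding square_integrable_def by (intro borel_measurable_diff) auto
    show "integrable M (\<lambda>\<omega>. 2 * \<rho>\<^sup>2 * (\<Sum>j\<in>R. (norm (half k \<omega> j))\<^sup>2))"
      using half by (auto simp: square_integrable_def)
    show "AE \<omega> in M. (norm (x (Suc k) \<omega> i - mixed k \<omega> i))\<^sup>2 \<le> 2 * \<rho>\<^sup>2 * (\<Sum>j\<in>R. (norm (half k \<omega> j))\<^sup>2)"
      using AE_aggregation_error[of k]
    proof eventually_elim
      case (elim \<omega>)
      have "spread R (half k \<omega>) \<le> (\<Sum>j\<in>R. (norm (half k \<omega> j))\<^sup>2)"
        using spread_le[OF R(1,2), of "half k \<omega>" 0] by simp
      then have "2 * \<rho>\<^sup>2 * spread R (half k \<omega>) \<le> 2 * \<rho>\<^sup>2 * (\<Sum>j\<in>R. (norm (half k \<omega> j))\<^sup>2)"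
        by (rule mult_left_mono) simp
      with aggregation_error_sq[OF elim Suc.prems] show ?case by (rule order_trans)
    qed
  qed
  from square_integrable_add[OF this yh] show ?case by simp
qed

lemma square_integrable_xm: "square_integrable M (xm k)"
  unfolding xm_eq[abs_def] by (intro square_integrable_fmean square_integrable_iterate)

lemma integrable_D: "integrable M (D k)"
proof -
  have "square_integrable M (\<lambda>\<omega>. x k \<omega> i - xm k \<omega>)" if "i \<in> R" for i
    by (intro square_integrable_diff square_integrable_iterate square_integrable_xm that)
  then show ?thesis
    unfolding disagreement_def[abs_def] by (auto simp: square_integrable_def)
qed

text \<open>The objective is bounded below by the optimal value and above by a quadratic function.\<close>
lemma integrable_obj: "integrable M (\<lambda>\<omega>. f (xm k \<omega>))"
proof (rule Bochner_Integration.integrable_bound)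
  have d: "GDERIV f a :> grad f a" for a using GDERIV_obj by (simp add: grad_obj)
  have "continuous_on UNIV f"
    using has_derivative_continuous[OF d[unfolded gderiv_def]]
    by (simp add: continuous_at_imp_continuous_on)
  moreover have "xm k \<in> borel_measurable M"
    using square_integrable_xm by (simp add: square_integrable_def)
  ultimately show "(\<lambda>\<omega>. f (xm k \<omega>)) \<in> borel_measurable M"
    by (rule borel_measurable_continuous_on)
  let ?B = "\<lambda>\<omega>. \<bar>fstar\<bar> + \<bar>f 0\<bar> + (norm (grad f 0))\<^sup>2 + (1 + L / 2) * (norm (xm k \<omega>))\<^sup>2"
  show "integrable M ?B"
    using square_integrable_xm by (auto simp: square_integrable_def)
  show "AE \<omega> in M. norm (f (xm k \<omega>)) \<le> norm (?B \<omega>)"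
  proof (rule AE_I2)
    fix \<omega>
    let ?a = "xm k \<omega>"
    have "f ?a \<le> f 0 + inner (grad f 0) ?a + L / 2 * (norm ?a)\<^sup>2"
      using lipschitz_grad_descent[OF d lipschitz_obj, of ?a 0] by simp
    moreover have "inner (grad f 0) ?a \<le> norm (grad f 0) * norm ?a" by (rule norm_cauchy_schwarz)
    moreover have "2 * (norm (grad f 0) * norm ?a) \<le> (norm (grad f 0))\<^sup>2 + (norm ?a)\<^sup>2"
      using sum_squares_bound[of "norm (grad f 0)" "norm ?a"] by (simp add: mult.assoc)
    moreover have "0 \<le> norm (grad f 0) * norm ?a" by simp
    moreover have "0 \<le> L / 2 * (norm ?a)\<^sup>2" using L_pos by simp
    moreover have "(1 + L / 2) * (norm ?a)\<^sup>2 = (norm ?a)\<^sup>2 + L / 2 * (norm ?a)\<^sup>2"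
      by (simp add: algebra_simps)
    moreover note fstar_le[of ?a]
    ultimately have "\<bar>f ?a\<bar> \<le> ?B \<omega>"
      using zero_le_power2[of "norm ?a"] zero_le_power2[of "norm (grad f 0)"] by linarith
    then show "norm (f ?a) \<le> norm (?B \<omega>)" by simp
  qed
qed

lemma square_integrable_grad: "square_integrable M (\<lambda>\<omega>. grad f (xm k \<omega>))"
  by (rule square_integrable_lipschitz[OF square_integrable_xm lipschitz_obj])

lemma measurable_grad: "(\<lambda>\<omega>. grad f (xm k \<omega>)) \<in> borel_measurable (\<F> k)"
proof (rule borel_measurable_continuous_on[OF _ measurable_xm])
  show "continuous_on UNIV (grad f)" by (rule lipschitz_on_continuous_on[OF lipschitz_obj])
qed

text \<open>Gradient and iterate are frozen jointly, as one \<open>\<F> k\<close>-measurable pair; for a frozen pair the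
  stochastic gradient is unbiased.\<close>
lemma expectation_grad_noise:
  assumes i: "i \<in> R"
  shows "expectation (\<lambda>\<omega>. inner (grad f (xm k \<omega>)) (grad_noise k \<omega> i)) = 0"
proof -
  let ?h = "\<lambda>((p, a), s). inner p (sample_grad P i a s - G i a)"
  let ?X = "\<lambda>\<omega>. (grad f (xm k \<omega>), x k \<omega> i)"
  have X: "?X \<in> \<F> k \<rightarrow>\<^sub>M borel \<Otimes>\<^sub>M borel"
    by (intro measurable_Pair measurable_grad measurable_iterate i)
  note d = distr_pair_fresh[OF X measurable_fresh(1)[OF i]]
  have [measurable]: "G i \<in> borel_measurable borel" by (rule measurable_G[OF i])
  have [measurable]: "(\<lambda>z. sample_grad P i (snd (fst z)) (snd z))
      \<in> borel_measurable ((borel \<Otimes>\<^sub>M borel) \<Otimes>\<^sub>M data P i)"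
    by (rule measurable_sample_grad[OF i]) measurable
  have h: "?h \<in> borel_measurable ((borel \<Otimes>\<^sub>M borel) \<Otimes>\<^sub>M data P i)"
    unfolding split_beta by measurable
  have int: "integrable M (\<lambda>\<omega>. inner (grad f (xm k \<omega>)) (grad_noise k \<omega> i))"
    by (intro integrable_inner_square_integrable square_integrable_grad grad_noise_moments i)
  interpret data: prob_space "data P i" by (rule prob_space_data[OF i])
  have "expectation (\<lambda>\<omega>. ?h (?X \<omega>, sample P i k \<omega>)) = 0"
  proof (rule indep_expectation_zero[OF d h])
    show "integrable M (\<lambda>\<omega>. ?h (?X \<omega>, sample P i k \<omega>))" using int by (simp add: grad_noise_def)
    fix z :: "(real^'n) \<times> (real^'n)"
    obtain p a where z: "z = (p, a)" by (cases z)
    have "(LINT s|data P i. inner p (sample_grad P i a s - G i a))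
        = inner p (LINT s|data P i. sample_grad P i a s - G i a)"
      using expected_sample_grad(1)[OF i] by (intro integral_inner_right) auto
    also have "\<dots> = 0"
      using expected_sample_grad[OF i] by (simp add: data.prob_space)
    finally show "(LINT s|distr M (data P i) (sample P i k). ?h (z, s)) = 0"
      by (simp add: distr_sample[OF i] z)
  qed
  then show ?thesis by (simp add: grad_noise_def)
qed

lemma expectation_grad_priv_noise:
  assumes i: "i \<in> R"
  shows "expectation (\<lambda>\<omega>. inner (grad f (xm k \<omega>)) (priv_noise k \<omega> i)) = 0"
proof -
  note d = distr_pair_fresh[OF measurable_grad measurable_fresh(2)[OF i]]
  have int: "integrable M (\<lambda>\<omega>. inner (grad f (xm k \<omega>)) (priv_noise k \<omega> i))"
    by (intro integrable_inner_square_integrable square_integrable_grad priv_noise_moments i)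
  have "expectation (\<lambda>\<omega>. (\<lambda>(p, v). inner p v) (grad f (xm k \<omega>), noise P i k \<omega>)) = 0"
  proof (rule indep_expectation_zero[OF d])
    show "(\<lambda>(p, v). inner p v) \<in> borel_measurable (borel \<Otimes>\<^sub>M borel :: ((real^'n) \<times> (real^'n)) measure)"
      unfolding split_beta by measurable
    show "integrable M (\<lambda>\<omega>. (\<lambda>(p, v). inner p v) (grad f (xm k \<omega>), noise P i k \<omega>))"
      using int by (simp add: priv_noise_def)
    fix p :: "real^'n"
    have "(LINT v|distr M borel (noise P i k). inner p v) = expectation (\<lambda>\<omega>. inner p (noise P i k \<omega>))"
      using d(2) by (intro integral_distr) auto
    then show "(LINT v|distr M borel (noise P i k). (\<lambda>(p, v). inner p v) (p, v)) = 0"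
      using priv_noise_moments(3)[OF i, of p k] by (simp add: priv_noise_def)
  qed
  then show ?thesis by (simp add: priv_noise_def)
qed

lemma square_integrable_mean_noise: "square_integrable M (mean_noise k)"
  unfolding mean_noise_def[abs_def]
  by (intro square_integrable_fmean square_integrable_add grad_noise_moments priv_noise_moments)

lemma expectation_grad_mean_noise: "expectation (\<lambda>\<omega>. inner (grad f (xm k \<omega>)) (mean_noise k \<omega>)) = 0"
proof -
  have i: "integrable M (\<lambda>\<omega>. inner (grad f (xm k \<omega>)) (grad_noise k \<omega> i))"
    "integrable M (\<lambda>\<omega>. inner (grad f (xm k \<omega>)) (priv_noise k \<omega> i))" if "i \<in> R" for i
    by (intro integrable_inner_square_integrable square_integrable_grad grad_noise_moments
        priv_noise_moments that)+
  have "expectation (\<lambda>\<omega>. inner (grad f (xm k \<omega>)) (mean_noise k \<omega>))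
    = expectation (\<lambda>\<omega>. (1 / N) * (\<Sum>i\<in>R. inner (grad f (xm k \<omega>)) (grad_noise k \<omega> i) + inner (grad f (xm k \<omega>)) (priv_noise k \<omega> i)))"
    by (simp add: mean_noise_def fmean_def inner_sum_right inner_add_right)
  also have "\<dots> = (1 / N) * (\<Sum>i\<in>R. expectation (\<lambda>\<omega>. inner (grad f (xm k \<omega>)) (grad_noise k \<omega> i))
      + expectation (\<lambda>\<omega>. inner (grad f (xm k \<omega>)) (priv_noise k \<omega> i)))"
    using i by (subst integral_mult_right_zero) (simp add: Bochner_Integration.integral_sum Bochner_Integration.integral_add)
  finally show ?thesis using expectation_grad_noise expectation_grad_priv_noise by simp
qed

section \<open>One iteration in expectation\<close>

lemma exp_disagreement_step:
  "exp_disagreement P (Suc k) \<le> (1 - \<phi>) * exp_disagreement P k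
    + 4 * N * (\<alpha> k)\<^sup>2 / \<eta> * (\<sigma>\<^sup>2 + \<zeta>\<^sup>2 + real CARD('n) * w2)"
proof -
  have "exp_disagreement P (Suc k)
      \<le> expectation (\<lambda>\<omega>. (1 - \<phi>) * D k \<omega> + 4 * (\<alpha> k)\<^sup>2 / \<eta> * (N * \<zeta>\<^sup>2 + noise_energy k \<omega>))"
    unfolding exp_disagreement_def
  proof (rule integral_mono_AE)
    show "AE \<omega> in M. D (Suc k) \<omega> \<le> (1 - \<phi>) * D k \<omega> + 4 * (\<alpha> k)\<^sup>2 / \<eta> * (N * \<zeta>\<^sup>2 + noise_energy k \<omega>)"
      using AE_aggregation_error by eventually_elim (rule disagreement_step)
  qed (use integrable_D noise_energy_moment(1) in auto)
  also have "\<dots> = (1 - \<phi>) * exp_disagreement P k + 4 * (\<alpha> k)\<^sup>2 / \<eta> * (N * \<zeta>\<^sup>2 + expectation (noise_energy k))"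
    using integrable_D noise_energy_moment(1) by (simp add: exp_disagreement_def prob_space)
  also have "\<dots> \<le> (1 - \<phi>) * exp_disagreement P k
      + 4 * (\<alpha> k)\<^sup>2 / \<eta> * (N * \<zeta>\<^sup>2 + N * (\<sigma>\<^sup>2 + real CARD('n) * w2))"
    using noise_energy_moment(2) eta by (intro add_left_mono mult_left_mono) auto
  finally show ?thesis by (simp add: algebra_simps add_divide_distrib)
qed

lemma exp_disagreement_nonneg: "0 \<le> exp_disagreement P k"
  unfolding exp_disagreement_def by (intro Bochner_Integration.integral_nonneg D_nonneg)

lemma fstar_le_exp_obj: "fstar \<le> exp_obj P k"
proof -
  have "expectation (\<lambda>\<omega>. fstar) \<le> exp_obj P k"
    unfolding exp_obj_def using integrable_obj fstar_le by (intro integral_mono) auto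
  then show ?thesis by (simp add: prob_space)
qed

text \<open>The expectation of \<open>objective_step\<close>. The term \<open>L \<alpha>\<^sup>2\<close> times the privacy noise is absorbed into the
  term of order \<open>\<alpha>\<close> with factor \<open>4 n\<close>, as \<open>L \<alpha> \<le> 1 / 4\<close>; the sampling noise of the mean keeps its
  factor \<open>\<alpha>\<^sup>2\<close>, so it survives in the limit only through the aggregation error, with factor \<open>\<rho>\<^sup>2\<close>.\<close>
lemma exp_obj_step:
  "exp_obj P (Suc k) \<le> exp_obj P k - \<alpha> k * \<nu> * (exp_obj P k - fstar)
    + (L * \<sigma>\<^sup>2 * (\<alpha> k)\<^sup>2
       + L\<^sup>2 * (96 * N * \<rho>\<^sup>2 / \<eta> + 1 / N) * (\<alpha> k * exp_disagreement P k)
       + 8 * \<rho>\<^sup>2 / (1 - \<eta>) * (exp_disagreement P k / \<alpha> k)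
       + (64 * N * \<rho>\<^sup>2 / \<eta> * (\<sigma>\<^sup>2 + \<zeta>\<^sup>2)
          + 4 * real CARD('n) * (1 + 8 * N * \<rho>\<^sup>2 / \<eta>) * w2) * \<alpha> k)"
proof -
  let ?n = "real CARD('n)"
  define d where "d = exp_disagreement P k"
  define a where "a = \<alpha> k"
  define Ee where "Ee = (\<lambda>\<omega>. \<Sum>i\<in>R. (norm (grad_noise k \<omega> i))\<^sup>2)"
  define En where "En = (\<lambda>\<omega>. \<Sum>i\<in>R. (norm (priv_noise k \<omega> i))\<^sup>2)"
  have a: "0 < a" and d: "0 \<le> d"
    using alpha_pos exp_disagreement_nonneg by (auto simp: a_def d_def)
  have i1: "integrable M Ee" and i2: "integrable M En"
    using grad_noise_moments priv_noise_moments by (auto simp: square_integrable_def Ee_def En_def)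
  have Ee: "expectation Ee \<le> N * \<sigma>\<^sup>2"
  proof -
    have "expectation Ee = (\<Sum>i\<in>R. expectation (\<lambda>\<omega>. (norm (grad_noise k \<omega> i))\<^sup>2))"
      unfolding Ee_def using grad_noise_moments by (simp add: square_integrable_def)
    also have "\<dots> \<le> (\<Sum>i\<in>R. \<sigma>\<^sup>2)" by (intro sum_mono grad_noise_moments)
    finally show ?thesis by simp
  qed
  have En: "expectation En \<le> N * (?n * w2)"
  proof -
    have "expectation En = (\<Sum>i\<in>R. expectation (\<lambda>\<omega>. (norm (priv_noise k \<omega> i))\<^sup>2))"
      unfolding En_def using priv_noise_moments by (simp add: square_integrable_def)
    also have "\<dots> \<le> (\<Sum>i\<in>R. ?n * w2)" by (intro sum_mono priv_noise_moments)
    finally show ?thesis by simp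
  qed
  let ?rhs = "\<lambda>\<omega>. f (xm k \<omega>) - a * \<nu> * (f (xm k \<omega>) - fstar)
    - a * inner (grad f (xm k \<omega>)) (mean_noise k \<omega>) + a * L\<^sup>2 / N * D k \<omega>
    + 2 * \<rho>\<^sup>2 / a * (D k \<omega> / (1 - \<eta>) + 4 * a\<^sup>2 / \<eta> * (L\<^sup>2 * D k \<omega> + N * \<zeta>\<^sup>2 + noise_energy k \<omega>))
    + L * a\<^sup>2 / N * (Ee \<omega> + 2 * En \<omega>)"
  note ints = integrable_obj[of k] integrable_D[of k] noise_energy_moment(1)[of k] i1 i2
    integrable_inner_square_integrable[OF square_integrable_grad square_integrable_mean_noise, of k]
  have "exp_obj P (Suc k) \<le> expectation ?rhs"
    unfolding exp_obj_def
  proof (rule integral_mono_AE)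
    show "AE \<omega> in M. f (xm (Suc k) \<omega>) \<le> ?rhs \<omega>"
      using AE_aggregation_error[of k]
      by eventually_elim (unfold Ee_def En_def a_def, rule objective_step)
    show "integrable M ?rhs" using ints by simp
  qed (rule integrable_obj)
  also have "\<dots> = exp_obj P k - a * \<nu> * (exp_obj P k - fstar) + a * L\<^sup>2 / N * d
    + 2 * \<rho>\<^sup>2 / a * (d / (1 - \<eta>) + 4 * a\<^sup>2 / \<eta> * (L\<^sup>2 * d + N * \<zeta>\<^sup>2 + expectation (noise_energy k)))
    + L * a\<^sup>2 / N * (expectation Ee + 2 * expectation En)"
    using ints expectation_grad_mean_noise[of k] by (simp add: exp_obj_def d_def exp_disagreement_def prob_space)
  also have "\<dots> \<le> exp_obj P k - a * \<nu> * (exp_obj P k - fstar) + a * L\<^sup>2 / N * d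
    + 2 * \<rho>\<^sup>2 / a * (d / (1 - \<eta>) + 4 * a\<^sup>2 / \<eta> * (L\<^sup>2 * d + N * \<zeta>\<^sup>2 + N * (\<sigma>\<^sup>2 + ?n * w2)))
    + L * a\<^sup>2 / N * (N * \<sigma>\<^sup>2 + 2 * (N * (?n * w2)))"
    using noise_energy_moment(2)[of k] Ee En eta a R L_pos
    by (intro add_mono order_refl mult_left_mono) auto
  also have "\<dots> \<le> exp_obj P k - a * \<nu> * (exp_obj P k - fstar)
    + (L * \<sigma>\<^sup>2 * a\<^sup>2 + L\<^sup>2 * (96 * N * \<rho>\<^sup>2 / \<eta> + 1 / N) * (a * d) + 8 * \<rho>\<^sup>2 / (1 - \<eta>) * (d / a)
       + (64 * N * \<rho>\<^sup>2 / \<eta> * (\<sigma>\<^sup>2 + \<zeta>\<^sup>2) + 4 * ?n * (1 + 8 * N * \<rho>\<^sup>2 / \<eta>) * w2) * a)"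
  proof -
    define q where "q = \<rho>\<^sup>2 / \<eta>"
    define r where "r = \<rho>\<^sup>2 / (1 - \<eta>)"
    define W where "W = ?n * w2"
    have q: "0 \<le> q" and r: "0 \<le> r" and W: "0 \<le> W"
      using eta w2_nonneg by (auto simp: q_def r_def W_def)
    have lhs: "2 * \<rho>\<^sup>2 / a * (d / (1 - \<eta>) + 4 * a\<^sup>2 / \<eta> * (L\<^sup>2 * d + N * \<zeta>\<^sup>2 + N * (\<sigma>\<^sup>2 + ?n * w2)))
      = 2 * r * (d / a) + 8 * q * L\<^sup>2 * (a * d) + 8 * N * q * (\<sigma>\<^sup>2 + \<zeta>\<^sup>2) * a + 8 * N * q * W * a"
    proof -
      have split: "2 * \<rho>\<^sup>2 / a * (d / e + 4 * a\<^sup>2 / \<eta> * Z) = 2 * (\<rho>\<^sup>2 / e) * (d / a) + 8 * q * a * Z"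
        if "e \<noteq> 0" for e Z
        using a eta that by (simp add: q_def field_simps power2_eq_square)
      show ?thesis
        using eta by (subst split) (simp_all add: r_def W_def algebra_simps)
    qed
    have noise: "L * a\<^sup>2 / N * (N * \<sigma>\<^sup>2 + 2 * (N * (?n * w2))) = L * \<sigma>\<^sup>2 * a\<^sup>2 + 2 * (L * a) * (a * W)"
      using R by (simp add: W_def field_simps power2_eq_square)
    have 1: "2 * r * (d / a) \<le> 8 * r * (d / a)"
      using r d a by (intro mult_right_mono) auto
    have 2: "8 * q * L\<^sup>2 * (a * d) \<le> 96 * N * q * L\<^sup>2 * (a * d)"
      using q R a d by (intro mult_right_mono) auto
    have 3: "8 * N * q * (\<sigma>\<^sup>2 + \<zeta>\<^sup>2) * a \<le> 64 * N * q * (\<sigma>\<^sup>2 + \<zeta>\<^sup>2) * a"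
      using q R a by (intro mult_right_mono) auto
    have 4: "8 * N * q * W * a \<le> 32 * N * q * W * a"
      using q R a W by (intro mult_right_mono) auto
    have 5: "2 * (L * a) * (a * W) \<le> 4 * (a * W)"
      using L_alpha(2)[of k] a W by (intro mult_right_mono) (auto simp: a_def)
    have rhs: "L\<^sup>2 * (96 * N * \<rho>\<^sup>2 / \<eta> + 1 / N) * (a * d) = 96 * N * q * L\<^sup>2 * (a * d) + a * L\<^sup>2 / N * d"
      "8 * \<rho>\<^sup>2 / (1 - \<eta>) * (d / a) = 8 * r * (d / a)"
      "(64 * N * \<rho>\<^sup>2 / \<eta> * (\<sigma>\<^sup>2 + \<zeta>\<^sup>2) + 4 * ?n * (1 + 8 * N * \<rho>\<^sup>2 / \<eta>) * w2) * a
        = 64 * N * q * (\<sigma>\<^sup>2 + \<zeta>\<^sup>2) * a + 4 * (a * W) + 32 * N * q * W * a"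
      by (simp_all add: q_def r_def W_def algebra_simps)
    show ?thesis unfolding lhs noise rhs using 1 2 3 4 5 by linarith
  qed
  finally show ?thesis by (simp only: a_def d_def)
qed

section \<open>The rate of the best iterate\<close>

lemma exp_obj_best_bounds:
  "fstar \<le> exp_obj_best P (Suc K)" "k \<in> {1..Suc K} \<Longrightarrow> exp_obj_best P (Suc K) \<le> exp_obj P k"
  unfolding exp_obj_best_def using fstar_le_exp_obj by (auto intro: Min_le)

text \<open>The part of the error of one step that is proportional to \<open>\<alpha>\<close>; divided by \<open>\<nu>\<close> it survives in the
  limit. All other contributions are collected in \<open>transient\<close>.\<close>
definition "bias = 64 * N * \<rho>\<^sup>2 / \<eta> * (\<sigma>\<^sup>2 + \<zeta>\<^sup>2) + 4 * real CARD('n) * (1 + 8 * N * \<rho>\<^sup>2 / \<eta>) * w2"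

definition "transient K = exp_obj P 0 - fstar + L * \<sigma>\<^sup>2 * \<theta>\<^sup>2 * (\<Sum>k=0..K. 1 / (real k + k0)\<^sup>2)
  + L\<^sup>2 * (96 * N * \<rho>\<^sup>2 / \<eta> + 1 / N) * \<theta> * (\<Sum>k=0..K. 1 / (real k + k0) * exp_disagreement P k)
  + 8 * \<rho>\<^sup>2 / (1 - \<eta>) / \<theta> * (\<Sum>k=0..K. (real k + k0) * exp_disagreement P k)"

lemma transient_nonneg: "0 \<le> transient K"
  unfolding transient_def using fstar_le_exp_obj[of 0] L_pos theta eta R exp_disagreement_nonneg k0_phi
  by (intro add_nonneg_nonneg mult_nonneg_nonneg sum_nonneg) auto

lemma ln_growth_pos: "1 \<le> K \<Longrightarrow> 0 < ln (real K + k0) - ln k0"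
  using k0_phi by simp

text \<open>The first claim before its terms are separated. The sum of the step-sizes cancels exactly against the
  \<open>bias\<close> terms and is estimated by the logarithm only in the denominator of \<open>transient\<close>.\<close>
lemma exp_obj_best_gap:
  assumes K: "1 \<le> K"
  shows "exp_obj_best P (K + 1) - fstar
    \<le> transient K / (\<theta> * \<nu> * (ln (real K + k0) - ln k0)) + bias / \<nu>"
proof -
  define m where "m = exp_obj_best P (K + 1) - fstar"
  define H where "H = (\<Sum>k=0..K. 1 / (real k + k0))"
  define l where "l = ln (real K + k0) - ln k0"
  define d where "d = exp_disagreement P"
  define c1 where "c1 = L * \<sigma>\<^sup>2"
  define c2 where "c2 = L\<^sup>2 * (96 * N * \<rho>\<^sup>2 / \<eta> + 1 / N)"
  define c3 where "c3 = 8 * \<rho>\<^sup>2 / (1 - \<eta>)"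
  define e where "e k = c1 * (\<alpha> k)\<^sup>2 + c2 * (\<alpha> k * d k) + c3 * (d k / \<alpha> k) + bias * \<alpha> k" for k
  have l: "0 < l" unfolding l_def by (rule ln_growth_pos[OF K])
  have lH: "l \<le> H" unfolding l_def H_def using k0_phi by (intro ln_le_sum_inverse) simp
  have "m * \<nu> * (\<Sum>k=0..K. \<alpha> k) \<le> (exp_obj P 0 - fstar) + (\<Sum>k=0..K. e k)"
  proof (rule best_gap_le[where \<Delta> = "\<lambda>k. exp_obj P k - fstar"])
    show "exp_obj P (Suc k) - fstar \<le> exp_obj P k - fstar - \<alpha> k * \<nu> * (exp_obj P k - fstar) + e k" for k
      using exp_obj_step[of k] unfolding e_def c1_def c2_def c3_def d_def bias_def by linarith
    have "\<theta> * \<nu> \<le> 1 * k0" using theta(2) k0_phi by simp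
    then show "\<alpha> 0 * \<nu> \<le> 1" using k0_phi by (simp add: stepsize field_simps)
    show "0 \<le> m" using exp_obj_best_bounds(1)[of K] by (simp add: m_def)
    show "m \<le> exp_obj P k - fstar" if "k \<in> {1..Suc K}" for k
      using exp_obj_best_bounds(2)[OF that] by (simp add: m_def)
  qed (use \<nu> alpha_pos fstar_le_exp_obj[of 0] in \<open>auto intro: less_imp_le\<close>)
  moreover have "(\<Sum>k=0..K. \<alpha> k) = \<theta> * H"
    by (simp add: stepsize H_def sum_distrib_left)
  moreover have "(exp_obj P 0 - fstar) + (\<Sum>k=0..K. e k) = transient K + bias * \<theta> * H"
  proof -
    have "e k = c1 * \<theta>\<^sup>2 * (1 / (real k + k0)\<^sup>2) + c2 * \<theta> * (1 / (real k + k0) * d k)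
        + c3 / \<theta> * ((real k + k0) * d k) + bias * \<theta> * (1 / (real k + k0))" for k
      by (simp add: e_def stepsize power_divide mult_ac)
    then have "(\<Sum>k=0..K. e k) = c1 * \<theta>\<^sup>2 * (\<Sum>k=0..K. 1 / (real k + k0)\<^sup>2)
        + c2 * \<theta> * (\<Sum>k=0..K. 1 / (real k + k0) * d k)
        + c3 / \<theta> * (\<Sum>k=0..K. (real k + k0) * d k) + bias * \<theta> * H"
      unfolding H_def sum_distrib_left by (simp only: sum.distrib)
    then show ?thesis by (simp add: transient_def c1_def c2_def c3_def d_def)
  qed
  ultimately have "m * (\<nu> * \<theta> * H) \<le> transient K + bias * \<theta> * H" by (simp add: mult_ac)
  then have "m \<le> (transient K + bias * \<theta> * H) / (\<nu> * \<theta> * H)"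
    using \<nu> theta(1) l lH by (simp add: pos_le_divide_eq)
  also have "\<dots> = transient K / (\<theta> * \<nu> * H) + bias / \<nu>"
    using \<nu> theta(1) l lH by (simp add: add_divide_distrib mult_ac)
  also have "transient K / (\<theta> * \<nu> * H) \<le> transient K / (\<theta> * \<nu> * l)"
    using \<nu> theta(1) l lH transient_nonneg by (intro divide_left_mono mult_left_mono) auto
  finally show ?thesis by (simp add: m_def l_def)
qed

definition "total_level = \<sigma>\<^sup>2 + \<zeta>\<^sup>2 + real CARD('n) * w2"

text \<open>The asymptotic bound on \<open>(k + k0)\<^sup>2 E D\<close>, the fixed point of the recursion in
  \<open>scaled_disagreement_le\<close>.\<close>
definition "floor_level = 16 * N * \<theta>\<^sup>2 / (\<eta> * \<phi>\<^sup>2) * total_level"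

lemma floor_level_nonneg: "0 \<le> floor_level"
  using eta w2_nonneg R by (simp add: floor_level_def total_level_def)

text \<open>Rescaling by \<open>t = k + k0\<close> multiplies the contraction factor \<open>1 - \<phi>\<close> by \<open>((t + 1) / t)\<^sup>2\<close>. Since
  \<open>\<phi> t \<ge> 2\<close> this is at most \<open>(1 + \<phi> / 2)\<^sup>2\<close>, and the product stays below \<open>1 - \<phi>\<^sup>2 / 2\<close>.\<close>
lemma scaled_disagreement_le:
  "(real k + k0)\<^sup>2 * exp_disagreement P k
     \<le> (1 - \<phi>\<^sup>2 / 2) ^ k * (k0\<^sup>2 * exp_disagreement P 0) + floor_level"
proof -
  define u where "u k = (real k + k0)\<^sup>2 * exp_disagreement P k" for k
  define Q where "Q = 4 * N / \<eta> * total_level"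
  define q where "q = 1 - \<phi>\<^sup>2 / 2"
  have Q: "0 \<le> Q" using eta w2_nonneg R by (simp add: Q_def total_level_def)
  have \<phi>1: "0 < \<phi>\<^sup>2" "\<phi>\<^sup>2 \<le> 1" using phi by (simp_all add: power_le_one)
  have "u (Suc k) \<le> q * u k + 2 * Q * \<theta>\<^sup>2" for k
  proof -
    define t where "t = real k + k0"
    have t: "0 < t" "2 \<le> \<phi> * t"
    proof -
      show "0 < t" using k0_phi by (simp add: t_def)
      have "\<phi> * k0 \<le> \<phi> * t" using phi by (simp add: t_def)
      then show "2 \<le> \<phi> * t" using k0_phi by (simp add: mult.commute)
    qed
    have r: "((t + 1) / t)\<^sup>2 \<le> (1 + \<phi> / 2)\<^sup>2"
      using t by (intro power_mono) (auto simp: field_simps)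
    have u0: "0 \<le> u k" by (simp add: u_def exp_disagreement_nonneg)
    have "u (Suc k) \<le> (t + 1)\<^sup>2 * ((1 - \<phi>) * exp_disagreement P k + 4 * N * (\<alpha> k)\<^sup>2 / \<eta> * total_level)"
      using exp_disagreement_step[of k] unfolding u_def t_def total_level_def
      by (intro mult_mono) (auto simp: exp_disagreement_nonneg algebra_simps)
    also have "\<dots> = ((t + 1) / t)\<^sup>2 * ((1 - \<phi>) * u k + Q * \<theta>\<^sup>2)"
    proof -
      have uk: "u k = t\<^sup>2 * exp_disagreement P k" and ak: "\<alpha> k = \<theta> / t"
        by (simp_all add: u_def t_def stepsize)
      show ?thesis unfolding uk ak using t by (simp add: Q_def power_divide field_simps)
    qed
    also have "\<dots> \<le> (1 + \<phi> / 2)\<^sup>2 * ((1 - \<phi>) * u k + Q * \<theta>\<^sup>2)"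
      using r phi u0 Q by (intro mult_right_mono) auto
    also have "\<dots> = (1 + \<phi> / 2)\<^sup>2 * (1 - \<phi>) * u k + (1 + \<phi> / 2)\<^sup>2 * (Q * \<theta>\<^sup>2)"
      by (simp add: algebra_simps)
    also have "\<dots> \<le> q * u k + 2 * (Q * \<theta>\<^sup>2)"
    proof (intro add_mono mult_right_mono)
      have "(1 + \<phi> / 2)\<^sup>2 * (1 - \<phi>) = 1 - 3 / 4 * \<phi>\<^sup>2 - \<phi> * \<phi>\<^sup>2 / 4"
        by (simp add: power2_eq_square field_simps)
      moreover have "0 \<le> \<phi> * \<phi>\<^sup>2" using phi by simp
      ultimately show "(1 + \<phi> / 2)\<^sup>2 * (1 - \<phi>) \<le> q"
        unfolding q_def using zero_le_power2[of \<phi>] by linarith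
      have "(1 + \<phi> / 2)\<^sup>2 \<le> (7 / 6)\<^sup>2" using phi by (intro power_mono) auto
      then show "(1 + \<phi> / 2)\<^sup>2 \<le> 2" by (simp add: power2_eq_square)
    qed (use u0 Q in auto)
    finally show ?thesis by simp
  qed
  then have "u k \<le> q ^ k * u 0 + 2 * Q * \<theta>\<^sup>2 / (1 - q)"
    by (rule affine_recursion_le) (use \<phi>1 Q in \<open>auto simp: q_def\<close>)
  also have "2 * Q * \<theta>\<^sup>2 / (1 - q) = floor_level"
    by (simp add: q_def Q_def floor_level_def)
  finally show ?thesis by (simp add: u_def q_def)
qed

text \<open>The starting point enters only through \<open>c\<close>: its share of the disagreement decays geometrically.
  The term with factor \<open>\<rho>\<^sup>2\<close> weights \<open>D = O(1 / t\<^sup>2)\<close> by \<open>t = k + k0\<close>, hence grows with the logarithm.\<close>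
lemma transient_growth:
  "\<exists>c. \<forall>K. transient K \<le> c + 8 * \<rho>\<^sup>2 / (1 - \<eta>) / \<theta> * floor_level * (ln (real K + k0) - ln k0)"
proof -
  define q where "q = 1 - \<phi>\<^sup>2 / 2"
  define u0 where "u0 = k0\<^sup>2 * exp_disagreement P 0"
  define d where "d = exp_disagreement P"
  have q: "0 \<le> q" "q < 1" using phi by (auto simp: q_def power_le_one intro: order_trans[of _ 1])
  have u0: "0 \<le> u0" by (simp add: u0_def exp_disagreement_nonneg)
  have k0_ge: "2 \<le> k0" using k0_phi by simp
  have t: "1 \<le> real k + k0" "0 < real k + k0" for k using k0_phi by auto
  have u: "(real k + k0)\<^sup>2 * d k \<le> q ^ k * u0 + floor_level" for k
    using scaled_disagreement_le[of k] by (simp add: q_def u0_def d_def)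
  have S1: "(\<Sum>k=0..K. 1 / (real k + k0) * d k) \<le> u0 + floor_level" for K
  proof -
    have "1 / (real k + k0) * d k \<le> (u0 + floor_level) * (1 / (real k + k0)\<^sup>2)" for k
    proof -
      have "q ^ k * u0 \<le> 1 * u0" using q u0 by (intro mult_right_mono) (auto simp: power_le_one)
      then have "(real k + k0)\<^sup>2 * d k \<le> u0 + floor_level" using u[of k] by simp
      then have "d k \<le> (u0 + floor_level) * (1 / (real k + k0)\<^sup>2)"
        using t[of k] by (simp add: field_simps)
      moreover have "1 / (real k + k0) * d k \<le> 1 * d k"
        using t[of k] by (intro mult_right_mono) (auto simp: d_def exp_disagreement_nonneg)
      ultimately show ?thesis by simp
    qed
    then have "(\<Sum>k=0..K. 1 / (real k + k0) * d k) \<le> (u0 + floor_level) * (\<Sum>k=0..K. 1 / (real k + k0)\<^sup>2)"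
      unfolding sum_distrib_left by (rule sum_mono)
    also have "\<dots> \<le> (u0 + floor_level) * 1"
      using sum_inverse_sq_le_1[OF k0_ge] u0 floor_level_nonneg by (intro mult_left_mono) auto
    finally show ?thesis by simp
  qed
  have S3: "(\<Sum>k=0..K. (real k + k0) * d k) \<le> u0 / (1 - q) + floor_level + floor_level * (ln (real K + k0) - ln k0)" for K
  proof -
    have "(real k + k0) * d k \<le> u0 * q ^ k + floor_level * (1 / (real k + k0))" for k
    proof -
      have "(real k + k0) * d k = ((real k + k0)\<^sup>2 * d k) / (real k + k0)"
        using t[of k] by (simp add: power2_eq_square)
      also have "\<dots> \<le> (q ^ k * u0 + floor_level) / (real k + k0)"
        using u[of k] t[of k] by (intro divide_right_mono) auto
      also have "\<dots> = q ^ k * u0 / (real k + k0) + floor_level * (1 / (real k + k0))"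
        by (simp add: add_divide_distrib)
      also have "q ^ k * u0 / (real k + k0) \<le> q ^ k * u0 / 1"
        using t[of k] q u0 by (intro divide_left_mono) auto
      finally show ?thesis by (simp add: mult.commute)
    qed
    then have "(\<Sum>k=0..K. (real k + k0) * d k)
        \<le> u0 * (\<Sum>k=0..K. q ^ k) + floor_level * (\<Sum>k=0..K. 1 / (real k + k0))"
      unfolding sum_distrib_left sum.distrib[symmetric] by (rule sum_mono)
    also have "\<dots> \<le> u0 * (1 / (1 - q)) + floor_level * (1 + (ln (real K + k0) - ln k0))"
    proof (intro add_mono mult_left_mono u0 floor_level_nonneg)
      have "(\<Sum>k=0..K. q ^ k) = (1 - q ^ Suc K) / (1 - q)"
        using sum_gp0[of q K] q by (simp add: atLeast0AtMost)
      then show "(\<Sum>k=0..K. q ^ k) \<le> 1 / (1 - q)"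
        using q by (simp add: divide_right_mono)
      show "(\<Sum>k=0..K. 1 / (real k + k0)) \<le> 1 + (ln (real K + k0) - ln k0)"
        using sum_inverse_le_ln[of k0 K] k0_ge by (auto intro: order_trans)
    qed
    finally show ?thesis by (simp add: algebra_simps)
  qed
  define c2 where "c2 = L\<^sup>2 * (96 * N * \<rho>\<^sup>2 / \<eta> + 1 / N) * \<theta>"
  define c3 where "c3 = 8 * \<rho>\<^sup>2 / (1 - \<eta>) / \<theta>"
  have c: "0 \<le> L * \<sigma>\<^sup>2 * \<theta>\<^sup>2" "0 \<le> c2" "0 \<le> c3"
    using L_pos eta R theta by (auto simp: c2_def c3_def intro!: mult_nonneg_nonneg add_nonneg_nonneg)
  have "transient K \<le> (exp_obj P 0 - fstar + L * \<sigma>\<^sup>2 * \<theta>\<^sup>2 * 1 + c2 * (u0 + floor_level) + c3 * (u0 / (1 - q) + floor_level))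
      + c3 * floor_level * (ln (real K + k0) - ln k0)" for K
  proof -
    have "transient K \<le> exp_obj P 0 - fstar + L * \<sigma>\<^sup>2 * \<theta>\<^sup>2 * 1 + c2 * (u0 + floor_level)
        + c3 * (u0 / (1 - q) + floor_level + floor_level * (ln (real K + k0) - ln k0))"
      unfolding transient_def c2_def[symmetric] c3_def[symmetric] d_def[symmetric]
      by (intro add_mono mult_left_mono order_refl c S1 S3 sum_inverse_sq_le_1 k0_ge)
    then show ?thesis by (simp add: algebra_simps)
  qed
  then show ?thesis unfolding c3_def by blast
qed

lemma exp_obj_best_limit:
  "convergent (\<lambda>K. exp_obj_best P (K + 1))"
  "lim (\<lambda>K. exp_obj_best P (K + 1)) - fstar \<le> 8 * \<rho>\<^sup>2 / (1 - \<eta>) / \<theta>\<^sup>2 / \<nu> * floor_level + bias / \<nu>"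
proof -
  let ?X = "\<lambda>K. exp_obj_best P (K + 1)"
  have "decseq ?X"
  proof (rule decseq_SucI)
    show "exp_obj_best P (Suc K + 1) \<le> exp_obj_best P (K + 1)" for K
      unfolding exp_obj_best_def by (intro Min_antimono) auto
  qed
  then show conv: "convergent ?X"
    by (rule decseq_convergent[of ?X fstar]) (use exp_obj_best_bounds(1) in \<open>auto simp: convergent_def\<close>)
  obtain c where c: "\<And>K. transient K \<le> c + 8 * \<rho>\<^sup>2 / (1 - \<eta>) / \<theta> * floor_level * (ln (real K + k0) - ln k0)"
    using transient_growth by blast
  let ?l = "\<lambda>K. ln (real K + k0) - ln k0"
  let ?b = "8 * \<rho>\<^sup>2 / (1 - \<eta>) / \<theta>\<^sup>2 / \<nu> * floor_level + bias / \<nu>"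
  have le: "?X K \<le> fstar + c / (\<theta> * \<nu>) / ?l K + ?b" if K: "1 \<le> K" for K
  proof -
    have l: "0 < ?l K" by (rule ln_growth_pos[OF K])
    have "transient K / (\<theta> * \<nu> * ?l K)
        \<le> (c + 8 * \<rho>\<^sup>2 / (1 - \<eta>) / \<theta> * floor_level * ?l K) / (\<theta> * \<nu> * ?l K)"
      using l theta \<nu> c by (intro divide_right_mono) auto
    also have "\<dots> = c / (\<theta> * \<nu>) / ?l K + 8 * \<rho>\<^sup>2 / (1 - \<eta>) / \<theta>\<^sup>2 / \<nu> * floor_level"
      using l theta \<nu> by (simp add: add_divide_distrib power2_eq_square)
    finally show ?thesis using exp_obj_best_gap[OF K] by linarith
  qed
  have "filterlim (\<lambda>K. k0 + real K) at_top sequentially"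
    by (intro filterlim_tendsto_add_at_top[OF tendsto_const] filterlim_real_sequentially)
  then have "filterlim (\<lambda>K. - ln k0 + ln (k0 + real K)) at_top sequentially"
    by (rule filterlim_tendsto_add_at_top[OF tendsto_const filterlim_compose[OF ln_at_top]])
  then have "filterlim ?l at_top sequentially" by (simp add: add.commute)
  then have "(\<lambda>K. c / (\<theta> * \<nu>) / ?l K) \<longlonglongrightarrow> 0"
    by (intro tendsto_divide_0[OF tendsto_const] filterlim_at_top_imp_at_infinity)
  then have "(\<lambda>K. fstar + c / (\<theta> * \<nu>) / ?l K + ?b) \<longlonglongrightarrow> fstar + 0 + ?b"
    by (intro tendsto_add tendsto_const)
  then have "lim ?X \<le> fstar + 0 + ?b"
    using le by (intro LIMSEQ_le[OF convergent_LIMSEQ_iff[THEN iffD1, OF conv]]) auto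
  then show "lim ?X - fstar \<le> ?b" by simp
qed

text \<open>The step-size constant cancels: \<open>floor_level\<close> is proportional to \<open>\<theta>\<^sup>2\<close>, and it is divided by \<open>\<theta>\<^sup>2\<close>. What
  remains depends on \<open>\<sigma>\<close>, \<open>\<zeta>\<close> and the noise level only through the last factor.\<close>
lemma limit_bound_le:
  "8 * \<rho>\<^sup>2 / (1 - \<eta>) / \<theta>\<^sup>2 / \<nu> * floor_level + bias / \<nu>
    \<le> (128 * N * real CARD('n) / (\<nu> * (1 - \<eta>) * \<eta> * \<phi>\<^sup>2) + 64 * N * real CARD('n) / (\<nu> * \<eta>)
        + 4 * real CARD('n) / \<nu>) * (\<rho>\<^sup>2 * (w2 + \<sigma>\<^sup>2 + \<zeta>\<^sup>2) + w2)"
proof -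
  let ?n = "real CARD('n)"
  have n: "1 \<le> ?n" by (simp add: Suc_le_eq)
  define s where "s = \<rho>\<^sup>2 * (w2 + \<sigma>\<^sup>2 + \<zeta>\<^sup>2)"
  have s: "0 \<le> s" using w2_nonneg by (simp add: s_def)
  have "1 * (\<sigma>\<^sup>2 + \<zeta>\<^sup>2) \<le> ?n * (\<sigma>\<^sup>2 + \<zeta>\<^sup>2)" using n by (intro mult_right_mono) auto
  then have total_level: "\<rho>\<^sup>2 * total_level \<le> ?n * s"
    unfolding s_def total_level_def using mult_left_mono[of "\<sigma>\<^sup>2 + \<zeta>\<^sup>2 + ?n * w2" "?n * (w2 + \<sigma>\<^sup>2 + \<zeta>\<^sup>2)" "\<rho>\<^sup>2"]
    by (simp add: algebra_simps)
  define A where "A = 128 * N / (\<nu> * (1 - \<eta>) * \<eta> * \<phi>\<^sup>2)"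
  define A' where "A' = 64 * N / (\<nu> * \<eta>)"
  have A: "0 \<le> A" "0 \<le> A'" using eta \<nu> by (simp_all add: A_def A'_def)
  have "8 * \<rho>\<^sup>2 / (1 - \<eta>) / \<theta>\<^sup>2 / \<nu> * floor_level = A * (\<rho>\<^sup>2 * total_level)"
    using theta by (simp add: floor_level_def A_def mult_ac)
  also have "\<dots> \<le> A * (?n * s)" using total_level A by (intro mult_left_mono)
  also have "\<dots> \<le> A * ?n * (s + w2)" using A w2_nonneg by (simp add: algebra_simps)
  finally have 1: "8 * \<rho>\<^sup>2 / (1 - \<eta>) / \<theta>\<^sup>2 / \<nu> * floor_level \<le> A * ?n * (s + w2)" .
  have "bias / \<nu> = A' * (\<rho>\<^sup>2 * (\<sigma>\<^sup>2 + \<zeta>\<^sup>2 + ?n / 2 * w2)) + 4 * ?n / \<nu> * w2"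
    using \<nu> eta by (simp add: bias_def A'_def field_simps)
  also have "\<rho>\<^sup>2 * (\<sigma>\<^sup>2 + \<zeta>\<^sup>2 + ?n / 2 * w2) \<le> \<rho>\<^sup>2 * total_level"
    unfolding total_level_def using w2_nonneg by (intro mult_left_mono) auto
  also note total_level
  finally have "bias / \<nu> \<le> A' * (?n * s) + 4 * ?n / \<nu> * w2" using A by (simp add: mult_left_mono)
  also have "\<dots> \<le> A' * ?n * (s + w2) + 4 * ?n / \<nu> * (s + w2)"
  proof (rule add_mono)
    show "A' * (?n * s) \<le> A' * ?n * (s + w2)" using A w2_nonneg by (simp add: algebra_simps)
    show "4 * ?n / \<nu> * w2 \<le> 4 * ?n / \<nu> * (s + w2)" using s \<nu> by (intro mult_left_mono) auto
  qed
  finally have 2: "bias / \<nu> \<le> A' * ?n * (s + w2) + 4 * ?n / \<nu> * (s + w2)" .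
  have "8 * \<rho>\<^sup>2 / (1 - \<eta>) / \<theta>\<^sup>2 / \<nu> * floor_level + bias / \<nu> \<le> (A * ?n + A' * ?n + 4 * ?n / \<nu>) * (s + w2)"
    using 1 2 by (simp add: distrib_right)
  then show ?thesis by (simp add: A_def A'_def s_def)
qed

end

theorem theorem2:
  "\<exists>C :: nat \<Rightarrow> nat \<Rightarrow> real \<Rightarrow> real \<Rightarrow> real \<Rightarrow> real \<Rightarrow> real \<Rightarrow> real.
    \<forall>(P :: ('v, 'n::finite, 's, 'w) dp_scc) (\<sigma>::real) (\<zeta>::real) (\<nu>::real) (\<rho>::real) (k0::real).
      network P \<longrightarrow> objectives P \<longrightarrow> feasible P \<longrightarrow> smooth P \<longrightarrow>
      sampling P \<longrightarrow> gaussian_noise P \<longrightarrow> nonanticipating P \<longrightarrow>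
      0 < \<sigma> \<longrightarrow> 0 < \<zeta> \<longrightarrow> bounded_variance_heterogeneity P \<sigma> \<zeta> \<longrightarrow>
      0 < \<nu> \<longrightarrow> PL_condition P \<nu> \<longrightarrow>
      nonneg_thresholds P \<longrightarrow> contraction_const P \<rho> \<longrightarrow>
      0 \<le> \<rho> \<longrightarrow> \<rho> < lambda_const P / (4 * sqrt (real (card (reliable P)))) \<longrightarrow>
      varphi_const P \<rho> \<in> {0<..<1} \<longrightarrow> eta_const P \<rho> \<in> {0<..<1} \<longrightarrow> phi_const P \<rho> \<in> {0<..<1} \<longrightarrow>
      k0 > 2 / phi_const P \<rho> \<longrightarrow>
      (\<forall>k. stepsize P k = theta_low P \<rho> \<nu> / (real k + k0)) \<longrightarrow>
      (let n = real CARD('n); R = real (card (reliable P)); L = lip_max P; w2 = noise_max_sq P;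
           \<eta> = eta_const P \<rho>; \<phi> = phi_const P \<rho>; \<theta> = theta_low P \<rho> \<nu>
       in
        (\<forall>K\<ge>1. exp_obj_best P (K + 1) - opt_val P \<le>
           (exp_obj P 0 - opt_val P) / (\<theta> * \<nu> * (ln (real K + k0) - ln k0))
           + (\<theta> * L * \<sigma>\<^sup>2 * (\<Sum>k=0..K. 1 / (real k + k0)\<^sup>2)) / (\<nu> * (ln (real K + k0) - ln k0))
           + L\<^sup>2 / \<nu> * (96 * R * \<rho>\<^sup>2 / \<eta> + 1 / R)
               * ((\<Sum>k=0..K. 1 / (real k + k0) * exp_disagreement P k) / (ln (real K + k0) - ln k0))
           + 8 * \<rho>\<^sup>2 / (\<nu> * (1 - \<eta>) * \<theta>\<^sup>2)
               * ((\<Sum>k=0..K. (real k + k0) * exp_disagreement P k) / (ln (real K + k0) - ln k0))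
           + 64 * R * \<rho>\<^sup>2 / (\<nu> * \<eta>) * (\<sigma>\<^sup>2 + \<zeta>\<^sup>2)
           + 4 * n / \<nu> * (1 + 8 * R * \<rho>\<^sup>2 / \<eta>) * w2)
        \<and>
        (\<rho> < rho_bar P \<longrightarrow>
           convergent (\<lambda>K. exp_obj_best P (K + 1)) \<and>
           lim (\<lambda>K. exp_obj_best P (K + 1)) - opt_val P \<le>
             C CARD('n) (card (reliable P)) L \<nu> \<eta> \<phi> k0 * (\<rho>\<^sup>2 * (w2 + \<sigma>\<^sup>2 + \<zeta>\<^sup>2) + w2)))"
proof (intro exI[of _ "\<lambda>n R L \<nu> \<eta> \<phi> k0. 128 * real R * real n / (\<nu> * (1 - \<eta>) * \<eta> * \<phi>\<^sup>2)
    + 64 * real R * real n / (\<nu> * \<eta>) + 4 * real n / \<nu>"] allI impI, goal_cases)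
  case (1 P \<sigma> \<zeta> \<nu> \<rho> k0)
  obtain F where F: "filtration (space (probspace P)) F"
    "\<And>k. subalgebra (probspace P) (F k)"
    "\<And>i k. i \<in> reliable P \<Longrightarrow> sample P i k \<in> F (Suc k) \<rightarrow>\<^sub>M data P i \<and>
        noise P i k \<in> F (Suc k) \<rightarrow>\<^sub>M borel \<and> threshold P i k \<in> F (Suc k) \<rightarrow>\<^sub>M borel \<and>
        (\<forall>j\<in>byz_nbrs P i. byz_msg P k j i \<in> F (Suc k) \<rightarrow>\<^sub>M borel)"
    "\<And>k. prob_space.indep_set (probspace P) (sets (F k))
        (sets (vimage_algebra (space (probspace P))
          (\<lambda>\<omega>. \<lambda>i\<in>reliable P. (sample P i k \<omega>, noise P i k \<omega>))
          (\<Pi>\<^sub>M i\<in>reliable P. data P i \<Otimes>\<^sub>M borel)))"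
    using \<open>nonanticipating P\<close> unfolding nonanticipating_def by blast
  have k0: "k0 > 2 / phi_const P \<rho>" and step: "\<And>k. stepsize P k = theta_low P \<rho> \<nu> / (real k + k0)"
    using 1 by auto
  interpret dp_scc_run P F \<sigma> \<zeta> \<nu> \<rho> k0
    by (rule dp_scc_run.intro) (fact 1 F k0 step)+
  let ?l = "\<lambda>K. ln (real K + k0) - ln k0"
  have "exp_obj_best P (K + 1) - opt_val P \<le>
           (exp_obj P 0 - opt_val P) / (\<theta> * \<nu> * ?l K)
           + (\<theta> * L * \<sigma>\<^sup>2 * (\<Sum>k=0..K. 1 / (real k + k0)\<^sup>2)) / (\<nu> * ?l K)
           + L\<^sup>2 / \<nu> * (96 * N * \<rho>\<^sup>2 / \<eta> + 1 / N)
               * ((\<Sum>k=0..K. 1 / (real k + k0) * exp_disagreement P k) / ?l K)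
           + 8 * \<rho>\<^sup>2 / (\<nu> * (1 - \<eta>) * \<theta>\<^sup>2)
               * ((\<Sum>k=0..K. (real k + k0) * exp_disagreement P k) / ?l K)
           + 64 * N * \<rho>\<^sup>2 / (\<nu> * \<eta>) * (\<sigma>\<^sup>2 + \<zeta>\<^sup>2)
           + 4 * real CARD('n) / \<nu> * (1 + 8 * N * \<rho>\<^sup>2 / \<eta>) * w2" if K: "1 \<le> K" for K
  proof -
    define l where "l = ?l K"
    have l: "l \<noteq> 0" using ln_growth_pos[OF K] by (simp add: l_def)
    have t: "\<theta> \<noteq> 0" "\<nu> \<noteq> 0" using theta \<nu> by auto
    have "(a + c1 * \<sigma>\<^sup>2 * \<theta>\<^sup>2 * s1 + c2 * \<theta> * s2 + c3 / \<theta> * s3) / (\<theta> * \<nu> * l)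
      = a / (\<theta> * \<nu> * l) + (\<theta> * c1 * \<sigma>\<^sup>2 * s1) / (\<nu> * l) + c2 / \<nu> * (s2 / l) + c3 / (\<nu> * \<theta>\<^sup>2) * (s3 / l)"
      for a c1 c2 c3 s1 s2 s3
      using l t by (simp add: add_divide_distrib power2_eq_square mult_ac)
    note split = this
    show ?thesis
      using exp_obj_best_gap[OF K] unfolding transient_def bias_def l_def[symmetric] split
      by (simp add: add_divide_distrib mult_ac)
  qed
  with exp_obj_best_limit(1) order_trans[OF exp_obj_best_limit(2) limit_bound_le]
  show ?case unfolding Let_def by simp
qed

end
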